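(* Let $Q$ be a smooth manifold, let $R_d\colon TQ\to Q\times Q$ be a discretization map on $Q$ with cotangent lift $R_d^{T^*}$, and let $H\colon T^*Q\to\mathbb{R}$ be a (smooth) Hamiltonian function. Then the equation $$\bigl(R_d^{T^*}\bigr)^{-1}(q_0,p_0;q_1,p_1)=\omega_Q^{\sharp}\Bigl(h\,\mathrm{d}H\bigl(\bigl(\tau_{T^*Q}\circ(R_d^{T^*})^{-1}\bigr)(q_0,p_0;q_1,p_1)\bigr)\Bigr),$$ with step size $h$, defines a symplectic integrator of the Hamiltonian system $(T^*Q,\omega_Q,H)$.
   Context: Discretization map: let $M$ be a smooth manifold and $U\subset TM$ an open neighborhood of the zero section. A smooth map $R_d\colon U\to M\times M$, $R_d(x,v)=(R^1(x,v),R^2(x,v))$, is a discretization map on $M$ if (1) $R_d(x,0)=(x,x)$ for all $x\in M$; and (2) for every $x\in M$, $T_{0_x}R^2_x-T_{0_x}R^1_x\colon T_{0_x}T_xM\simeq T_xM\to T_xM$ is the identity map of $T_xM$, where $R^a_x$ is the restriction of $R^a$ to (the part in $U$ of) $T_xM$, $a=1,2$. Every discretization map is a local diffeomorphism near the zero section, and inverses such as $(R_d^{T^*})^{-1}$ below are the corresponding inverses defined near the diagonal. Cotangent lift: $R_d^{T^*}=\Phi^{-1}\circ\widehat{R_d}\circ\alpha_Q$, a discretization map on $T^*Q$ (defined near the zero section of $\tau_{T^*Q}\colon TT^*Q\to T^*Q$), where - $\alpha_Q\colon TT^*Q\to T^*TQ$ is the canonical diffeomorphism, locally $\alpha_Q(q,p,\dot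 q,\dot p)=(q,\dot q,\dot p,p)$ in coordinates $(q,v,p_q,p_v)$ of $T^*TQ$; - for a (local) diffeomorphism $F\colon M_1\to M_2$, $\widehat F\colon T^*M_1\to T^*M_2$ is $\widehat F(\alpha_x)=\alpha_x\circ(T_xF)^{-1}\in T^*_{F(x)}M_2$; - $\Phi\colon T^*Q\times T^*Q\to T^*(Q\times Q)$, $\Phi(q_0,p_0;q_1,p_1)=(q_0,q_1,-p_0,p_1)$. Hamiltonian system: $\omega_Q$ is the canonical symplectic form of $T^*Q$, locally $\omega_Q=\mathrm{d}q\wedge\mathrm{d}p$; $\omega_Q^\flat(X)=i_X\omega_Q$ and $\omega_Q^\sharp=(\omega_Q^\flat)^{-1}$. The Hamiltonian vector field is $X_H=\omega_Q^\sharp(\mathrm{d}H)$, so the equation in the claim reads equivalently $(R_d^{T^*})^{-1}(q_0,p_0;q_1,p_1)=h\,X_H(\gamma)$ with $\gamma=\tau_{T^*Q}\bigl((R_d^{T^*})^{-1}(q_0,p_0;q_1,p_1)\bigr)$. Symplectic integrator: a one-step method is symplectic if its one-step map (discrete flow) is symplectic. For an implicit method this is understood locally: for every point $\alpha\in T^*Q$ there are open neighborhoods $W,W'$ of $\alpha$ and $h_0>0$ such that, for $0<h<h_0$, the equation determines for each $(q_0,p_0)\in W$ a unique $(q_1,p_1)\in W'$, and the resulting smooth map $\varphi_h\colon W\to W'$, $(q_0,p_0)\mapsto(q_1,p_1)$, satisfies $\varphi_h^*\omega_Q=\omega_Q$. *)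

theory Defs
  imports "HOL-Analysis.Analysis"
begin

section \<open>Smooth maps between open sets of Euclidean spaces\<close>

fun Ck_on :: "nat \<Rightarrow> 'e::euclidean_space set \<Rightarrow> ('e \<Rightarrow> 'f::euclidean_space) \<Rightarrow> bool" where
  "Ck_on 0 S f \<longleftrightarrow> continuous_on S f"
| "Ck_on (Suc k) S f \<longleftrightarrow>
     (\<forall>x\<in>S. f differentiable (at x)) \<and> (\<forall>v. Ck_on k S (\<lambda>x. frechet_derivative f (at x) v))"

definition smooth_on :: "'e::euclidean_space set \<Rightarrow> ('e \<Rightarrow> 'f::euclidean_space) \<Rightarrow> bool" where
  "smooth_on S f \<longleftrightarrow> open S \<and> (\<forall>k. Ck_on k S f)"


section \<open>Smooth manifolds\<close>

text \<open>A chart is a pair \<open>(U, \<phi>)\<close>; the values of \<open>\<phi>\<close> outside \<open>U\<close> are irrelevant. A manifold is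
  given by an atlas \<open>A\<close> (not assumed maximal); its underlying set is the union of the chart domains
  and its topology is the one determined by the charts.\<close>

type_synonym ('a, 'e) chart = "'a set \<times> ('a \<Rightarrow> 'e)"
type_synonym ('a, 'e) atlas = "('a, 'e) chart set"

definition points :: "('a, 'e) atlas \<Rightarrow> 'a set" where
  "points A = (\<Union>c\<in>A. fst c)"

definition chart_inv :: "('a, 'e) chart \<Rightarrow> 'e \<Rightarrow> 'a" where
  "chart_inv c = inv_into (fst c) (snd c)"

definition chart_at :: "('a, 'e) atlas \<Rightarrow> 'a \<Rightarrow> ('a, 'e) chart" where
  "chart_at A x = (SOME c. c \<in> A \<and> x \<in> fst c)"

definition smooth_atlas :: "('a, 'e::euclidean_space) atlas \<Rightarrow> bool" where
  "smooth_atlas A \<longleftrightarrow>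
     (\<forall>c\<in>A. inj_on (snd c) (fst c) \<and> open (snd c ` fst c)) \<and>
     (\<forall>c\<in>A. \<forall>d\<in>A. smooth_on (snd c ` (fst c \<inter> fst d)) (snd d \<circ> chart_inv c))"

definition manifold_top :: "('a, 'e::euclidean_space) atlas \<Rightarrow> 'a topology" where
  "manifold_top A = topology (\<lambda>W. W \<subseteq> points A \<and> (\<forall>c\<in>A. open (snd c ` (W \<inter> fst c))))"

lemma openin_manifold_top:
  fixes A :: "('a, 'e::euclidean_space) atlas"
  assumes inj: "\<And>c. c \<in> A \<Longrightarrow> inj_on (snd c) (fst c)"
  shows "openin (manifold_top A) W \<longleftrightarrow>
           W \<subseteq> points A \<and> (\<forall>c\<in>A. open (snd c ` (W \<inter> fst c)))"
proof -
  let ?L = "\<lambda>W. W \<subseteq> points A \<and> (\<forall>c\<in>A. open (snd c ` (W \<inter> fst c)))"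
  have "istopology ?L"
    unfolding istopology_def
  proof (intro conjI allI impI)
    fix S T assume S: "?L S" and T: "?L T"
    show "S \<inter> T \<subseteq> points A" using S by blast
    show "\<forall>c\<in>A. open (snd c ` (S \<inter> T \<inter> fst c))"
    proof
      fix c assume c: "c \<in> A"
      have "snd c ` (S \<inter> T \<inter> fst c) = snd c ` (S \<inter> fst c) \<inter> snd c ` (T \<inter> fst c)"
        using inj[OF c] by (auto simp: inj_on_def)
      then show "open (snd c ` (S \<inter> T \<inter> fst c))" using S T c by auto
    qed
  next
    fix K assume K: "\<forall>S\<in>K. ?L S"
    show "\<Union>K \<subseteq> points A" using K by blast
    show "\<forall>c\<in>A. open (snd c ` (\<Union>K \<inter> fst c))"
    proof
      fix c assume c: "c \<in> A"
      have "snd c ` (\<Union>K \<inter> fst c) = (\<Union>S\<in>K. snd c ` (S \<inter> fst c))" by auto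
      then show "open (snd c ` (\<Union>K \<inter> fst c))" using K c by auto
    qed
  qed
  then show ?thesis by (simp add: manifold_top_def)
qed

definition smooth_manifold :: "('a, 'e::euclidean_space) atlas \<Rightarrow> bool" where
  "smooth_manifold A \<longleftrightarrow>
     smooth_atlas A \<and> Hausdorff_space (manifold_top A) \<and> second_countable (manifold_top A)"

definition prod_atlas ::
  "('a, 'e::euclidean_space) atlas \<Rightarrow> ('b, 'f::euclidean_space) atlas \<Rightarrow> ('a \<times> 'b, 'e \<times> 'f) atlas"
  where
  "prod_atlas A B = {(fst c \<times> fst d, map_prod (snd c) (snd d)) | c d. c \<in> A \<and> d \<in> B}"

definition euclidean_atlas :: "('e::euclidean_space, 'e) atlas" where
  "euclidean_atlas = {(UNIV, id)}"

definition smooth_map ::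
  "('a, 'e::euclidean_space) atlas \<Rightarrow> ('b, 'f::euclidean_space) atlas \<Rightarrow> 'a set \<Rightarrow> ('a \<Rightarrow> 'b) \<Rightarrow> bool"
  where
  "smooth_map A B S F \<longleftrightarrow>
     openin (manifold_top A) S \<and>
     (\<forall>x\<in>S. \<exists>c\<in>A. \<exists>d\<in>B. \<exists>N. openin (manifold_top A) N \<and> x \<in> N \<and> N \<subseteq> S \<inter> fst c \<and>
        F ` N \<subseteq> fst d \<and> smooth_on (snd c ` N) (snd d \<circ> F \<circ> chart_inv c))"

definition diffeomorphism ::
  "('a, 'e::euclidean_space) atlas \<Rightarrow> ('b, 'f::euclidean_space) atlas \<Rightarrow> 'a set \<Rightarrow> 'b set \<Rightarrow>
   ('a \<Rightarrow> 'b) \<Rightarrow> bool" where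
  "diffeomorphism A B V D F \<longleftrightarrow>
     bij_betw F V D \<and> smooth_map A B V F \<and> smooth_map B A D (inv_into V F)"


section \<open>Tangent and cotangent bundles\<close>

text \<open>A tangent vector at \<open>x\<close> is a family of coordinate vectors, one for each chart around \<open>x\<close>,
  related by the derivatives of the transition maps. The family is set to \<open>0\<close> at all other
  charts, so that equality of tangent vectors is equality of functions.\<close>

type_synonym ('a, 'e) tvec = "('a, 'e) chart \<Rightarrow> 'e"
type_synonym ('a, 'e) tangent = "'a \<times> ('a, 'e) tvec"

definition tspace :: "('a, 'e::euclidean_space) atlas \<Rightarrow> 'a \<Rightarrow> ('a, 'e) tvec set" where
  "tspace A x =
     {\<xi>. (\<forall>c. \<not> (c \<in> A \<and> x \<in> fst c) \<longrightarrow> \<xi> c = 0) \<and>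
         (\<forall>c\<in>A. \<forall>d\<in>A. x \<in> fst c \<inter> fst d \<longrightarrow>
            \<xi> d = frechet_derivative (snd d \<circ> chart_inv c) (at (snd c x)) (\<xi> c))}"

text \<open>The tangent vector at \<open>x\<close> with coordinates \<open>v\<close> in the chart \<open>c\<close>.\<close>

definition tvec_of :: "('a, 'e::euclidean_space) atlas \<Rightarrow> ('a, 'e) chart \<Rightarrow> 'a \<Rightarrow> 'e \<Rightarrow> ('a, 'e) tvec"
  where
  "tvec_of A c x v =
     (\<lambda>d. if d \<in> A \<and> x \<in> fst d
          then frechet_derivative (snd d \<circ> chart_inv c) (at (snd c x)) v else 0)"

definition tangent_chart :: "('a, 'e::euclidean_space) atlas \<Rightarrow> ('a, 'e) chart \<Rightarrow>
    (('a, 'e) tangent, 'e \<times> 'e) chart" where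
  "tangent_chart A c = (Sigma (fst c) (tspace A), \<lambda>(x, \<xi>). (snd c x, \<xi> c))"

definition tangent_atlas :: "('a, 'e::euclidean_space) atlas \<Rightarrow> (('a, 'e) tangent, 'e \<times> 'e) atlas"
  where
  "tangent_atlas A = tangent_chart A ` A"

text \<open>The tangent map \<open>T\<^sub>x F\<close>, computed in a chart around \<open>x\<close>; for \<open>F\<close> smooth near \<open>x\<close> the result
  does not depend on the chart.\<close>

definition tmap :: "('a, 'e::euclidean_space) atlas \<Rightarrow> ('b, 'f::euclidean_space) atlas \<Rightarrow>
    ('a \<Rightarrow> 'b) \<Rightarrow> 'a \<Rightarrow> ('a, 'e) tvec \<Rightarrow> ('b, 'f) tvec" where
  "tmap A B F x \<xi> =
     (let c = chart_at A x in
      (\<lambda>d. if d \<in> B \<and> F x \<in> fst d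
           then frechet_derivative (snd d \<circ> F \<circ> chart_inv c) (at (snd c x)) (\<xi> c) else 0))"

text \<open>A covector at \<open>x\<close> is a linear functional on the tangent space at \<open>x\<close>, extended by \<open>0\<close> to
  functions that are not tangent vectors at \<open>x\<close>.\<close>

type_synonym ('a, 'e) covec = "('a, 'e) tvec \<Rightarrow> real"
type_synonym ('a, 'e) cotangent = "'a \<times> ('a, 'e) covec"

definition cotspace :: "('a, 'e::euclidean_space) atlas \<Rightarrow> 'a \<Rightarrow> ('a, 'e) covec set" where
  "cotspace A x =
     {\<alpha>. (\<forall>\<xi>\<in>tspace A x. \<forall>\<eta>\<in>tspace A x. \<alpha> (\<lambda>c. \<xi> c + \<eta> c) = \<alpha> \<xi> + \<alpha> \<eta>) \<and>
         (\<forall>r. \<forall>\<xi>\<in>tspace A x. \<alpha> (\<lambda>c. r *\<^sub>R \<xi> c) = r * \<alpha> \<xi>) \<and>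
         (\<forall>\<xi>. \<xi> \<notin> tspace A x \<longrightarrow> \<alpha> \<xi> = 0)}"

text \<open>The fibre coordinates of a covector are its values on the coordinate vectors of the chart, so
  that \<open>\<alpha> \<xi> = p \<bullet> \<xi> c\<close> if \<open>p\<close> are the fibre coordinates of \<open>\<alpha>\<close> in \<open>c\<close>.\<close>

definition cotangent_chart :: "('a, 'e::euclidean_space) atlas \<Rightarrow> ('a, 'e) chart \<Rightarrow>
    (('a, 'e) cotangent, 'e \<times> 'e) chart" where
  "cotangent_chart A c =
     (Sigma (fst c) (cotspace A),
      \<lambda>(x, \<alpha>). (snd c x, \<Sum>b\<in>Basis. \<alpha> (tvec_of A c x b) *\<^sub>R b))"

definition cotangent_atlas ::
  "('a, 'e::euclidean_space) atlas \<Rightarrow> (('a, 'e) cotangent, 'e \<times> 'e) atlas" where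
  "cotangent_atlas A = cotangent_chart A ` A"


section \<open>Discretization maps\<close>

text \<open>The tangent space at \<open>x\<close>, a vector space, as a manifold with linear charts, and the canonical
  identification of it with its own tangent space at the origin.\<close>

definition fibre_atlas :: "('a, 'e::euclidean_space) atlas \<Rightarrow> 'a \<Rightarrow> (('a, 'e) tvec, 'e) atlas" where
  "fibre_atlas A x = {(tspace A x, \<lambda>\<xi>. \<xi> c) | c. c \<in> A \<and> x \<in> fst c}"

definition fibre_tvec ::
  "('a, 'e::euclidean_space) atlas \<Rightarrow> 'a \<Rightarrow> ('a, 'e) tvec \<Rightarrow> (('a, 'e) tvec, 'e) tvec" where
  "fibre_tvec A x \<xi> = (\<lambda>C. if C \<in> fibre_atlas A x then snd C \<xi> else 0)"

definition discretization_map :: "('a, 'e::euclidean_space) atlas \<Rightarrow> ('a, 'e) tangent set \<Rightarrow>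
    (('a, 'e) tangent \<Rightarrow> 'a \<times> 'a) \<Rightarrow> bool" where
  "discretization_map A U R \<longleftrightarrow>
     openin (manifold_top (tangent_atlas A)) U \<and>
     (\<forall>x\<in>points A. (x, \<lambda>_. 0) \<in> U) \<and>
     smooth_map (tangent_atlas A) (prod_atlas A A) U R \<and>
     (\<forall>x\<in>points A. R (x, \<lambda>_. 0) = (x, x)) \<and>
     (\<forall>x\<in>points A. \<forall>\<xi>\<in>tspace A x.
        (\<lambda>c. tmap (fibre_atlas A x) A (\<lambda>v. snd (R (x, v))) (\<lambda>_. 0) (fibre_tvec A x \<xi>) c
           - tmap (fibre_atlas A x) A (\<lambda>v. fst (R (x, v))) (\<lambda>_. 0) (fibre_tvec A x \<xi>) c) = \<xi>)"


section \<open>The cotangent lift of a discretization map\<close>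

text \<open>The canonical diffeomorphism \<open>TT\<^sup>*Q \<rightarrow> T\<^sup>*TQ\<close>, in the coordinates induced by a chart of \<open>Q\<close>
  around the base point; the result does not depend on the chart.\<close>

definition alpha_map :: "('a, 'e::euclidean_space) atlas \<Rightarrow>
    (('a, 'e) cotangent, 'e \<times> 'e) tangent \<Rightarrow> (('a, 'e) tangent, 'e \<times> 'e) cotangent" where
  "alpha_map A w =
     (let c = chart_at A (fst (fst w));
          ((q, p), (q', p')) = snd (tangent_chart (cotangent_atlas A) (cotangent_chart A c)) w
      in chart_inv (cotangent_chart (tangent_atlas A) (tangent_chart A c)) ((q, q'), (p', p)))"

definition hat :: "('a, 'e::euclidean_space) atlas \<Rightarrow> ('b, 'f::euclidean_space) atlas \<Rightarrow>
    ('a \<Rightarrow> 'b) \<Rightarrow> ('a, 'e) cotangent \<Rightarrow> ('b, 'f) cotangent" where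
  "hat A B F = (\<lambda>(x, \<alpha>).
     (F x, \<lambda>\<eta>. if \<eta> \<in> tspace B (F x) then \<alpha> (inv_into (tspace A x) (tmap A B F x) \<eta>) else 0))"

definition Phi_map :: "('a, 'e::euclidean_space) atlas \<Rightarrow>
    ('a, 'e) cotangent \<times> ('a, 'e) cotangent \<Rightarrow> ('a \<times> 'a, 'e \<times> 'e) cotangent" where
  "Phi_map A = (\<lambda>((q0, p0), (q1, p1)).
     ((q0, q1), \<lambda>\<zeta>. if \<zeta> \<in> tspace (prod_atlas A A) (q0, q1)
                     then - p0 (tmap (prod_atlas A A) A fst (q0, q1) \<zeta>)
                          + p1 (tmap (prod_atlas A A) A snd (q0, q1) \<zeta>)
                     else 0))"

definition cotangent_lift :: "('a, 'e::euclidean_space) atlas \<Rightarrow>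
    (('a, 'e) tangent \<Rightarrow> 'a \<times> 'a) \<Rightarrow>
    (('a, 'e) cotangent, 'e \<times> 'e) tangent \<Rightarrow> ('a, 'e) cotangent \<times> ('a, 'e) cotangent" where
  "cotangent_lift A R =
     inv_into (points (cotangent_atlas A) \<times> points (cotangent_atlas A)) (Phi_map A)
     \<circ> hat (tangent_atlas A) (prod_atlas A A) R \<circ> alpha_map A"

text \<open>The lift is defined over those points of \<open>U\<close> near which \<open>R\<close> is a local diffeomorphism.\<close>

definition cotangent_lift_dom :: "('a, 'e::euclidean_space) atlas \<Rightarrow> ('a, 'e) tangent set \<Rightarrow>
    (('a, 'e) tangent \<Rightarrow> 'a \<times> 'a) \<Rightarrow> (('a, 'e) cotangent, 'e \<times> 'e) tangent set" where
  "cotangent_lift_dom A U R =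
     {w \<in> points (tangent_atlas (cotangent_atlas A)).
        \<exists>V D. fst (alpha_map A w) \<in> V \<and> V \<subseteq> U \<and>
              diffeomorphism (tangent_atlas A) (prod_atlas A A) V D R}"

text \<open>The set \<open>V\<close> selects a local inverse, defined on the open set \<open>D\<close>, of the cotangent lift.
  If \<open>V\<close> contains the zero section then \<open>D\<close> is a neighborhood of the diagonal.\<close>

definition lift_invertible_on :: "('a, 'e::euclidean_space) atlas \<Rightarrow> ('a, 'e) tangent set \<Rightarrow>
    (('a, 'e) tangent \<Rightarrow> 'a \<times> 'a) \<Rightarrow> (('a, 'e) cotangent, 'e \<times> 'e) tangent set \<Rightarrow>
    (('a, 'e) cotangent \<times> ('a, 'e) cotangent) set \<Rightarrow> bool" where
  "lift_invertible_on A U R V D \<longleftrightarrow>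
     V \<subseteq> cotangent_lift_dom A U R \<and>
     diffeomorphism (tangent_atlas (cotangent_atlas A))
       (prod_atlas (cotangent_atlas A) (cotangent_atlas A)) V D (cotangent_lift A R)"


section \<open>Hamiltonian systems and symplectic integrators\<close>

text \<open>The canonical symplectic form \<open>dq \<and> dp\<close>, with \<open>(dq \<and> dp)(X, Y) = X\<^sub>q \<bullet> Y\<^sub>p - Y\<^sub>q \<bullet> X\<^sub>p\<close>,
  in the coordinates induced by a chart of \<open>Q\<close>; the value does not depend on the chart.\<close>

definition omega :: "('a, 'e::euclidean_space) atlas \<Rightarrow> ('a, 'e) cotangent \<Rightarrow>
    (('a, 'e) cotangent, 'e \<times> 'e) tvec \<Rightarrow> (('a, 'e) cotangent, 'e \<times> 'e) tvec \<Rightarrow> real" where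
  "omega A z X Y =
     (let C = cotangent_chart A (chart_at A (fst z))
      in fst (X C) \<bullet> snd (Y C) - fst (Y C) \<bullet> snd (X C))"

definition omega_flat :: "('a, 'e::euclidean_space) atlas \<Rightarrow> ('a, 'e) cotangent \<Rightarrow>
    (('a, 'e) cotangent, 'e \<times> 'e) tvec \<Rightarrow> (('a, 'e) cotangent, 'e \<times> 'e) covec" where
  "omega_flat A z X = (\<lambda>Y. if Y \<in> tspace (cotangent_atlas A) z then omega A z X Y else 0)"

definition omega_sharp :: "('a, 'e::euclidean_space) atlas \<Rightarrow>
    (('a, 'e) cotangent, 'e \<times> 'e) cotangent \<Rightarrow> (('a, 'e) cotangent, 'e \<times> 'e) tangent" where
  "omega_sharp A = (\<lambda>(z, \<beta>). (z, inv_into (tspace (cotangent_atlas A) z) (omega_flat A z) \<beta>))"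

definition differential :: "('a, 'e::euclidean_space) atlas \<Rightarrow> ('a \<Rightarrow> real) \<Rightarrow> 'a \<Rightarrow> ('a, 'e) covec"
  where
  "differential A f x =
     (\<lambda>\<xi>. if \<xi> \<in> tspace A x then tmap A euclidean_atlas f x \<xi> (UNIV, id) else 0)"

text \<open>The defining equation of the integrator, where \<open>Rinv\<close> is an inverse, defined on \<open>D\<close>, of the
  cotangent lift.\<close>

definition integrator_equation :: "('a, 'e::euclidean_space) atlas \<Rightarrow>
    (('a, 'e) cotangent \<times> ('a, 'e) cotangent \<Rightarrow> (('a, 'e) cotangent, 'e \<times> 'e) tangent) \<Rightarrow>
    (('a, 'e) cotangent \<times> ('a, 'e) cotangent) set \<Rightarrow> (('a, 'e) cotangent \<Rightarrow> real) \<Rightarrow>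
    real \<Rightarrow> ('a, 'e) cotangent \<Rightarrow> ('a, 'e) cotangent \<Rightarrow> bool" where
  "integrator_equation A Rinv D H h z0 z1 \<longleftrightarrow>
     (z0, z1) \<in> D \<and>
     (let \<gamma> = fst (Rinv (z0, z1))
      in Rinv (z0, z1) = omega_sharp A (\<gamma>, \<lambda>Y. h * differential (cotangent_atlas A) H \<gamma> Y))"

text \<open>The possibly implicit one-step method \<open>E h z0 z1\<close> is a symplectic integrator near \<open>z\<close>.\<close>

definition symplectic_integrator_at :: "('a, 'e::euclidean_space) atlas \<Rightarrow>
    (real \<Rightarrow> ('a, 'e) cotangent \<Rightarrow> ('a, 'e) cotangent \<Rightarrow> bool) \<Rightarrow> ('a, 'e) cotangent \<Rightarrow> bool" where
  "symplectic_integrator_at A E z \<longleftrightarrow>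
     (\<exists>W W' h0. openin (manifold_top (cotangent_atlas A)) W \<and> z \<in> W \<and>
        openin (manifold_top (cotangent_atlas A)) W' \<and> z \<in> W' \<and> h0 > 0 \<and>
        (\<forall>h. 0 < h \<and> h < h0 \<longrightarrow>
           (\<forall>z0\<in>W. \<exists>!z1. z1 \<in> W' \<and> E h z0 z1) \<and>
           (let \<phi> = (\<lambda>z0. THE z1. z1 \<in> W' \<and> E h z0 z1)
            in smooth_map (cotangent_atlas A) (cotangent_atlas A) W \<phi> \<and>
               (\<forall>z0\<in>W. \<forall>X\<in>tspace (cotangent_atlas A) z0. \<forall>Y\<in>tspace (cotangent_atlas A) z0.
                  omega A (\<phi> z0) (tmap (cotangent_atlas A) (cotangent_atlas A) \<phi> z0 X)
                                 (tmap (cotangent_atlas A) (cotangent_atlas A) \<phi> z0 Y)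
                  = omega A z0 X Y))))"

end

theory Submission
  imports Defs
begin

text \<open>The map \<open>\<alpha>\<^sub>Q\<close> pulls the canonical symplectic form of \<open>T\<^sup>*TQ\<close> back to the tangent lift of
  \<open>\<omega>\<^sub>Q\<close>, the cotangent lift of a diffeomorphism is symplectic, and \<open>\<Phi>\<close> turns the canonical form of
  \<open>T\<^sup>*(Q \<times> Q)\<close> into \<open>-\<omega>\<^sub>Q \<oplus> \<omega>\<^sub>Q\<close>. Hence \<open>(R\<^sub>d\<^sup>T\<^sup>*)\<^sup>*(-\<omega>\<^sub>Q \<oplus> \<omega>\<^sub>Q)\<close> is the tangent lift of \<open>\<omega>\<^sub>Q\<close>, for which
  the image of \<open>h X\<^sub>H\<close> is Lagrangian because the second derivative of \<open>H\<close> is symmetric. The solutions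
  of the integrator equation are the points \<open>R\<^sub>d\<^sup>T\<^sup>*(h X\<^sub>H(\<gamma>))\<close>; since \<open>R\<^sub>d\<^sup>T\<^sup>*(0\<^sub>\<gamma>) = (\<gamma>, \<gamma>)\<close>, the inverse
  function theorem applied to \<open>(h, \<gamma>) \<mapsto> (h, z\<^sub>0)\<close> at \<open>h = 0\<close> makes \<open>\<gamma>\<close>, and with it \<open>z\<^sub>1\<close>, a smooth function of
  \<open>(h, z\<^sub>0)\<close>.\<close>

text \<open>The definitions pick \<open>chart_at\<close> afresh at every point, so
  \<open>alpha_map\<close>, \<open>omega\<close> and \<open>tmap\<close> cannot be differentiated as
  they are written: the chosen chart may jump from point to point. Each of them is therefore first
  shown to have the same coordinate expression in every chart. For \<open>omega\<close> and
  \<open>alpha_map\<close> this rests on the symplecticity and the naturality of cotangent lifts,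
  applied to transition maps. After that a single chart of Q around the base point of z is enough,
  because all points involved lie near z. Treating h as a variable and not as a parameter yields
  neighborhoods and a bound \<open>h0\<close> that serve all small h together. Uniqueness of the
  next point is the delicate part: the domain V of the inverse is arbitrary, and a pair near (z, z)
  must be kept from being the image of a vector of V far from the zero vector at z. Continuity of
  the inverse on D excludes this.\<close>

abbreviation FD :: "('e::real_normed_vector \<Rightarrow> 'f::real_normed_vector) \<Rightarrow> 'e \<Rightarrow> 'e \<Rightarrow> 'f" where
  "FD f x \<equiv> frechet_derivative f (at x)"

section \<open>Calculus of smooth maps\<close>

lemma FD_works: "f differentiable (at x) \<Longrightarrow> (f has_derivative FD f x) (at x)"
  by (simp add: frechet_derivative_works)

lemma FD_eqI: "(f has_derivative f') (at x) \<Longrightarrow> FD f x = f'"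
  using frechet_derivative_at by metis

text \<open>\<open>frechet_derivative\<close> is a choice among all derivatives at the point.
  Functions that agree near the point have the same derivatives there, so the choices coincide, also
  at points without a derivative.\<close>

lemma FD_cong_open:
  assumes "open S" "x \<in> S" "\<And>y. y \<in> S \<Longrightarrow> f y = g y"
  shows "FD f x = FD g x"
proof -
  have "(f has_derivative f') (at x) \<longleftrightarrow> (g has_derivative f') (at x)" for f'
    using assms by (metis has_derivative_transform_within_open)
  then show ?thesis by (simp add: frechet_derivative_def)
qed

lemma differentiable_cong_open:
  assumes "open S" "x \<in> S" "\<And>y. y \<in> S \<Longrightarrow> f y = g y" "f differentiable (at x)"
  shows "g differentiable (at x)"
  using assms by (metis differentiable_def has_derivative_transform_within_open)

lemma FD_linear: "f differentiable (at x) \<Longrightarrow> linear (FD f x)"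
  by (rule linear_frechet_derivative)

section \<open>Closure properties of the classes \<open>Ck_on\<close>\<close>

lemma Ck_on_cong:
  assumes "Ck_on k S f" "open S" "\<And>x. x \<in> S \<Longrightarrow> f x = g x"
  shows "Ck_on k S g"
  using assms
proof (induction k arbitrary: f g)
  case 0
  then show ?case using continuous_on_cong by (metis Ck_on.simps(1))
next
  case (Suc k)
  have "g differentiable (at x)" if "x \<in> S" for x
    using Suc.prems that differentiable_cong_open[of S x f g] by auto
  moreover have "Ck_on k S (\<lambda>x. FD g x v)" for v
    by (rule Suc.IH[of "\<lambda>x. FD f x v"])
      (use Suc.prems FD_cong_open[of S _ f g] in auto)
  ultimately show ?case by simp
qed

lemma Ck_on_subset: "Ck_on k S f \<Longrightarrow> T \<subseteq> S \<Longrightarrow> Ck_on k T f"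
  by (induction k arbitrary: f) (auto intro: continuous_on_subset)

lemma Ck_on_Suc_imp: "Ck_on (Suc k) S f \<Longrightarrow> Ck_on k S f"
proof (induction k arbitrary: f)
  case 0
  then show ?case
    by (auto intro!: continuous_at_imp_continuous_on differentiable_imp_continuous_within)
next
  case (Suc k)
  then show ?case by (meson Ck_on.simps(2))
qed

lemma Ck_on_local:
  assumes "\<And>x. x \<in> S \<Longrightarrow> \<exists>T. open T \<and> x \<in> T \<and> Ck_on k T f"
  shows "Ck_on k S f"
  using assms
proof (induction k arbitrary: f)
  case 0
  then show ?case
    by (metis Ck_on.simps(1) continuous_at_imp_continuous_on continuous_on_eq_continuous_at)
next
  case (Suc k)
  have "f differentiable (at x)" if "x \<in> S" for x
    using Suc.prems[OF that] by auto
  moreover have "Ck_on k S (\<lambda>x. FD f x v)" for v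
    by (rule Suc.IH) (use Suc.prems in fastforce)
  ultimately show ?case by simp
qed

lemma Ck_on_const: "Ck_on k S (\<lambda>x. c)"
  by (induction k arbitrary: c) auto

lemma Ck_on_ident: "Ck_on k S (\<lambda>x. x)"
  by (cases k) (auto simp: Ck_on_const)

lemma Ck_on_bounded_linear:
  assumes "bounded_linear L" "Ck_on k S f" "open S"
  shows "Ck_on k S (\<lambda>x. L (f x))"
  using assms(2)
proof (induction k arbitrary: f)
  case 0
  then show ?case using assms(1) by (simp add: bounded_linear.continuous_on)
next
  case (Suc k)
  have d: "((\<lambda>x. L (f x)) has_derivative (\<lambda>v. L (FD f x v))) (at x)" if "x \<in> S" for x
    using Suc.prems that by (intro bounded_linear.has_derivative[OF assms(1)] FD_works) auto
  moreover have "Ck_on k S (\<lambda>x. FD (\<lambda>x. L (f x)) x v)" for v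
    by (rule Ck_on_cong[OF Suc.IH[of "\<lambda>x. FD f x v"] assms(3)])
      (use Suc.prems FD_eqI[OF d] in auto)
  ultimately show ?case by (auto simp: differentiable_def)
qed

lemma Ck_on_add:
  assumes "Ck_on k S f" "Ck_on k S g" "open S"
  shows "Ck_on k S (\<lambda>x. f x + g x)"
  using assms(1,2)
proof (induction k arbitrary: f g)
  case 0
  then show ?case by (simp add: continuous_on_add)
next
  case (Suc k)
  have d: "((\<lambda>x. f x + g x) has_derivative (\<lambda>v. FD f x v + FD g x v)) (at x)"
    if "x \<in> S" for x
    using Suc.prems that by (intro has_derivative_add FD_works) auto
  moreover have "Ck_on k S (\<lambda>x. FD (\<lambda>x. f x + g x) x v)" for v
    by (rule Ck_on_cong[OF Suc.IH[of "\<lambda>x. FD f x v" "\<lambda>x. FD g x v"] assms(3)])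
      (use Suc.prems FD_eqI[OF d] in auto)
  ultimately show ?case by (auto simp: differentiable_def)
qed

lemma Ck_on_bilinear:
  assumes "bounded_bilinear B" "Ck_on k S f" "Ck_on k S g" "open S"
  shows "Ck_on k S (\<lambda>x. B (f x) (g x))"
  using assms(2,3)
proof (induction k arbitrary: f g)
  case 0
  then show ?case using assms(1) by (simp add: bounded_bilinear.continuous_on)
next
  case (Suc k)
  have d: "((\<lambda>x. B (f x) (g x)) has_derivative (\<lambda>v. B (f x) (FD g x v) + B (FD f x v) (g x))) (at x)"
    if "x \<in> S" for x
    using Suc.prems that by (intro bounded_bilinear.FDERIV[OF assms(1)] FD_works) auto
  moreover have "Ck_on k S (\<lambda>x. FD (\<lambda>x. B (f x) (g x)) x v)" for v
  proof (rule Ck_on_cong[OF _ assms(4)])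
    show "Ck_on k S (\<lambda>x. B (f x) (FD g x v) + B (FD f x v) (g x))"
      using Suc.prems Ck_on_Suc_imp[OF Suc.prems(1)] Ck_on_Suc_imp[OF Suc.prems(2)]
      by (intro Ck_on_add Suc.IH assms(4)) simp_all
  qed (use FD_eqI[OF d] in auto)
  ultimately show ?case by (auto simp: differentiable_def)
qed

lemma Ck_on_Pair:
  assumes "Ck_on k S f" "Ck_on k S g" "open S"
  shows "Ck_on k S (\<lambda>x. (f x, g x))"
  using assms(1,2)
proof (induction k arbitrary: f g)
  case 0
  then show ?case by (simp add: continuous_on_Pair)
next
  case (Suc k)
  have d: "((\<lambda>x. (f x, g x)) has_derivative (\<lambda>v. (FD f x v, FD g x v))) (at x)" if "x \<in> S" for x
    using Suc.prems that by (intro has_derivative_Pair FD_works) auto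
  moreover have "Ck_on k S (\<lambda>x. FD (\<lambda>x. (f x, g x)) x v)" for v
    by (rule Ck_on_cong[OF Suc.IH[of "\<lambda>x. FD f x v" "\<lambda>x. FD g x v"] assms(3)])
      (use Suc.prems FD_eqI[OF d] in auto)
  ultimately show ?case by (auto simp: differentiable_def)
qed

lemma Ck_on_sum:
  assumes "\<And>i. i \<in> I \<Longrightarrow> Ck_on k S (f i)" "open S"
  shows "Ck_on k S (\<lambda>x. \<Sum>i\<in>I. f i x)"
  using assms(1)
  by (induction I rule: infinite_finite_induct) (simp_all add: Ck_on_const Ck_on_add assms(2))

lemma linear_apply_Basis:
  fixes L :: "'a::euclidean_space \<Rightarrow> 'b::real_vector"
  assumes "linear L"
  shows "L v = (\<Sum>b\<in>Basis. (v \<bullet> b) *\<^sub>R L b)"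
proof -
  have "L v = L (\<Sum>b\<in>Basis. (v \<bullet> b) *\<^sub>R b)" by (simp add: euclidean_representation)
  also have "\<dots> = (\<Sum>b\<in>Basis. (v \<bullet> b) *\<^sub>R L b)"
    using assms by (simp add: linear_sum linear_cmul o_def)
  finally show ?thesis .
qed

text \<open>\<open>Ck_on\<close> speaks only of derivatives in a fixed direction, whereas the chain
  rule applies a derivative to a vector that moves with the point. Expanding this vector in the
  basis leaves scalar coefficients times values in fixed directions.\<close>

lemma Ck_on_linear_apply:
  fixes A :: "'a::euclidean_space \<Rightarrow> 'b::euclidean_space \<Rightarrow> 'c::euclidean_space"
  assumes "\<And>x. x \<in> S \<Longrightarrow> linear (A x)" "\<And>v. Ck_on k S (\<lambda>x. A x v)" "Ck_on k S z" "open S"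
  shows "Ck_on k S (\<lambda>x. A x (z x))"
proof -
  have 1: "Ck_on k S (\<lambda>x. \<Sum>b\<in>Basis. (z x \<bullet> b) *\<^sub>R A x b)"
    by (intro Ck_on_sum Ck_on_bilinear[OF bounded_bilinear_scaleR] assms
        Ck_on_bounded_linear[OF bounded_linear_inner_left])
  show ?thesis
    by (rule Ck_on_cong[OF 1 assms(4)]) (simp add: linear_apply_Basis[OF assms(1), symmetric])
qed

text \<open>By the chain rule a directional derivative of the composition is
  \<open>FD g (f x)\<close> applied to a vector of class \<open>k\<close>. The induction is over all
  outer functions, so that its hypothesis covers the directional derivatives of \<open>g\<close>
  with the same \<open>f\<close>.\<close>

lemma Ck_on_compose:
  fixes g :: "'b::euclidean_space \<Rightarrow> 'c::euclidean_space"
  assumes "Ck_on k T g" "Ck_on k S f" "open S" "open T" "f ` S \<subseteq> T"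
  shows "Ck_on k S (\<lambda>x. g (f x))"
  using assms(1,2)
proof (induction k arbitrary: g)
  case 0
  then show ?case using assms(5) by (auto intro: continuous_on_compose2)
next
  case (Suc k)
  have d: "((\<lambda>x. g (f x)) has_derivative (\<lambda>v. FD g (f x) (FD f x v))) (at x)" if "x \<in> S" for x
  proof -
    have "f differentiable at x" "g differentiable at (f x)"
      using Suc.prems that assms(5) by auto
    then show ?thesis by (rule has_derivative_compose[OF FD_works FD_works])
  qed
  moreover have "Ck_on k S (\<lambda>x. FD (\<lambda>x. g (f x)) x v)" for v
  proof (rule Ck_on_cong[OF Ck_on_linear_apply[of S "\<lambda>x. FD g (f x)" k "\<lambda>x. FD f x v"] assms(3)])
    show "Ck_on k S (\<lambda>x. FD g (f x) v)" for v
      by (rule Suc.IH) (use Suc.prems(1) Ck_on_Suc_imp[OF Suc.prems(2)] in simp_all)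
    show "linear (FD g (f x))" if "x \<in> S" for x
      by (rule FD_linear) (use Suc.prems(1) assms(5) that in auto)
  qed (use Suc.prems(2) assms(3) FD_eqI[OF d] in auto)
  ultimately show ?case by (auto simp: differentiable_def)
qed


section \<open>Smooth maps and their derivatives on open sets\<close>

lemma smooth_on_open: "smooth_on S f \<Longrightarrow> open S"
  by (simp add: smooth_on_def)

lemma smooth_on_cong:
  "smooth_on S f \<Longrightarrow> (\<And>x. x \<in> S \<Longrightarrow> f x = g x) \<Longrightarrow> smooth_on S g"
  by (auto simp: smooth_on_def intro: Ck_on_cong)

lemma smooth_on_subset: "smooth_on S f \<Longrightarrow> open T \<Longrightarrow> T \<subseteq> S \<Longrightarrow> smooth_on T f"
  by (auto simp: smooth_on_def intro: Ck_on_subset)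

lemma smooth_on_local:
  assumes "\<And>x. x \<in> S \<Longrightarrow> \<exists>T. x \<in> T \<and> T \<subseteq> S \<and> smooth_on T f"
  shows "smooth_on S f"
  unfolding smooth_on_def
proof (intro conjI allI)
  show "open S" using assms by (subst open_subopen) (meson smooth_on_def)
  show "Ck_on k S f" for k by (rule Ck_on_local) (use assms in \<open>meson smooth_on_def\<close>)
qed

lemma smooth_on_continuous_on: "smooth_on S f \<Longrightarrow> continuous_on S f"
  unfolding smooth_on_def by (metis Ck_on.simps(1))

lemma smooth_on_differentiable: "smooth_on S f \<Longrightarrow> x \<in> S \<Longrightarrow> f differentiable (at x)"
  unfolding smooth_on_def by (metis Ck_on.simps(2))

lemma smooth_on_has_derivative: "smooth_on S f \<Longrightarrow> x \<in> S \<Longrightarrow> (f has_derivative FD f x) (at x)"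
  by (simp add: FD_works smooth_on_differentiable)

lemma smooth_on_FD_linear: "smooth_on S f \<Longrightarrow> x \<in> S \<Longrightarrow> linear (FD f x)"
  by (simp add: FD_linear smooth_on_differentiable)

lemma smooth_on_const: "open S \<Longrightarrow> smooth_on S (\<lambda>x. c)"
  by (simp add: smooth_on_def Ck_on_const)

lemma smooth_on_bounded_linear:
  "bounded_linear L \<Longrightarrow> smooth_on S f \<Longrightarrow> smooth_on S (\<lambda>x. L (f x))"
  by (simp add: smooth_on_def Ck_on_bounded_linear)

lemma smooth_on_ident: "open S \<Longrightarrow> smooth_on S (\<lambda>x. x)"
  by (simp add: smooth_on_def Ck_on_ident)

lemma smooth_on_linear: "bounded_linear L \<Longrightarrow> open S \<Longrightarrow> smooth_on S L"
  using smooth_on_bounded_linear[OF _ smooth_on_ident] by blast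

lemma smooth_on_bilinear:
  "bounded_bilinear B \<Longrightarrow> smooth_on S f \<Longrightarrow> smooth_on S g \<Longrightarrow> smooth_on S (\<lambda>x. B (f x) (g x))"
  by (simp add: smooth_on_def Ck_on_bilinear)

lemma smooth_on_Pair: "smooth_on S f \<Longrightarrow> smooth_on S g \<Longrightarrow> smooth_on S (\<lambda>x. (f x, g x))"
  by (simp add: smooth_on_def Ck_on_Pair)

lemma smooth_on_fst: "smooth_on S f \<Longrightarrow> smooth_on S (\<lambda>x. fst (f x))"
  by (rule smooth_on_bounded_linear[OF bounded_linear_fst])

lemma smooth_on_snd: "smooth_on S f \<Longrightarrow> smooth_on S (\<lambda>x. snd (f x))"
  by (rule smooth_on_bounded_linear[OF bounded_linear_snd])

lemma smooth_on_minus: "smooth_on S f \<Longrightarrow> smooth_on S (\<lambda>x. - f x)"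
  by (rule smooth_on_bounded_linear[OF bounded_linear_minus[OF bounded_linear_ident]])

lemma smooth_on_sum:
  "open S \<Longrightarrow> (\<And>i. i \<in> I \<Longrightarrow> smooth_on S (f i)) \<Longrightarrow> smooth_on S (\<lambda>x. \<Sum>i\<in>I. f i x)"
  by (auto simp: smooth_on_def intro!: Ck_on_sum)

lemma smooth_on_compose:
  fixes g :: "'b::euclidean_space \<Rightarrow> 'c::euclidean_space"
  assumes "smooth_on T g" "smooth_on S f" "\<And>x. x \<in> S \<Longrightarrow> f x \<in> T"
  shows "smooth_on S (\<lambda>x. g (f x))"
  using assms by (auto simp: smooth_on_def intro!: Ck_on_compose[of _ T g S f])

lemma smooth_on_FD:
  fixes f :: "'b::euclidean_space \<Rightarrow> 'c::euclidean_space"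
  assumes f: "smooth_on T f" and g: "smooth_on S g" and v: "smooth_on S v"
    and sub: "\<And>x. x \<in> S \<Longrightarrow> g x \<in> T"
  shows "smooth_on S (\<lambda>x. FD f (g x) (v x))"
proof -
  have 1: "smooth_on T (\<lambda>x. FD f x v)" for v
    using f unfolding smooth_on_def by (metis Ck_on.simps(2))
  have S: "open S" using g by (rule smooth_on_open)
  have 2: "Ck_on k S (\<lambda>x. FD f (g x) v)" for k v
    using smooth_on_compose[OF 1 g sub] by (simp add: smooth_on_def)
  have 3: "linear (FD f (g x))" if "x \<in> S" for x
    using f sub that smooth_on_FD_linear by blast
  have "Ck_on k S (\<lambda>x. FD f (g x) (v x))" for k
    by (rule Ck_on_linear_apply[OF 3 2 _ S]) (use v in \<open>auto simp: smooth_on_def\<close>)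
  then show ?thesis using S by (simp add: smooth_on_def)
qed

lemma smooth_on_FD_const: "smooth_on S f \<Longrightarrow> smooth_on S (\<lambda>x. FD f x v)"
  unfolding smooth_on_def by (metis Ck_on.simps(2))

lemmas smooth_on_intros = smooth_on_const smooth_on_ident smooth_on_Pair smooth_on_fst smooth_on_snd
  smooth_on_minus smooth_on_bilinear[OF bounded_bilinear_scaleR]
  smooth_on_bilinear[OF bounded_bilinear_inner] smooth_on_sum

lemma FD_compose:
  assumes "g differentiable (at (f x))" "f differentiable (at x)"
  shows "FD (\<lambda>x. g (f x)) x = (\<lambda>v. FD g (f x) (FD f x v))"
  by (rule FD_eqI, rule has_derivative_compose[OF FD_works[OF assms(2)] FD_works[OF assms(1)]])

subsection \<open>Symmetry of the second derivative\<close>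

lemma has_derivative_line:
  fixes f :: "'a::euclidean_space \<Rightarrow> 'b::euclidean_space"
  assumes "f differentiable (at (a + t *\<^sub>R u))"
  shows "((\<lambda>t. f (a + t *\<^sub>R u)) has_derivative (\<lambda>s. s *\<^sub>R FD f (a + t *\<^sub>R u) u)) (at t within T)"
proof -
  have "((\<lambda>t. a + t *\<^sub>R u) has_derivative (\<lambda>s. s *\<^sub>R u)) (at t)"
    by (auto intro!: derivative_eq_intros)
  from has_derivative_compose[OF this FD_works[OF assms]]
  show ?thesis
    by (simp add: linear_cmul[OF FD_linear[OF assms]] has_derivative_at_withinI)
qed

text \<open>The second difference over a parallelogram is the increment, in direction
  \<open>u\<close>, of the increment of \<open>f\<close> in direction \<open>v\<close>. Two
  applications of the mean value theorem, one for each direction, turn it into a mixed second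
  derivative at one point of the parallelogram.\<close>

lemma second_difference_mean_value:
  fixes f :: "'a::euclidean_space \<Rightarrow> real"
  assumes f: "smooth_on S f" and "t > 0"
    and sub: "\<And>r s. r \<in> {0..t} \<Longrightarrow> s \<in> {0..t} \<Longrightarrow> x + r *\<^sub>R u + s *\<^sub>R v \<in> S"
  obtains r s where "r \<in> {0..t}" "s \<in> {0..t}"
    "f (x + t *\<^sub>R u + t *\<^sub>R v) - f (x + t *\<^sub>R u) - f (x + t *\<^sub>R v) + f x
      = t * t * FD (\<lambda>x. FD f x u) (x + r *\<^sub>R u + s *\<^sub>R v) v"
proof -
  define F where "F = (\<lambda>r. f (x + t *\<^sub>R v + r *\<^sub>R u) - f (x + r *\<^sub>R u))"
  have sub': "x + t *\<^sub>R v + r *\<^sub>R u \<in> S" "x + r *\<^sub>R u \<in> S" if "r \<in> {0..t}" for r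
    using sub[OF that, of t] sub[OF that, of 0] \<open>t > 0\<close> by (auto simp: algebra_simps)
  have "(F has_derivative (\<lambda>s. s *\<^sub>R FD f (x + t *\<^sub>R v + r *\<^sub>R u) u - s *\<^sub>R FD f (x + r *\<^sub>R u) u))
      (at r within {0..t})" if "0 \<le> r" "r \<le> t" for r
    unfolding F_def
    by (intro has_derivative_diff has_derivative_line smooth_on_differentiable[OF f] sub')
      (use that in auto)
  from mvt_simple[OF \<open>t > 0\<close> this] obtain r where r: "r \<in> {0<..<t}"
    and Fr: "F t - F 0 = t * (FD f (x + t *\<^sub>R v + r *\<^sub>R u) u - FD f (x + r *\<^sub>R u) u)"
    by (auto simp: algebra_simps)
  \<comment> \<open>The value \<open>r\<close> found for direction \<open>u\<close> is now fixed;
    \<open>G\<close> is what remains as a function along \<open>v\<close>, and the increment in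
    \<open>Fr\<close> is \<open>t\<close> times that of \<open>G\<close>.\<close>
  define G where "G = (\<lambda>s. FD f (x + r *\<^sub>R u + s *\<^sub>R v) u)"
  have fu: "smooth_on S (\<lambda>x. FD f x u)"
    by (rule smooth_on_FD_const[OF f])
  have "(G has_derivative (\<lambda>k. k *\<^sub>R FD (\<lambda>x. FD f x u) (x + r *\<^sub>R u + s *\<^sub>R v) v)) (at s within {0..t})"
    if "0 \<le> s" "s \<le> t" for s
    unfolding G_def
    by (intro has_derivative_line[of "\<lambda>x. FD f x u"] smooth_on_differentiable[OF fu] sub) (use r that in auto)
  from mvt_simple[OF \<open>t > 0\<close> this] obtain s where s: "s \<in> {0<..<t}"
    and Gs: "G t - G 0 = t * FD (\<lambda>x. FD f x u) (x + r *\<^sub>R u + s *\<^sub>R v) v"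
    by auto
  have "F t - F 0 = t * (G t - G 0)" unfolding Fr G_def by (simp add: algebra_simps)
  then have "F t - F 0 = t * t * FD (\<lambda>x. FD f x u) (x + r *\<^sub>R u + s *\<^sub>R v) v"
    using Gs by simp
  then show ?thesis
    using r s that[of r s] unfolding F_def by (auto simp: algebra_simps)
qed

text \<open>The second difference does not change when \<open>u\<close> and \<open>v\<close> are
  exchanged, so it equals \<open>t * t\<close> times either mixed derivative, each at a point close
  to \<open>x\<close>. If the two mixed derivatives differed at \<open>x\<close>, continuity would
  keep them apart on a small parallelogram.\<close>

lemma second_derivative_symmetric_real:
  fixes f :: "'a::euclidean_space \<Rightarrow> real"
  assumes f: "smooth_on S f" and x: "x \<in> S"
  shows "FD (\<lambda>x. FD f x u) x v = FD (\<lambda>x. FD f x v) x u"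
proof (rule ccontr)
  define g where "g = (\<lambda>u v x. FD (\<lambda>x. FD f x u) x v)"
  assume "FD (\<lambda>x. FD f x u) x v \<noteq> FD (\<lambda>x. FD f x v) x u"
  then have ne: "dist (g u v x) (g v u x) > 0" by (simp add: g_def)
  define e where "e = dist (g u v x) (g v u x) / 2"
  have S: "open S" using f smooth_on_open by blast
  have "smooth_on S (g u v)" for u v
    unfolding g_def by (intro smooth_on_FD_const f)
  then have "isCont (g u v) x" for u v
    using x S smooth_on_continuous_on continuous_on_eq_continuous_at by blast
  then have "\<exists>d>0. \<forall>y. dist y x < d \<longrightarrow> dist (g u v y) (g u v x) < e" for u v
    using ne unfolding continuous_at_eps_delta e_def by (meson half_gt_zero)
  then obtain d1 d2 where d: "d1 > 0" "\<And>y. dist y x < d1 \<Longrightarrow> dist (g u v y) (g u v x) < e"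
     "d2 > 0" "\<And>y. dist y x < d2 \<Longrightarrow> dist (g v u y) (g v u x) < e" by meson
  obtain d3 where d3: "d3 > 0" "ball x d3 \<subseteq> S" using S x openE by blast
  define d where "d = min d1 (min d2 d3)"
  \<comment> \<open>With this \<open>t\<close> the parallelogram stays within distance
    \<open>d\<close> of \<open>x\<close>; the summand 1 keeps the denominator positive when both
    directions vanish.\<close>
  define t where "t = d / (2 * (norm u + norm v + 1))"
  have dpos: "d > 0" using d d3 by (simp add: d_def)
  have np: "norm u + norm v + 1 > 0" by (smt (verit) norm_ge_zero)
  have tpos: "t > 0" unfolding t_def using dpos np by simp
  have "t * (norm u + norm v) < t * (norm u + norm v + 1)" using tpos by simp
  also have "\<dots> \<le> t * (norm u + norm v + 1) * 2" using tpos np by simp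
  also have "\<dots> = d" unfolding t_def using np by (simp add: field_simps)
  finally have td: "t * (norm u + norm v) < d" .
  have near: "dist (x + r *\<^sub>R u + s *\<^sub>R v) x < d" if "r \<in> {0..t}" "s \<in> {0..t}" for r s
  proof -
    have "dist (x + r *\<^sub>R u + s *\<^sub>R v) x = norm (r *\<^sub>R u + s *\<^sub>R v)"
      by (simp add: dist_norm add.assoc)
    also have "\<dots> \<le> r * norm u + s * norm v"
      using that by (intro norm_triangle_le) auto
    also have "\<dots> \<le> t * norm u + t * norm v"
      using that by (intro add_mono mult_right_mono) auto
    finally show ?thesis using td by (simp add: algebra_simps)
  qed
  have near': "dist (x + r *\<^sub>R v + s *\<^sub>R u) x < d" if "r \<in> {0..t}" "s \<in> {0..t}" for r s
    using near[OF that(2,1)] by (simp add: add.assoc add.commute[of "s *\<^sub>R u"])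
  have inS: "y \<in> S" if "dist y x < d" for y
    using that d3 by (auto simp: d_def dist_commute subset_iff)
  obtain r s where rs: "r \<in> {0..t}" "s \<in> {0..t}"
    "f (x + t *\<^sub>R u + t *\<^sub>R v) - f (x + t *\<^sub>R u) - f (x + t *\<^sub>R v) + f x
      = t * t * g u v (x + r *\<^sub>R u + s *\<^sub>R v)"
    using second_difference_mean_value[OF f tpos inS[OF near]] unfolding g_def by metis
  obtain r' s' where rs': "r' \<in> {0..t}" "s' \<in> {0..t}"
    "f (x + t *\<^sub>R v + t *\<^sub>R u) - f (x + t *\<^sub>R v) - f (x + t *\<^sub>R u) + f x
      = t * t * g v u (x + r' *\<^sub>R v + s' *\<^sub>R u)"
    using second_difference_mean_value[OF f tpos inS[OF near']] unfolding g_def by metis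
  have "t * t * g u v (x + r *\<^sub>R u + s *\<^sub>R v) = t * t * g v u (x + r' *\<^sub>R v + s' *\<^sub>R u)"
    unfolding rs(3)[symmetric] rs'(3)[symmetric] by (simp add: add.assoc add.commute[of "t *\<^sub>R u"])
  then have eq: "g u v (x + r *\<^sub>R u + s *\<^sub>R v) = g v u (x + r' *\<^sub>R v + s' *\<^sub>R u)"
    using tpos by simp
  have "dist (g u v (x + r *\<^sub>R u + s *\<^sub>R v)) (g u v x) < e"
    by (rule d) (use near[OF rs(1,2)] in \<open>simp add: d_def\<close>)
  moreover have "dist (g v u (x + r' *\<^sub>R v + s' *\<^sub>R u)) (g v u x) < e"
    by (rule d) (use near'[OF rs'(1,2)] in \<open>simp add: d_def\<close>)
  ultimately have "dist (g u v x) (g v u x) < 2 * e"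
    unfolding eq dist_commute[of "g u v x"] using dist_triangle2[of "g u v x" "g v u x"]
    by (smt (verit) dist_commute)
  then show False by (simp add: e_def)
qed

lemma FD_inner_left:
  "f differentiable (at x) \<Longrightarrow> FD (\<lambda>x. f x \<bullet> b) x v = FD f x v \<bullet> b"
  by (subst FD_eqI[of _ "\<lambda>v. FD f x v \<bullet> b"]) (auto intro!: has_derivative_inner_left FD_works)

lemma second_derivative_symmetric:
  fixes f :: "'a::euclidean_space \<Rightarrow> 'b::euclidean_space"
  assumes f: "smooth_on S f" and x: "x \<in> S"
  shows "FD (\<lambda>x. FD f x u) x v = FD (\<lambda>x. FD f x v) x u"
proof (rule euclidean_eqI)
  fix b :: 'b assume "b \<in> Basis"
  have S: "open S" using f smooth_on_open by blast
  have fb: "smooth_on S (\<lambda>x. f x \<bullet> b)" by (intro smooth_on_intros f S)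
  have "FD (\<lambda>x. FD (\<lambda>x. f x \<bullet> b) x u) x v = FD (\<lambda>x. FD f x u) x v \<bullet> b" for u v
  proof -
    have "FD (\<lambda>x. FD (\<lambda>x. f x \<bullet> b) x u) x = FD (\<lambda>x. FD f x u \<bullet> b) x"
      by (rule FD_cong_open[OF S x]) (simp add: FD_inner_left smooth_on_differentiable[OF f])
    moreover have "smooth_on S (\<lambda>x. FD f x u)"
      by (rule smooth_on_FD_const[OF f])
    ultimately show ?thesis
      using FD_inner_left[OF smooth_on_differentiable[OF _ x]] by metis
  qed
  then show "FD (\<lambda>x. FD f x u) x v \<bullet> b = FD (\<lambda>x. FD f x v) x u \<bullet> b"
    using second_derivative_symmetric_real[OF fb x] by metis
qed

subsection \<open>The inverse function theorem for smooth maps\<close>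

text \<open>The joint derivative exists because the map is smooth, so it can be read off from two
  slices: varying the point gives the second derivative, varying the vector gives
  \<open>FD f x\<close> itself by linearity.\<close>

lemma has_derivative_FD_apply:
  fixes f :: "'a::euclidean_space \<Rightarrow> 'b::euclidean_space"
  assumes f: "smooth_on S f" and x: "x \<in> S"
  shows "((\<lambda>z. FD f (fst z) (snd z)) has_derivative
    (\<lambda>z. FD (\<lambda>x. FD f x v) x (fst z) + FD f x (snd z))) (at (x, v))"
proof -
  have S: "open S" using f smooth_on_open by blast
  have SU: "open (S \<times> (UNIV :: 'a set))" using S by (simp add: open_Times)
  have "smooth_on (S \<times> UNIV) (\<lambda>z. FD f (fst z) (snd z))"
    by (intro smooth_on_FD[OF f] smooth_on_intros SU) auto
  then have dif: "(\<lambda>z. FD f (fst z) (snd z)) differentiable (at (x, v))"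
    using x by (intro smooth_on_differentiable) auto
  define D where "D = FD (\<lambda>z. FD f (fst z) (snd z)) (x, v)"
  have D: "((\<lambda>z. FD f (fst z) (snd z)) has_derivative D) (at (x, v))"
    unfolding D_def by (rule FD_works[OF dif])
  have 1: "D (a, 0) = FD (\<lambda>x. FD f x v) x a" for a
  proof -
    have "((\<lambda>x. (x, v)) has_derivative (\<lambda>a. (a, 0))) (at x)"
      by (auto intro!: derivative_eq_intros)
    from has_derivative_compose[OF this, of "\<lambda>z. FD f (fst z) (snd z)" D] D
    have "((\<lambda>x. FD f x v) has_derivative (\<lambda>a. D (a, 0))) (at x)" by simp
    from FD_eqI[OF this] show ?thesis by simp
  qed
  have 2: "D (0, b) = FD f x b" for b
  proof -
    have "((\<lambda>v. (x, v)) has_derivative (\<lambda>b. (0, b))) (at v)"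
      by (auto intro!: derivative_eq_intros)
    from has_derivative_compose[OF this, of "\<lambda>z. FD f (fst z) (snd z)" D] D
    have 3: "(FD f x has_derivative (\<lambda>b. D (0, b))) (at v)" by simp
    have "(FD f x has_derivative FD f x) (at v)"
      by (simp add: bounded_linear_imp_has_derivative linear_conv_bounded_linear[symmetric]
          smooth_on_FD_linear[OF f x])
    from has_derivative_unique[OF 3 this] show ?thesis by (simp add: fun_eq_iff)
  qed
  have "linear D" using D has_derivative_linear by blast
  then have "D z = D (fst z, 0) + D (0, snd z)" for z
    by (simp add: linear_add[symmetric])
  then have "D = (\<lambda>z. FD (\<lambda>x. FD f x v) x (fst z) + FD f x (snd z))"
    by (simp add: 1 2 fun_eq_iff)
  then show ?thesis using D by simp
qed

lemma FD_inverse: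
  fixes f :: "'a::euclidean_space \<Rightarrow> 'a"
  assumes f: "smooth_on S f" and gf: "\<And>x. x \<in> S \<Longrightarrow> g (f x) = x" and x: "x \<in> S"
    and inj: "inj (FD f x)"
  shows "(g has_derivative inv (FD f x)) (at (f x))" "FD f x (FD g (f x) w) = w"
    "FD g (f x) (FD f x v) = v"
proof -
  have lin: "linear (FD f x)" using f x by (rule smooth_on_FD_linear)
  have surj: "surj (FD f x)" using lin inj by (simp add: linear_injective_imp_surjective)
  show 1: "(g has_derivative inv (FD f x)) (at (f x))"
    by (rule has_derivative_inverse_strong[OF smooth_on_open[OF f] x smooth_on_continuous_on[OF f] gf
          smooth_on_has_derivative[OF f x]])
      (use surj in \<open>auto simp: surj_iff[symmetric]\<close>)
  show "FD f x (FD g (f x) w) = w" by (simp add: FD_eqI[OF 1] surj surj_f_inv_f)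
  show "FD g (f x) (FD f x v) = v" by (simp add: FD_eqI[OF 1] inj)
qed

text \<open>The directional derivatives of \<open>g\<close> are differentiable since the tangent map of \<open>g\<close> inverts that
  of \<open>f\<close>; their derivatives are again compositions of derivatives of \<open>f\<close> and \<open>g\<close>, so each step of
  the induction gains one order of differentiability.\<close>

lemma smooth_on_inverse:
  fixes f :: "'a::euclidean_space \<Rightarrow> 'a"
  assumes f: "smooth_on S f" and gf: "\<And>x. x \<in> S \<Longrightarrow> g (f x) = x"
    and inj: "\<And>x. x \<in> S \<Longrightarrow> inj (FD f x)"
  shows "smooth_on (f ` S) g"
proof -
  let ?T = "f ` S"
  have S: "open S" using f smooth_on_open by blast
  have "inj_on f S" using gf by (metis inj_onI)
  then have T: "open ?T" using invariance_of_domain[OF smooth_on_continuous_on[OF f] S] by blast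
  have fv: "smooth_on S (\<lambda>x. FD f x v)" for v
    by (rule smooth_on_FD_const[OF f])
  define E where "E = (\<lambda>x v u. FD (\<lambda>x. FD f x v) x u)"
  have Tf: "((\<lambda>z. (f (fst z), FD f (fst z) (snd z))) has_derivative
      (\<lambda>z. (FD f x (fst z), E x v (fst z) + FD f x (snd z)))) (at (x, v))" if "x \<in> S" for x v
    unfolding E_def
    by (intro has_derivative_Pair has_derivative_FD_apply[OF f that]
        has_derivative_compose[where g = f and f = fst, simplified]
        has_derivative_fst has_derivative_ident)
      (use smooth_on_has_derivative[OF f that] in simp)
  have Elin: "linear (E x v)" if "x \<in> S" for x v
    unfolding E_def using fv that smooth_on_FD_linear by blast
  have dg: "(g has_derivative inv (FD f x)) (at (f x))"
    and fg': "FD f x (FD g (f x) w) = w" and gf': "FD g (f x) (FD f x w) = w" if "x \<in> S" for x w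
    using FD_inverse[OF f gf that inj[OF that]] by auto
  have glin: "linear (FD g y)" if "y \<in> ?T" for y
    using that dg differentiableI FD_linear by blast
  have d2g: "((\<lambda>y. FD g y w) has_derivative
      (\<lambda>u. - FD g y (E (g y) (FD g y w) (FD g y u)))) (at y)" if yT: "y \<in> ?T" for y w
  proof -
    from yT obtain x where x: "x \<in> S" "y = f x" by auto
    let ?v = "FD g y w"
    \<comment> \<open>The derivative at \<open>(x, ?v)\<close> of \<open>F\<close>, the tangent map
      of \<open>f\<close>, is block triangular with both diagonal blocks equal to
      \<open>FD f x\<close>; \<open>?D'\<close> inverts it by back substitution.\<close>
    let ?D' = "\<lambda>z. (FD g y (fst z), FD g y (snd z - E x ?v (FD g y (fst z))))"
    define F where "F = (\<lambda>z. (f (fst z), FD f (fst z) (snd z)))"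
    define G where "G = (\<lambda>z. (g (fst z), FD g (fst z) (snd z)))"
    have Sx: "open (S \<times> (UNIV::'a set))" using S by (simp add: open_Times)
    have f1: "smooth_on (S \<times> (UNIV::'a set)) (\<lambda>z. f (fst z))"
      by (rule smooth_on_compose[OF f]) (auto intro!: smooth_on_intros Sx)
    have f2: "smooth_on (S \<times> (UNIV::'a set)) (\<lambda>z. FD f (fst z) (snd z))"
      by (rule smooth_on_FD[OF f]) (auto intro!: smooth_on_intros Sx)
    have "(G has_derivative ?D') (at (F (x, ?v)))"
    proof (rule has_derivative_inverse_strong[where x = "(x, ?v)" and f = F and g = G and S = "S \<times> UNIV"])
      show "continuous_on (S \<times> (UNIV::'a set)) F"
        unfolding F_def by (rule smooth_on_continuous_on[OF smooth_on_Pair[OF f1 f2]])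
      show "(F has_derivative (\<lambda>z. (FD f x (fst z), E x ?v (fst z) + FD f x (snd z)))) (at (x, ?v))"
        unfolding F_def by (rule Tf[OF x(1)])
      show "(\<lambda>z. (FD f x (fst z), E x ?v (fst z) + FD f x (snd z))) \<circ> ?D' = id"
        using x fg' by (auto simp: fun_eq_iff)
    qed (use Sx x gf gf' in \<open>auto simp: F_def G_def\<close>)
    then have D: "((\<lambda>z. (g (fst z), FD g (fst z) (snd z))) has_derivative ?D') (at (y, w))"
      using x fg' by (simp add: F_def G_def)
    have "((\<lambda>y. (y, w)) has_derivative (\<lambda>u. (u, 0))) (at y)"
      by (auto intro!: derivative_eq_intros)
    from has_derivative_snd[OF has_derivative_compose[OF this D]]
    have "((\<lambda>y. FD g y w) has_derivative (\<lambda>u. FD g y (0 - E x ?v (FD g y u)))) (at y)" by simp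
    then show ?thesis using glin[OF yT] gf x by (simp add: linear_neg)
  qed
  \<comment> \<open>The claim is carried for \<open>g\<close> and for its directional derivatives
    together: by \<open>d2g\<close> the next derivative of the latter is built from both, at the
    same order.\<close>
  have "Ck_on k ?T g \<and> (\<forall>w. Ck_on k ?T (\<lambda>y. FD g y w))" for k
  proof (induction k)
    case 0
    have "continuous_on ?T g"
      by (rule continuous_at_imp_continuous_on) (use dg has_derivative_continuous in blast)
    moreover have "continuous_on ?T (\<lambda>y. FD g y w)" for w
      by (rule continuous_at_imp_continuous_on) (use d2g has_derivative_continuous in blast)
    ultimately show ?case by simp
  next
    case (Suc k)
    have "Ck_on k ?T (\<lambda>y. FD (\<lambda>y. FD g y w) y u)" for w u
    proof (rule Ck_on_cong[OF _ T])
      have Eg: "Ck_on k ?T (\<lambda>y. E (g y) v u)" for v u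
      proof -
        have "smooth_on S (\<lambda>x. E x v u)" unfolding E_def
          by (rule smooth_on_FD_const[OF fv])
        then have "Ck_on k S (\<lambda>x. E x v u)" by (simp add: smooth_on_def)
        then show ?thesis by (rule Ck_on_compose[OF _ _ T S]) (use Suc gf in auto)
      qed
      \<comment> \<open>Linearity of \<open>E\<close> in its first direction is not visible from its
        definition; it comes from the symmetry of the second derivative.\<close>
      have Elin': "linear (\<lambda>v. E x v u)" if "x \<in> S" for x u
      proof -
        have "E x v u = E x u v" for v
          unfolding E_def using second_derivative_symmetric[OF f that] .
        then show ?thesis using Elin[OF that] by simp
      qed
      have 1: "Ck_on k ?T (\<lambda>y. E (g y) (FD g y w) u)" for u
        by (rule Ck_on_linear_apply[of ?T "\<lambda>y v. E (g y) v u"]) (use Eg Elin' Suc T gf in auto)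
      have 2: "Ck_on k ?T (\<lambda>y. E (g y) (FD g y w) (FD g y u))"
        by (rule Ck_on_linear_apply[of ?T "\<lambda>y. E (g y) (FD g y w)" k "\<lambda>y. FD g y u"]) (use 1 Elin Suc T gf in auto)
      have 3: "Ck_on k ?T (\<lambda>y. FD g y (E (g y) (FD g y w) (FD g y u)))"
        by (rule Ck_on_linear_apply[of ?T "FD g" k "\<lambda>y. E (g y) (FD g y w) (FD g y u)"]) (use 2 glin Suc T in auto)
      show "Ck_on k ?T (\<lambda>y. - FD g y (E (g y) (FD g y w) (FD g y u)))"
        by (rule Ck_on_bounded_linear[OF bounded_linear_minus[OF bounded_linear_ident] 3 T])
      show "- FD g y (E (g y) (FD g y w) (FD g y u)) = FD (\<lambda>y. FD g y w) y u" if "y \<in> ?T" for y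
        by (simp add: FD_eqI[OF d2g[OF that]])
    qed
    moreover have "g differentiable (at y)" "(\<lambda>y. FD g y w) differentiable (at y)" if "y \<in> ?T" for y w
      using that dg d2g differentiableI by blast+
    ultimately show ?case using Suc by simp
  qed
  then show ?thesis using T by (simp add: smooth_on_def)
qed

text \<open>\<open>inverse_function_theorem\<close> yields a homeomorphism on a neighborhood where
  the derivative stays bijective. That bijectivity is what \<open>smooth_on_inverse\<close> asks for
  in order to make the inverse smooth.\<close>

lemma smooth_inverse_function:
  fixes f :: "'a::euclidean_space \<Rightarrow> 'a"
  assumes f: "smooth_on S f" and x0: "x0 \<in> S" and inj: "inj (FD f x0)"
  obtains T g where "open T" "x0 \<in> T" "T \<subseteq> S" "\<And>x. x \<in> T \<Longrightarrow> g (f x) = x" "smooth_on (f ` T) g"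
proof -
  have S: "open S" using f smooth_on_open by blast
  have bl: "bounded_linear (FD f x)" if "x \<in> S" for x
    using smooth_on_FD_linear[OF f that] by (simp add: linear_conv_bounded_linear)
  define f' where "f' = (\<lambda>x. Blinfun (FD f x))"
  have f': "blinfun_apply (f' x) = FD f x" if "x \<in> S" for x
    unfolding f'_def using bl[OF that] by (rule bounded_linear_Blinfun_apply)
  obtain i where i: "linear i" "i \<circ> FD f x0 = id"
    using linear_injective_left_inverse[OF smooth_on_FD_linear[OF f x0] inj] by blast
  obtain U V g g' where *: "open U" "U \<subseteq> S" "x0 \<in> U" "homeomorphism U V f g"
     "\<And>y. y \<in> V \<Longrightarrow> bij (blinfun_apply (f' (g y)))"
  proof (rule inverse_function_theorem[of S f f' x0 "Blinfun i"])
    show "(f has_derivative blinfun_apply (f' x)) (at x)" if "x \<in> S" for x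
      using f' smooth_on_has_derivative[OF f] that by simp
    \<comment> \<open>In finite dimension, continuity of the derivative in operator norm reduces to
      continuity in each fixed direction.\<close>
    have "continuous_on S (\<lambda>x. f' x b)" for b
    proof -
      have "smooth_on S (\<lambda>x. FD f x b)" by (rule smooth_on_FD_const[OF f])
      then show ?thesis using continuous_on_cong[OF refl, of S "\<lambda>x. f' x b" "\<lambda>x. FD f x b"] f' smooth_on_continuous_on
        by auto
    qed
    then show "continuous_on S f'" by (intro continuous_on_blinfun_componentwise)
    show "Blinfun i o\<^sub>L f' x0 = id_blinfun"
    proof (rule blinfun_eqI)
      have "i (FD f x0 v) = v" for v using i(2) by (rule pointfree_idE)
      then show "blinfun_apply (Blinfun i o\<^sub>L f' x0) v = blinfun_apply id_blinfun v" for v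
        using i(1) f'[OF x0] by (simp add: bounded_linear_Blinfun_apply linear_conv_bounded_linear)
    qed
  qed (use S x0 in auto)
  have gf: "g (f x) = x" and fV: "f x \<in> V" if "x \<in> U" for x
    using *(4) that by (auto simp: homeomorphism_def)
  have "inj (FD f x)" if "x \<in> U" for x
  proof -
    have "bij (FD f x)" using *(5)[OF fV[OF that]] gf[OF that] f' *(2) that by auto
    then show ?thesis by (rule bij_is_inj)
  qed
  from smooth_on_inverse[OF smooth_on_subset[OF f *(1,2)] gf this] have "smooth_on (f ` U) g" .
  then show ?thesis using that[of U g] * gf by blast
qed

subsection \<open>Cotangent lifts in coordinates\<close>

text \<open>The map \<open>hat\<close> in coordinates, where \<open>\<sigma>\<close> is meant to be
  a local inverse of \<open>\<tau>\<close>: composing a covector with the inverse of the derivative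
  of \<open>\<tau>\<close> is composing it with the derivative of \<open>\<sigma>\<close>, whose
  adjoint acts on the fibre coordinate. Passing \<open>\<sigma>\<close> as an argument makes the
  smooth dependence on the base point visible.\<close>

definition cot_lift :: "('e::euclidean_space \<Rightarrow> 'e) \<Rightarrow> ('e \<Rightarrow> 'e) \<Rightarrow> 'e \<times> 'e \<Rightarrow> 'e \<times> 'e" where
  "cot_lift \<tau> \<sigma> = (\<lambda>(q, p). (\<tau> q, adjoint (FD \<sigma> (\<tau> q)) p))"

text \<open>The canonical form in coordinates. It serves for \<open>T*Q\<close> and, with
  \<open>'e\<close> replaced by a product, also for \<open>T*TQ\<close>.\<close>

definition sform :: "'e::euclidean_space \<times> 'e \<Rightarrow> 'e \<times> 'e \<Rightarrow> real" where
  "sform X Y = fst X \<bullet> snd Y - fst Y \<bullet> snd X"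

lemma adjoint_Basis:
  fixes L :: "'a::euclidean_space \<Rightarrow> 'b::euclidean_space"
  assumes "linear L"
  shows "adjoint L p = (\<Sum>b\<in>Basis. (p \<bullet> L b) *\<^sub>R b)"
  by (rule euclidean_eqI)
    (simp add: adjoint_clauses[OF assms] inner_sum_left inner_Basis if_distrib sum.delta cong: if_cong)

lemma fst_cot_lift [simp]: "fst (cot_lift \<tau> \<sigma> z) = \<tau> (fst z)"
  by (simp add: cot_lift_def split: prod.split)

lemma smooth_on_cot_lift:
  assumes "smooth_on S \<tau>" "smooth_on T \<sigma>" "\<And>x. x \<in> S \<Longrightarrow> \<tau> x \<in> T"
  shows "smooth_on (S \<times> UNIV) (cot_lift \<tau> \<sigma>)"
proof (rule smooth_on_cong)
  have o: "open (S \<times> (UNIV::'a set))" using assms(1) by (simp add: open_Times smooth_on_def)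
  have t: "smooth_on (S \<times> (UNIV::'a set)) (\<lambda>z. \<tau> (fst z))"
    by (intro smooth_on_compose[OF assms(1)] smooth_on_intros o) auto
  show "smooth_on (S \<times> UNIV) (\<lambda>z. (\<tau> (fst z), \<Sum>b\<in>Basis. (snd z \<bullet> FD \<sigma> (\<tau> (fst z)) b) *\<^sub>R b))"
    by (intro smooth_on_intros t smooth_on_FD[OF assms(2) t] o) (use assms(3) in auto)
  show "(\<tau> (fst z), \<Sum>b\<in>Basis. (snd z \<bullet> FD \<sigma> (\<tau> (fst z)) b) *\<^sub>R b) = cot_lift \<tau> \<sigma> z"
    if "z \<in> S \<times> UNIV" for z
    using that smooth_on_FD_linear[OF assms(2)] assms(3)
    by (auto simp: cot_lift_def adjoint_Basis)
qed

lemma FD_left_inverse: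
  fixes \<tau> :: "'a::euclidean_space \<Rightarrow> 'b::euclidean_space"
  assumes "smooth_on S \<tau>" "smooth_on T \<sigma>" "\<And>x. x \<in> S \<Longrightarrow> \<tau> x \<in> T" "\<And>x. x \<in> S \<Longrightarrow> \<sigma> (\<tau> x) = x"
    "x \<in> S"
  shows "FD \<sigma> (\<tau> x) (FD \<tau> x e) = e"
proof -
  have "FD (\<lambda>x. \<sigma> (\<tau> x)) x = FD (\<lambda>x. x) x"
    by (rule FD_cong_open[of S]) (use assms smooth_on_open in auto)
  moreover have "FD (\<lambda>x. \<sigma> (\<tau> x)) x = (\<lambda>v. FD \<sigma> (\<tau> x) (FD \<tau> x v))"
    by (intro FD_compose smooth_on_differentiable[OF assms(1)] smooth_on_differentiable[OF assms(2)] assms)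
  ultimately show ?thesis by (metis frechet_derivative_ident)
qed

text \<open>A covector and a vector that are moved together keep their pairing. The inverse, the
  derivative and the uniqueness of the lift are all obtained by testing with this identity.\<close>

lemma cot_lift_pairing:
  assumes "smooth_on S \<tau>" "smooth_on T \<sigma>" "\<And>x. x \<in> S \<Longrightarrow> \<tau> x \<in> T" "\<And>x. x \<in> S \<Longrightarrow> \<sigma> (\<tau> x) = x"
    "fst z \<in> S"
  shows "snd (cot_lift \<tau> \<sigma> z) \<bullet> FD \<tau> (fst z) e = snd z \<bullet> e"
  using FD_left_inverse[OF assms, of e] smooth_on_FD_linear[OF assms(2), of "\<tau> (fst z)"] assms(3,5)
  by (simp add: cot_lift_def adjoint_clauses case_prod_beta)

lemma cot_lift_inverse:
  assumes "smooth_on S \<tau>" "smooth_on T \<sigma>" "\<And>x. x \<in> S \<Longrightarrow> \<tau> x \<in> T" "\<And>x. x \<in> S \<Longrightarrow> \<sigma> (\<tau> x) = x"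
    "fst z \<in> S"
  shows "cot_lift \<sigma> \<tau> (cot_lift \<tau> \<sigma> z) = z"
proof -
  have "linear (FD \<tau> (fst z))" using assms(1,5) smooth_on_FD_linear by blast
  then have "adjoint (FD \<tau> (fst z)) (snd (cot_lift \<tau> \<sigma> z)) \<bullet> e = snd z \<bullet> e" for e
    using cot_lift_pairing[OF assms] by (simp add: adjoint_clauses)
  then have "adjoint (FD \<tau> (fst z)) (snd (cot_lift \<tau> \<sigma> z)) = snd z"
    by (metis euclidean_eqI)
  then show ?thesis
    using assms(4,5) by (simp add: cot_lift_def case_prod_beta)
qed

text \<open>Instead of differentiating the adjoint in \<open>cot_lift\<close>, the identity of
  \<open>cot_lift_pairing\<close> is differentiated with \<open>e\<close> fixed. This determines the
  derivative of the fibre part implicitly and isolates the second derivative of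
  \<open>\<tau>\<close> in one term.\<close>

lemma cot_lift_pairing_derivative:
  assumes "smooth_on S \<tau>" "smooth_on T \<sigma>" "\<And>x. x \<in> S \<Longrightarrow> \<tau> x \<in> T" "\<And>x. x \<in> S \<Longrightarrow> \<sigma> (\<tau> x) = x"
    "fst z \<in> S"
  shows "snd (FD (cot_lift \<tau> \<sigma>) z X) \<bullet> FD \<tau> (fst z) e
    + snd (cot_lift \<tau> \<sigma> z) \<bullet> FD (\<lambda>x. FD \<tau> x e) (fst z) (fst X) = snd X \<bullet> e"
proof -
  have S: "open S" using assms(1) smooth_on_open by blast
  have o: "open (S \<times> (UNIV::'a set))" using S by (simp add: open_Times)
  have z: "z \<in> S \<times> UNIV" using assms(5) by (simp add: mem_Times_iff)
  have te: "smooth_on S (\<lambda>x. FD \<tau> x e)"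
    by (rule smooth_on_FD_const[OF assms(1)])
  let ?F = "cot_lift \<tau> \<sigma>"
  have dF: "(?F has_derivative FD ?F z) (at z)"
    by (rule smooth_on_has_derivative[OF smooth_on_cot_lift[OF assms(1-3)] z])
  have "((\<lambda>z. snd (?F z) \<bullet> FD \<tau> (fst z) e) has_derivative
     (\<lambda>X. snd (?F z) \<bullet> FD (\<lambda>x. FD \<tau> x e) (fst z) (fst X) + snd (FD ?F z X) \<bullet> FD \<tau> (fst z) e)) (at z)"
    by (intro has_derivative_inner has_derivative_snd dF
        has_derivative_compose[OF has_derivative_fst[OF has_derivative_ident]
          smooth_on_has_derivative[OF te assms(5)]])
  moreover have "((\<lambda>z. snd z \<bullet> e) has_derivative (\<lambda>X. snd X \<bullet> e)) (at z)"
    by (auto intro!: derivative_eq_intros)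
  then have "((\<lambda>z. snd (?F z) \<bullet> FD \<tau> (fst z) e) has_derivative (\<lambda>X. snd X \<bullet> e)) (at z)"
    by (rule has_derivative_transform_within_open[OF _ o z]) (use cot_lift_pairing[OF assms(1-4)] in auto)
  ultimately have "(\<lambda>X. snd (?F z) \<bullet> FD (\<lambda>x. FD \<tau> x e) (fst z) (fst X) + snd (FD ?F z X) \<bullet> FD \<tau> (fst z) e)
    = (\<lambda>X. snd X \<bullet> e)" by (rule has_derivative_unique)
  from fun_cong[OF this, of X] show ?thesis by simp
qed

lemma fst_FD_cot_lift:
  assumes "smooth_on S \<tau>" "smooth_on T \<sigma>" "\<And>x. x \<in> S \<Longrightarrow> \<tau> x \<in> T" "fst z \<in> S"
  shows "fst (FD (cot_lift \<tau> \<sigma>) z X) = FD \<tau> (fst z) (fst X)"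
proof -
  have z: "z \<in> S \<times> UNIV" using assms(4) by (simp add: mem_Times_iff)
  have "((\<lambda>z. fst (cot_lift \<tau> \<sigma> z)) has_derivative (\<lambda>X. fst (FD (cot_lift \<tau> \<sigma>) z X))) (at z)"
    by (intro has_derivative_fst smooth_on_has_derivative[OF smooth_on_cot_lift[OF assms(1-3)] z])
  moreover have "((\<lambda>z. \<tau> (fst z)) has_derivative (\<lambda>X. FD \<tau> (fst z) (fst X))) (at z)"
    by (rule has_derivative_compose[OF has_derivative_fst[OF has_derivative_ident]
          smooth_on_has_derivative[OF assms(1,4)]])
  ultimately have "(\<lambda>X. fst (FD (cot_lift \<tau> \<sigma>) z X)) = (\<lambda>X. FD \<tau> (fst z) (fst X))"
    unfolding fst_cot_lift by (rule has_derivative_unique)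
  then show ?thesis by (rule fun_cong)
qed

text \<open>The differentiated pairing is used for \<open>X\<close> against the base part of
  \<open>Y\<close> and for \<open>Y\<close> against the base part of \<open>X\<close>. In the
  difference the terms with the second derivative of \<open>\<tau>\<close> cancel by symmetry, and
  what remains is the claim.\<close>

lemma cot_lift_symplectic:
  assumes "smooth_on S \<tau>" "smooth_on T \<sigma>" "\<And>x. x \<in> S \<Longrightarrow> \<tau> x \<in> T" "\<And>x. x \<in> S \<Longrightarrow> \<sigma> (\<tau> x) = x"
    "fst z \<in> S"
  shows "sform (FD (cot_lift \<tau> \<sigma>) z X) (FD (cot_lift \<tau> \<sigma>) z Y) = sform X Y"
  using cot_lift_pairing_derivative[OF assms, of X "fst Y"] cot_lift_pairing_derivative[OF assms, of Y "fst X"]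
    second_derivative_symmetric[OF assms(1,5), of "fst X" "fst Y"]
  by (simp add: sform_def fst_FD_cot_lift[OF assms(1-3,5)] inner_commute)

section \<open>Charts\<close>

lemma chart_inv_right:
  assumes "u \<in> snd c ` S" "S \<subseteq> fst c"
  shows "chart_inv c u \<in> fst c" "snd c (chart_inv c u) = u"
  using assms by (auto simp: chart_inv_def intro!: inv_into_into f_inv_into_f)

lemma chart_inv_left:
  assumes "smooth_atlas A" "c \<in> A" "x \<in> fst c"
  shows "chart_inv c (snd c x) = x"
  using assms by (auto simp: chart_inv_def smooth_atlas_def)

lemma transition_smooth:
  assumes "smooth_atlas A" "c \<in> A" "d \<in> A"
  shows "smooth_on (snd c ` (fst c \<inter> fst d)) (snd d \<circ> chart_inv c)"
  using assms by (auto simp: smooth_atlas_def)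

lemma chart_inj: "smooth_atlas A \<Longrightarrow> c \<in> A \<Longrightarrow> inj_on (snd c) (fst c)"
  by (auto simp: smooth_atlas_def)

text \<open>\<open>manifold_top\<close> asks for open images in all charts. Inside one chart domain
  a single image suffices, because the image in another chart is a preimage under a continuous
  transition map.\<close>

lemma openin_chart:
  assumes A: "smooth_atlas A" and c: "c \<in> A" and N: "N \<subseteq> fst c"
  shows "openin (manifold_top A) N \<longleftrightarrow> open (snd c ` N)"
proof
  assume "openin (manifold_top A) N"
  then have "open (snd c ` (N \<inter> fst c))"
    using c openin_manifold_top[OF chart_inj[OF A]] by blast
  then show "open (snd c ` N)" using N by (simp add: Int_absorb2)
next
  assume o: "open (snd c ` N)"
  have "open (snd d ` (N \<inter> fst d))" if d: "d \<in> A" for d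
  proof -
    have s: "smooth_on (snd d ` (fst d \<inter> fst c)) (snd c \<circ> chart_inv d)"
      using transition_smooth[OF A d c] .
    have "open (snd d ` (fst d \<inter> fst c) \<inter> (snd c \<circ> chart_inv d) -` (snd c ` N))"
      by (rule continuous_open_preimage[OF smooth_on_continuous_on[OF s] smooth_on_open[OF s] o])
    moreover have "snd d ` (fst d \<inter> fst c) \<inter> (snd c \<circ> chart_inv d) -` (snd c ` N) = snd d ` (N \<inter> fst d)"
    proof (intro equalityI subsetI)
      fix u assume u: "u \<in> snd d ` (fst d \<inter> fst c) \<inter> (snd c \<circ> chart_inv d) -` (snd c ` N)"
      then obtain y where y: "u = snd d y" "y \<in> fst d" "y \<in> fst c" by auto
      then have "snd c y \<in> snd c ` N" using u chart_inv_left[OF A d] by simp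
      then have "y \<in> N" using chart_inj[OF A c] N y by (auto dest: inj_onD)
      then show "u \<in> snd d ` (N \<inter> fst d)" using y by auto
    next
      fix u assume "u \<in> snd d ` (N \<inter> fst d)"
      then show "u \<in> snd d ` (fst d \<inter> fst c) \<inter> (snd c \<circ> chart_inv d) -` (snd c ` N)"
        using N chart_inv_left[OF A d] by auto
    qed
    ultimately show ?thesis by simp
  qed
  then show "openin (manifold_top A) N"
    using c N openin_manifold_top[OF chart_inj[OF A]] by (auto simp: points_def)
qed

lemma openin_chart_domain:
  assumes "smooth_atlas A" "c \<in> A"
  shows "openin (manifold_top A) (fst c)"
  using assms openin_chart[OF assms order_refl] by (auto simp: smooth_atlas_def)

lemma openin_subset_points:
  assumes "smooth_atlas A" "openin (manifold_top A) S"
  shows "S \<subseteq> points A"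
  using assms openin_manifold_top[OF chart_inj[OF assms(1)]] by blast

lemma chart_at:
  assumes "x \<in> points A"
  shows "chart_at A x \<in> A" "x \<in> fst (chart_at A x)"
proof -
  have "\<exists>c. c \<in> A \<and> x \<in> fst c" using assms by (auto simp: points_def)
  then have "chart_at A x \<in> A \<and> x \<in> fst (chart_at A x)"
    unfolding chart_at_def by (rule someI_ex)
  then show "chart_at A x \<in> A" "x \<in> fst (chart_at A x)" by auto
qed

section \<open>Smooth maps in charts\<close>

lemma smooth_map_openin: "smooth_map A B S F \<Longrightarrow> openin (manifold_top A) S"
  by (simp add: smooth_map_def)

text \<open>\<open>smooth_map\<close> provides only some pair of charts around each point. Near the
  point, the expression in the prescribed charts is the given one preceded and followed by
  transition maps.\<close>

lemma smooth_map_in_charts: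
  assumes A: "smooth_atlas A" and B: "smooth_atlas B" and F: "smooth_map A B S F"
    and c: "c \<in> A" and d: "d \<in> B" and N: "openin (manifold_top A) N" "N \<subseteq> S \<inter> fst c"
    and FN: "F ` N \<subseteq> fst d"
  shows "smooth_on (snd c ` N) (snd d \<circ> F \<circ> chart_inv c)"
proof (rule smooth_on_local)
  fix u assume "u \<in> snd c ` N"
  then obtain x where x: "x \<in> N" "u = snd c x" by auto
  then have "x \<in> S" using N by auto
  then obtain c' d' N' where c': "c' \<in> A" and d': "d' \<in> B" and N': "openin (manifold_top A) N'"
    "x \<in> N'" "N' \<subseteq> S \<inter> fst c'" "F ` N' \<subseteq> fst d'"
    "smooth_on (snd c' ` N') (snd d' \<circ> F \<circ> chart_inv c')"
    using F unfolding smooth_map_def by meson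
  define M where "M = N \<inter> N'"
  have M: "openin (manifold_top A) M" using N N' unfolding M_def by blast
  have oM: "open (snd c ` M)" using openin_chart[OF A c, of M] M N unfolding M_def by auto
  have s1: "smooth_on (snd c ` M) (snd c' \<circ> chart_inv c)"
    by (rule smooth_on_subset[OF transition_smooth[OF A c c'] oM]) (use N N' in \<open>auto simp: M_def\<close>)
  have s2: "smooth_on (snd c ` M) (\<lambda>u. (snd d' \<circ> F \<circ> chart_inv c') ((snd c' \<circ> chart_inv c) u))"
    by (rule smooth_on_compose[OF N'(5) s1])
      (use N chart_inv_left[OF A c] in \<open>auto simp: M_def\<close>)
  have s3: "smooth_on (snd c ` M) (\<lambda>u. (snd d \<circ> chart_inv d')
      ((snd d' \<circ> F \<circ> chart_inv c') ((snd c' \<circ> chart_inv c) u)))"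
  proof (rule smooth_on_compose[OF transition_smooth[OF B d' d] s2])
    fix u assume "u \<in> snd c ` M"
    then obtain y where y: "u = snd c y" "y \<in> M" by auto
    then show "(snd d' \<circ> F \<circ> chart_inv c') ((snd c' \<circ> chart_inv c) u) \<in> snd d' ` (fst d' \<inter> fst d)"
      using chart_inv_left[OF A c, of y] chart_inv_left[OF A c', of y] N N' FN
      by (auto simp: M_def subset_iff)
  qed
  have "smooth_on (snd c ` M) (snd d \<circ> F \<circ> chart_inv c)"
  proof (rule smooth_on_cong[OF s3])
    fix u assume "u \<in> snd c ` M"
    then obtain y where y: "u = snd c y" "y \<in> M" by auto
    then have "F y \<in> fst d'" "y \<in> fst c" "y \<in> fst c'" using N N' by (auto simp: M_def)
    then show "(snd d \<circ> chart_inv d') ((snd d' \<circ> F \<circ> chart_inv c') ((snd c' \<circ> chart_inv c) u))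
      = (snd d \<circ> F \<circ> chart_inv c) u"
      using y chart_inv_left[OF A c, of y] chart_inv_left[OF A c', of y] chart_inv_left[OF B d', of "F y"]
      by simp
  qed
  then show "\<exists>T. u \<in> T \<and> T \<subseteq> snd c ` N \<and> smooth_on T (snd d \<circ> F \<circ> chart_inv c)"
    using x N' by (auto simp: M_def intro!: exI[of _ "snd c ` M"])
qed

lemma smooth_map_preimage:
  assumes A: "smooth_atlas A" and B: "smooth_atlas B" and F: "smooth_map A B S F"
    and O: "openin (manifold_top B) T"
  shows "openin (manifold_top A) {x \<in> S. F x \<in> T}"
proof (subst openin_subopen, intro ballI)
  fix x assume x: "x \<in> {x \<in> S. F x \<in> T}"
  then obtain c d N where c: "c \<in> A" and d: "d \<in> B" and N: "openin (manifold_top A) N"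
    "x \<in> N" "N \<subseteq> S \<inter> fst c" "F ` N \<subseteq> fst d"
    "smooth_on (snd c ` N) (snd d \<circ> F \<circ> chart_inv c)"
    using F unfolding smooth_map_def by (smt (verit) mem_Collect_eq)
  define M where "M = {y \<in> N. F y \<in> T}"
  have "openin (manifold_top B) (T \<inter> fst d)" using O openin_chart_domain[OF B d] by blast
  then have oT: "open (snd d ` (T \<inter> fst d))" using openin_chart[OF B d] by blast
  have "snd c ` M = snd c ` N \<inter> (snd d \<circ> F \<circ> chart_inv c) -` (snd d ` (T \<inter> fst d))"
  proof (intro equalityI subsetI)
    fix u assume "u \<in> snd c ` M"
    then show "u \<in> snd c ` N \<inter> (snd d \<circ> F \<circ> chart_inv c) -` (snd d ` (T \<inter> fst d))"
      using N(3,4) chart_inv_left[OF A c] by (fastforce simp: M_def)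
  next
    fix u assume "u \<in> snd c ` N \<inter> (snd d \<circ> F \<circ> chart_inv c) -` (snd d ` (T \<inter> fst d))"
    then obtain y where y: "u = snd c y" "y \<in> N" "snd d (F y) \<in> snd d ` (T \<inter> fst d)"
      using N(3) chart_inv_left[OF A c] by auto
    then obtain t where t: "t \<in> T" "t \<in> fst d" "snd d (F y) = snd d t" by auto
    then have "F y = t" using inj_onD[OF chart_inj[OF B d] t(3)] N(4) y by auto
    then have "F y \<in> T" using t by simp
    then show "u \<in> snd c ` M" using y by (auto simp: M_def)
  qed
  moreover have "open (snd c ` N \<inter> (snd d \<circ> F \<circ> chart_inv c) -` (snd d ` (T \<inter> fst d)))"
    by (rule continuous_open_preimage[OF smooth_on_continuous_on[OF N(5)] smooth_on_open[OF N(5)] oT])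
  ultimately have "openin (manifold_top A) M"
    using openin_chart[OF A c, of M] N by (auto simp: M_def)
  then show "\<exists>M. openin (manifold_top A) M \<and> x \<in> M \<and> M \<subseteq> {x \<in> S. F x \<in> T}"
    using x N by (intro exI[of _ M]) (auto simp: M_def)
qed

lemma smooth_map_chartI:
  assumes A: "smooth_atlas A" and c: "c \<in> A" and d: "d \<in> B" and V: "V \<subseteq> fst c" "F ` V \<subseteq> fst d"
    and s: "smooth_on (snd c ` V) (snd d \<circ> F \<circ> chart_inv c)"
  shows "smooth_map A B V F"
  unfolding smooth_map_def
proof (intro conjI ballI)
  show o: "openin (manifold_top A) V" using openin_chart[OF A c V(1)] smooth_on_open[OF s] by simp
  show "\<exists>c\<in>A. \<exists>d\<in>B. \<exists>N. openin (manifold_top A) N \<and> x \<in> N \<and> N \<subseteq> V \<inter> fst c \<and> F ` N \<subseteq> fst d \<and>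
      smooth_on (snd c ` N) (snd d \<circ> F \<circ> chart_inv c)" if "x \<in> V" for x
    using that o c d V s by (intro bexI[of _ c] bexI[of _ d] exI[of _ V]) auto
qed

lemma smooth_map_differentiable:
  assumes A: "smooth_atlas A" and B: "smooth_atlas B" and F: "smooth_map A B S F"
    and c: "c \<in> A" and d: "d \<in> B" and x: "x \<in> S" "x \<in> fst c" "F x \<in> fst d"
  shows "(snd d \<circ> F \<circ> chart_inv c) differentiable (at (snd c x))"
proof -
  define N where "N = {y \<in> S. F y \<in> fst d} \<inter> fst c"
  have N: "openin (manifold_top A) N" unfolding N_def
    using smooth_map_preimage[OF A B F openin_chart_domain[OF B d]] openin_chart_domain[OF A c] by blast
  have "smooth_on (snd c ` N) (snd d \<circ> F \<circ> chart_inv c)"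
    by (rule smooth_map_in_charts[OF A B F c d N]) (auto simp: N_def)
  then show ?thesis by (rule smooth_on_differentiable) (use x in \<open>auto simp: N_def\<close>)
qed

text \<open>A criterion for sets that fit into one chart on each side, where it is enough to invert
  the coordinate expression smoothly. It serves for the discretization map and again for its
  cotangent lift.\<close>

lemma diffeomorphism_chartI:
  assumes A: "smooth_atlas A" and B: "smooth_atlas B" and c: "c \<in> A" and d: "d \<in> B"
    and V: "V \<subseteq> fst c" and F: "\<And>x. x \<in> V \<Longrightarrow> F x \<in> fst d \<and> snd d (F x) = f (snd c x)"
    and D: "D \<subseteq> fst d" "snd d ` D = f ` snd c ` V"
    and f: "smooth_on (snd c ` V) f" and g: "smooth_on (snd d ` D) g"
    and gf: "\<And>u. u \<in> snd c ` V \<Longrightarrow> g (f u) = u"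
  shows "diffeomorphism A B V D F"
proof -
  have inj: "inj_on F V"
  proof (rule inj_onI)
    fix x y assume xy: "x \<in> V" "y \<in> V" "F x = F y"
    then have "f (snd c x) = f (snd c y)" using F by metis
    then have "snd c x = snd c y" using gf xy by (metis imageI)
    then show "x = y" using chart_inj[OF A c] V xy by (auto dest: inj_onD)
  qed
  have FV: "F ` V = D"
  proof (intro equalityI subsetI)
    fix y assume "y \<in> F ` V"
    then obtain x where x: "x \<in> V" "y = F x" by auto
    then have "snd d y \<in> snd d ` D" unfolding D(2) using F[of x] by auto
    then obtain y' where y': "y' \<in> D" "snd d y = snd d y'" by auto
    then have "y = y'" using inj_onD[OF chart_inj[OF B d] y'(2)] D(1) F[of x] x by auto
    then show "y \<in> D" using y' by simp
  next
    fix y assume y: "y \<in> D"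
    then have "snd d y \<in> f ` snd c ` V" using D(2) by blast
    then obtain x where x: "x \<in> V" "snd d y = f (snd c x)" by auto
    then have "snd d y = snd d (F x)" using F by simp
    then have "y = F x" using inj_onD[OF chart_inj[OF B d]] D(1) F[of x] x y by blast
    then show "y \<in> F ` V" using x by simp
  qed
  show ?thesis unfolding diffeomorphism_def
  proof (intro conjI)
    show "bij_betw F V D" using inj FV by (simp add: bij_betw_def)
    show "smooth_map A B V F"
    proof (rule smooth_map_chartI[OF A c d V])
      show "smooth_on (snd c ` V) (snd d \<circ> F \<circ> chart_inv c)"
        by (rule smooth_on_cong[OF f]) (use F V chart_inv_left[OF A c] in \<open>auto simp: subset_iff\<close>)
    qed (use F in auto)
    show "smooth_map B A D (inv_into V F)"
    proof (rule smooth_map_chartI[OF B d c D(1)])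
      show "inv_into V F ` D \<subseteq> fst c" using V FV inv_into_into[of _ F V] by blast
      show "smooth_on (snd d ` D) (snd c \<circ> inv_into V F \<circ> chart_inv d)"
      proof (rule smooth_on_cong[OF g])
        fix u assume "u \<in> snd d ` D"
        then obtain x where x: "x \<in> V" "u = snd d (F x)" using FV by auto
        then have "chart_inv d u = F x" using chart_inv_left[OF B d, of "F x"] F[of x] by metis
        then show "g u = (snd c \<circ> inv_into V F \<circ> chart_inv d) u"
          using x inj gf F[of x] by simp
      qed
    qed
  qed
qed

section \<open>Tangent vectors in charts\<close>

text \<open>The chain rule for transition maps as a cocycle condition. It is the reason why
  \<open>tvec_of\<close> yields a compatible family, hence a tangent vector.\<close>

lemma FD_transition_compose:
  assumes A: "smooth_atlas A" and c: "c \<in> A" "x \<in> fst c" and d: "d \<in> A" "x \<in> fst d"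
    and e: "e \<in> A" "x \<in> fst e"
  shows "FD (snd e \<circ> chart_inv d) (snd d x) (FD (snd d \<circ> chart_inv c) (snd c x) v)
    = FD (snd e \<circ> chart_inv c) (snd c x) v"
proof -
  let ?N = "fst c \<inter> fst d \<inter> fst e"
  have "openin (manifold_top A) ?N"
    using openin_chart_domain[OF A c(1)] openin_chart_domain[OF A d(1)] openin_chart_domain[OF A e(1)]
    by blast
  then have o: "open (snd c ` ?N)" using openin_chart[OF A c(1), of ?N] by blast
  note inv = chart_inv_left[OF A c(1)] chart_inv_left[OF A d(1)]
  have dif: "(snd d \<circ> chart_inv c) differentiable (at (snd c x))"
    by (rule smooth_on_differentiable[OF transition_smooth[OF A c(1) d(1)]]) (use c d in auto)
  have "(snd e \<circ> chart_inv d) differentiable (at (snd d x))"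
    by (rule smooth_on_differentiable[OF transition_smooth[OF A d(1) e(1)]]) (use d e in auto)
  then have dif': "(snd e \<circ> chart_inv d) differentiable (at ((snd d \<circ> chart_inv c) (snd c x)))"
    using inv c by simp
  have "FD (snd e \<circ> chart_inv c) (snd c x) = FD ((snd e \<circ> chart_inv d) \<circ> (snd d \<circ> chart_inv c)) (snd c x)"
    by (rule FD_cong_open[OF o]) (use c d e inv in auto)
  also have "\<dots> = FD (snd e \<circ> chart_inv d) ((snd d \<circ> chart_inv c) (snd c x)) \<circ> FD (snd d \<circ> chart_inv c) (snd c x)"
    by (rule frechet_derivative_compose[OF dif dif'])
  finally show ?thesis using c inv by simp
qed

lemma FD_transition_self:
  assumes A: "smooth_atlas A" and c: "c \<in> A" "x \<in> fst c"
  shows "FD (snd c \<circ> chart_inv c) (snd c x) v = v"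
proof -
  have "open (snd c ` fst c)" using assms by (auto simp: smooth_atlas_def)
  then have "FD (snd c \<circ> chart_inv c) (snd c x) = FD (\<lambda>u. u) (snd c x)"
    by (rule FD_cong_open) (use c chart_inv_left[OF A c(1)] in auto)
  then show ?thesis by simp
qed

lemma FD_transition_linear:
  assumes A: "smooth_atlas A" and "c \<in> A" "d \<in> A" "x \<in> fst c" "x \<in> fst d"
  shows "linear (FD (snd d \<circ> chart_inv c) (snd c x))"
  by (rule smooth_on_FD_linear[OF transition_smooth[OF A]]) (use assms in auto)

lemma tspaceI:
  assumes "\<And>c. \<not> (c \<in> A \<and> x \<in> fst c) \<Longrightarrow> \<xi> c = 0"
    and "\<And>c d. \<lbrakk>c \<in> A; d \<in> A; x \<in> fst c; x \<in> fst d\<rbrakk> \<Longrightarrow>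
      \<xi> d = FD (snd d \<circ> chart_inv c) (snd c x) (\<xi> c)"
  shows "\<xi> \<in> tspace A x"
  unfolding tspace_def using assms by blast

lemma tspace_transition:
  assumes "\<xi> \<in> tspace A x" "c \<in> A" "d \<in> A" "x \<in> fst c" "x \<in> fst d"
  shows "\<xi> d = FD (snd d \<circ> chart_inv c) (snd c x) (\<xi> c)"
  using assms unfolding tspace_def by blast

lemma tspace_outside:
  assumes "\<xi> \<in> tspace A x" "\<not> (c \<in> A \<and> x \<in> fst c)"
  shows "\<xi> c = 0"
  using assms unfolding tspace_def by blast

lemma tvec_of_same:
  assumes "smooth_atlas A" "c \<in> A" "x \<in> fst c"
  shows "tvec_of A c x v c = v"
  using assms by (simp add: tvec_of_def FD_transition_self)

lemma tvec_of_in_tspace: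
  assumes "smooth_atlas A" "c \<in> A" "x \<in> fst c"
  shows "tvec_of A c x v \<in> tspace A x"
  by (rule tspaceI) (auto simp: tvec_of_def FD_transition_compose[OF assms])

lemma tspace_eqI:
  assumes "\<xi> \<in> tspace A x" "\<eta> \<in> tspace A x" "c \<in> A" "x \<in> fst c" "\<xi> c = \<eta> c"
  shows "\<xi> = \<eta>"
proof
  fix d
  show "\<xi> d = \<eta> d"
  proof (cases "d \<in> A \<and> x \<in> fst d")
    case True
    then show ?thesis
      using tspace_transition[OF assms(1,3) _ assms(4), of d] tspace_transition[OF assms(2,3) _ assms(4), of d]
        assms(5) by simp
  next
    case False
    then show ?thesis using tspace_outside[OF assms(1) False] tspace_outside[OF assms(2) False] by simp
  qed
qed

lemma tvec_of_eq:
  assumes "smooth_atlas A" "c \<in> A" "x \<in> fst c" "\<xi> \<in> tspace A x"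
  shows "tvec_of A c x (\<xi> c) = \<xi>"
  by (rule tspace_eqI[OF tvec_of_in_tspace[OF assms(1-3)] assms(4,2,3)])
    (rule tvec_of_same[OF assms(1-3)])

lemma tspace_add:
  assumes A: "smooth_atlas A" and "\<xi> \<in> tspace A x" "\<eta> \<in> tspace A x"
  shows "(\<lambda>c. \<xi> c + \<eta> c) \<in> tspace A x"
proof (rule tspaceI)
  fix c d assume *: "c \<in> A" "d \<in> A" "x \<in> fst c" "x \<in> fst d"
  show "\<xi> d + \<eta> d = FD (snd d \<circ> chart_inv c) (snd c x) (\<xi> c + \<eta> c)"
    unfolding linear_add[OF FD_transition_linear[OF A *]]
      tspace_transition[OF assms(2) *] tspace_transition[OF assms(3) *] ..
qed (use tspace_outside[OF assms(2)] tspace_outside[OF assms(3)] in simp)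

lemma tspace_scale:
  assumes A: "smooth_atlas A" and "\<xi> \<in> tspace A x"
  shows "(\<lambda>c. r *\<^sub>R \<xi> c) \<in> tspace A x"
proof (rule tspaceI)
  fix c d assume *: "c \<in> A" "d \<in> A" "x \<in> fst c" "x \<in> fst d"
  show "r *\<^sub>R \<xi> d = FD (snd d \<circ> chart_inv c) (snd c x) (r *\<^sub>R \<xi> c)"
    unfolding linear_cmul[OF FD_transition_linear[OF A *]] tspace_transition[OF assms(2) *] ..
qed (use tspace_outside[OF assms(2)] in simp)

lemma tspace_zero:
  assumes A: "smooth_atlas A"
  shows "(\<lambda>c. 0) \<in> tspace A x"
  by (rule tspaceI) (simp_all add: linear_0[OF FD_transition_linear[OF A]])

text \<open>\<open>tmap\<close> is computed in the chart chosen at \<open>x\<close>. Any other chart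
  differs from it by a transition map, whose derivative also carries the coordinates of the vector,
  so the two changes cancel.\<close>

lemma tmap_in_chart:
  assumes A: "smooth_atlas A" and c: "c \<in> A" "x \<in> fst c"
    and d: "d \<in> B" "F x \<in> fst d" and \<xi>: "\<xi> \<in> tspace A x"
    and dif: "(snd d \<circ> F \<circ> chart_inv c) differentiable (at (snd c x))"
  shows "tmap A B F x \<xi> d = FD (snd d \<circ> F \<circ> chart_inv c) (snd c x) (\<xi> c)"
proof -
  define e where "e = chart_at A x"
  have "x \<in> points A" using c by (auto simp: points_def)
  then have e: "e \<in> A" "x \<in> fst e" unfolding e_def by (rule chart_at)+
  let ?N = "fst e \<inter> fst c"
  have o: "open (snd e ` ?N)" using transition_smooth[OF A e(1) c(1)] smooth_on_open by blast
  have "FD (snd d \<circ> F \<circ> chart_inv e) (snd e x)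
      = FD ((snd d \<circ> F \<circ> chart_inv c) \<circ> (snd c \<circ> chart_inv e)) (snd e x)"
    by (rule FD_cong_open[OF o]) (use e c chart_inv_left[OF A e(1)] chart_inv_left[OF A c(1)] in auto)
  also have "\<dots> = FD (snd d \<circ> F \<circ> chart_inv c) ((snd c \<circ> chart_inv e) (snd e x))
      \<circ> FD (snd c \<circ> chart_inv e) (snd e x)"
  proof (rule frechet_derivative_compose)
    show "(snd c \<circ> chart_inv e) differentiable (at (snd e x))"
      by (rule smooth_on_differentiable[OF transition_smooth[OF A e(1) c(1)]]) (use e c in auto)
    show "(snd d \<circ> F \<circ> chart_inv c) differentiable (at ((snd c \<circ> chart_inv e) (snd e x)))"
      using dif chart_inv_left[OF A e] by simp
  qed
  finally have "FD (snd d \<circ> F \<circ> chart_inv e) (snd e x) (\<xi> e)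
      = FD (snd d \<circ> F \<circ> chart_inv c) (snd c x) (\<xi> c)"
    using chart_inv_left[OF A e] tspace_transition[OF \<xi> e(1) c(1) e(2) c(2)] by simp
  then show ?thesis using d by (simp add: tmap_def Let_def e_def)
qed

lemma tmap_in_tspace:
  assumes A: "smooth_atlas A" and B: "smooth_atlas B" and F: "smooth_map A B S F"
    and x: "x \<in> S" and \<xi>: "\<xi> \<in> tspace A x"
  shows "tmap A B F x \<xi> \<in> tspace B (F x)"
proof -
  define c where "c = chart_at A x"
  have "x \<in> points A" using x openin_subset_points[OF A smooth_map_openin[OF F]] by blast
  then have c: "c \<in> A" "x \<in> fst c" unfolding c_def by (rule chart_at)+
  have "tmap A B F x \<xi> e = FD (snd e \<circ> chart_inv d) (snd d (F x)) (tmap A B F x \<xi> d)"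
    if d: "d \<in> B" "F x \<in> fst d" and e: "e \<in> B" "F x \<in> fst e" for d e
  proof -
    define N where "N = {y \<in> S. F y \<in> fst d \<inter> fst e} \<inter> fst c"
    have "openin (manifold_top B) (fst d \<inter> fst e)"
      using openin_chart_domain[OF B] d e by blast
    from smooth_map_preimage[OF A B F this] openin_chart_domain[OF A c(1)]
    have "openin (manifold_top A) N" unfolding N_def by blast
    then have oN: "open (snd c ` N)" using openin_chart[OF A c(1), of N] by (auto simp: N_def)
    have "FD (snd e \<circ> F \<circ> chart_inv c) (snd c x)
      = FD ((snd e \<circ> chart_inv d) \<circ> (snd d \<circ> F \<circ> chart_inv c)) (snd c x)"
      by (rule FD_cong_open[OF oN])
        (use x c d e chart_inv_left[OF A c(1)] chart_inv_left[OF B d(1)] in \<open>auto simp: N_def\<close>)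
    also have "\<dots> = FD (snd e \<circ> chart_inv d) ((snd d \<circ> F \<circ> chart_inv c) (snd c x))
      \<circ> FD (snd d \<circ> F \<circ> chart_inv c) (snd c x)"
    proof (rule frechet_derivative_compose)
      show "(snd d \<circ> F \<circ> chart_inv c) differentiable at (snd c x)"
        by (rule smooth_map_differentiable[OF A B F c(1) d(1) x c(2) d(2)])
      show "(snd e \<circ> chart_inv d) differentiable at ((snd d \<circ> F \<circ> chart_inv c) (snd c x))"
        by (rule smooth_on_differentiable[OF transition_smooth[OF B d(1) e(1)]])
          (use d e chart_inv_left[OF A c] in auto)
    qed
    finally show ?thesis using d e chart_inv_left[OF A c] by (simp add: tmap_def Let_def c_def)
  qed
  moreover have "tmap A B F x \<xi> d = 0" if "\<not> (d \<in> B \<and> F x \<in> fst d)" for d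
    using that by (simp only: tmap_def Let_def if_False)
  ultimately show ?thesis by (intro tspaceI)
qed

section \<open>Bundle charts\<close>

text \<open>Tangent and cotangent bundle are treated at once: over a base chart the fibre coordinate
  \<open>k\<close> is a bijection onto the model space, and \<open>g\<close> describes the change
  between two such charts. The transition maps are smooth because they agree with \<open>g\<close>
  on the overlaps.\<close>

lemma bundle_atlas:
  fixes A :: "('a, 'e::euclidean_space) atlas"
    and k :: "('a, 'e) chart \<Rightarrow> 'a \<Rightarrow> 't \<Rightarrow> 'f::euclidean_space"
  assumes A: "smooth_atlas A"
    and dom: "\<And>c. c \<in> A \<Longrightarrow> fst (K c) = Sigma (fst c) T"
    and K: "\<And>c x \<xi>. c \<in> A \<Longrightarrow> x \<in> fst c \<Longrightarrow> \<xi> \<in> T x \<Longrightarrow> snd (K c) (x, \<xi>) = (snd c x, k c x \<xi>)"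
    and bij: "\<And>c x. c \<in> A \<Longrightarrow> x \<in> fst c \<Longrightarrow> bij_betw (k c x) (T x) UNIV"
    and g: "\<And>c d. c \<in> A \<Longrightarrow> d \<in> A \<Longrightarrow> smooth_on ((snd c ` (fst c \<inter> fst d)) \<times> UNIV) (g c d)"
    and gK: "\<And>c d x \<xi>. c \<in> A \<Longrightarrow> d \<in> A \<Longrightarrow> x \<in> fst c \<Longrightarrow> x \<in> fst d \<Longrightarrow> \<xi> \<in> T x \<Longrightarrow>
      g c d (snd c x, k c x \<xi>) = (snd d x, k d x \<xi>)"
  shows "smooth_atlas (K ` A)" "c \<in> A \<Longrightarrow> S \<subseteq> fst c \<Longrightarrow> snd (K c) ` (Sigma S T) = (snd c ` S) \<times> UNIV"
proof -
  have image: "snd (K c) ` (Sigma S T) = (snd c ` S) \<times> UNIV" if c: "c \<in> A" and S: "S \<subseteq> fst c" for c S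
  proof (intro equalityI subsetI)
    fix u assume "u \<in> snd (K c) ` (Sigma S T)"
    then show "u \<in> (snd c ` S) \<times> UNIV" using K[OF c] S by force
  next
    fix u assume "u \<in> (snd c ` S) \<times> (UNIV::'f set)"
    then obtain x v where x: "x \<in> S" "u = (snd c x, v)" by auto
    moreover obtain \<xi> where "\<xi> \<in> T x" "v = k c x \<xi>"
      using bij[OF c, of x] x(1) S by (auto simp: bij_betw_def)
    ultimately show "u \<in> snd (K c) ` (Sigma S T)" using K[OF c] S by force
  qed
  then show "c \<in> A \<Longrightarrow> S \<subseteq> fst c \<Longrightarrow> snd (K c) ` (Sigma S T) = (snd c ` S) \<times> UNIV" .
  have inj: "inj_on (snd (K c)) (fst (K c))" if c: "c \<in> A" for c
  proof (rule inj_onI)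
    fix z w assume z: "z \<in> fst (K c)" "w \<in> fst (K c)" "snd (K c) z = snd (K c) w"
    obtain x \<xi> y \<eta> where eq: "z = (x, \<xi>)" "w = (y, \<eta>)" by (metis surj_pair)
    then have *: "x \<in> fst c" "\<xi> \<in> T x" "y \<in> fst c" "\<eta> \<in> T y" using z dom[OF c] by auto
    then have **: "snd c x = snd c y" "k c x \<xi> = k c y \<eta>" using z K[OF c] eq by auto
    then have "x = y" using chart_inj[OF A c] * by (auto dest: inj_onD)
    then show "z = w" using eq * ** bij[OF c, of x] by (auto simp: bij_betw_def dest: inj_onD)
  qed
  have inv: "chart_inv (K c) (snd (K c) z) = z" if "c \<in> A" "z \<in> fst (K c)" for c z
    using inj[OF that(1)] that(2) by (simp add: chart_inv_def)
  show "smooth_atlas (K ` A)"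
    unfolding smooth_atlas_def
  proof (intro conjI ballI)
    fix C assume "C \<in> K ` A"
    then obtain c where c: "c \<in> A" "C = K c" by auto
    then show "inj_on (snd C) (fst C)" using inj by simp
    show "open (snd C ` fst C)"
      unfolding c(2) dom[OF c(1)] image[OF c(1) order_refl]
      using A c(1) by (simp add: smooth_atlas_def open_Times)
    fix D assume "D \<in> K ` A"
    then obtain d where d: "d \<in> A" "D = K d" by auto
    have dom_int: "fst C \<inter> fst D = Sigma (fst c \<inter> fst d) T" using c d dom by auto
    show "smooth_on (snd C ` (fst C \<inter> fst D)) (snd D \<circ> chart_inv C)"
    proof (rule smooth_on_cong[of _ "g c d"])
      show "smooth_on (snd C ` (fst C \<inter> fst D)) (g c d)"
        unfolding dom_int unfolding c(2)
        by (subst image[OF c(1)]) (use g[OF c(1) d(1)] in auto)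
      fix u assume "u \<in> snd C ` (fst C \<inter> fst D)"
      then obtain x \<xi> where u: "u = snd C (x, \<xi>)" "x \<in> fst c" "x \<in> fst d" "\<xi> \<in> T x"
        unfolding dom_int by auto
      have "(x, \<xi>) \<in> fst (K c)" using u dom[OF c(1)] by simp
      then have "chart_inv C u = (x, \<xi>)" using inv[OF c(1)] u c by simp
      then show "g c d u = (snd D \<circ> chart_inv C) u"
        using u c d K[of c x \<xi>] K[of d x \<xi>] gK[of c d x \<xi>] by simp
    qed
  qed
qed

section \<open>The tangent bundle, whose transition maps are tangent maps\<close>

definition tlift :: "('e::euclidean_space \<Rightarrow> 'f::euclidean_space) \<Rightarrow> 'e \<times> 'e \<Rightarrow> 'f \<times> 'f" where
  "tlift f = (\<lambda>z. (f (fst z), FD f (fst z) (snd z)))"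

lemma smooth_on_tlift:
  assumes f: "smooth_on S f"
  shows "smooth_on (S \<times> UNIV) (tlift f)"
proof -
  have S: "open (S \<times> (UNIV::'a set))" using f smooth_on_open open_Times by blast
  have "smooth_on (S \<times> UNIV) (\<lambda>z. (f (fst z), FD f (fst z) (snd z)))"
    by (intro smooth_on_Pair smooth_on_compose[OF f] smooth_on_FD[OF f] smooth_on_intros S) auto
  then show ?thesis by (simp add: tlift_def case_prod_beta)
qed

lemma FD_tlift:
  assumes f: "smooth_on S f" and x: "x \<in> S"
  shows "FD (tlift f) (x, v) z = (FD f x (fst z), FD (\<lambda>x. FD f x v) x (fst z) + FD f x (snd z))"
proof -
  have "((\<lambda>z. f (fst z)) has_derivative (\<lambda>z. FD f x (fst z))) (at (x, v))"
    using has_derivative_compose[OF has_derivative_fst[OF has_derivative_ident], of f "FD f x" "(x, v)"]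
      smooth_on_has_derivative[OF f x] by simp
  from has_derivative_Pair[OF this has_derivative_FD_apply[OF f x]]
  have "(tlift f has_derivative (\<lambda>z. (FD f x (fst z), FD (\<lambda>x. FD f x v) x (fst z) + FD f x (snd z)))) (at (x, v))"
    by (simp add: tlift_def case_prod_beta)
  from FD_eqI[OF this] show ?thesis by simp
qed

lemma fst_tangent_chart [simp]: "fst (tangent_chart A c) = Sigma (fst c) (tspace A)"
  by (simp add: tangent_chart_def)

lemma snd_tangent_chart [simp]: "snd (tangent_chart A c) (x, \<xi>) = (snd c x, \<xi> c)"
  by (simp add: tangent_chart_def)

lemma tangent_chart_in_atlas: "c \<in> A \<Longrightarrow> tangent_chart A c \<in> tangent_atlas A"
  by (simp add: tangent_atlas_def)

lemma cotangent_chart_in_atlas: "c \<in> A \<Longrightarrow> cotangent_chart A c \<in> cotangent_atlas A"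
  by (simp add: cotangent_atlas_def)

lemma points_tangent_atlas: "points (tangent_atlas A) = Sigma (points A) (tspace A)"
  by (auto simp: points_def tangent_atlas_def)

lemma bij_betw_tangent_coord:
  assumes "smooth_atlas A" "c \<in> A" "x \<in> fst c"
  shows "bij_betw (\<lambda>\<xi>. \<xi> c) (tspace A x) UNIV"
  by (rule bij_betw_byWitness[where f' = "tvec_of A c x"])
    (use tvec_of_eq[OF assms] tvec_of_same[OF assms] tvec_of_in_tspace[OF assms] in auto)

lemma tangent_atlas:
  assumes A: "smooth_atlas A"
  shows smooth_tangent_atlas: "smooth_atlas (tangent_atlas A)"
    and tangent_chart_image: "c \<in> A \<Longrightarrow> S \<subseteq> fst c \<Longrightarrow>
      snd (tangent_chart A c) ` (Sigma S (tspace A)) = (snd c ` S) \<times> UNIV"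
proof -
  have g: "tlift (snd d \<circ> chart_inv c) (snd c x, \<xi> c) = (snd d x, \<xi> d)"
    if "c \<in> A" "d \<in> A" "x \<in> fst c" "x \<in> fst d" "\<xi> \<in> tspace A x" for c d x \<xi>
    using tspace_transition[OF that(5,1-4)] chart_inv_left[OF A that(1,3)] by (simp add: tlift_def)
  note * = bundle_atlas[OF A fst_tangent_chart snd_tangent_chart bij_betw_tangent_coord[OF A]
      smooth_on_tlift[OF transition_smooth[OF A]] g]
  show "smooth_atlas (tangent_atlas A)"
    unfolding tangent_atlas_def by (rule *(1))
  show "c \<in> A \<Longrightarrow> S \<subseteq> fst c \<Longrightarrow>
      snd (tangent_chart A c) ` (Sigma S (tspace A)) = (snd c ` S) \<times> UNIV"
    by (rule *(2))
qed

section \<open>The cotangent bundle, whose transition maps are cotangent lifts\<close>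

definition cov_of :: "('a, 'e::euclidean_space) atlas \<Rightarrow> ('a, 'e) chart \<Rightarrow> 'a \<Rightarrow> 'e \<Rightarrow> ('a, 'e) covec" where
  "cov_of A c x p = (\<lambda>\<xi>. if \<xi> \<in> tspace A x then p \<bullet> \<xi> c else 0)"

text \<open>The fibre part of \<open>cotangent_chart\<close>, split off so that
  \<open>bundle_atlas\<close> applies; \<open>cov_of\<close> is its inverse.\<close>

definition cov_coord :: "('a, 'e::euclidean_space) atlas \<Rightarrow> ('a, 'e) chart \<Rightarrow> 'a \<Rightarrow> ('a, 'e) covec \<Rightarrow> 'e" where
  "cov_coord A c x \<alpha> = (\<Sum>b\<in>Basis. \<alpha> (tvec_of A c x b) *\<^sub>R b)"

lemma fst_cotangent_chart [simp]: "fst (cotangent_chart A c) = Sigma (fst c) (cotspace A)"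
  by (simp add: cotangent_chart_def)

lemma snd_cotangent_chart [simp]: "snd (cotangent_chart A c) (x, \<alpha>) = (snd c x, cov_coord A c x \<alpha>)"
  by (simp add: cotangent_chart_def cov_coord_def)

lemma points_cotangent_atlas: "points (cotangent_atlas A) = Sigma (points A) (cotspace A)"
  by (auto simp: points_def cotangent_atlas_def)

text \<open>\<open>tvec_of\<close> is linear in its coordinate vector, because a tangent vector is
  determined by one chart. The covector thus becomes a linear functional on the model space,
  represented by its values on the basis.\<close>

lemma cotspace_apply:
  assumes A: "smooth_atlas A" and c: "c \<in> A" "x \<in> fst c" and \<alpha>: "\<alpha> \<in> cotspace A x" and \<xi>: "\<xi> \<in> tspace A x"
  shows "\<alpha> \<xi> = cov_coord A c x \<alpha> \<bullet> \<xi> c"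
proof -
  let ?t = "tvec_of A c x"
  have t: "?t v \<in> tspace A x" for v by (rule tvec_of_in_tspace[OF A c])
  have add: "?t (u + v) = (\<lambda>d. ?t u d + ?t v d)" for u v
    by (rule tspace_eqI[OF t tspace_add[OF A t t] c]) (simp add: tvec_of_same[OF A c])
  have scale: "?t (r *\<^sub>R v) = (\<lambda>d. r *\<^sub>R ?t v d)" for r v
    by (rule tspace_eqI[OF t tspace_scale[OF A t] c]) (simp add: tvec_of_same[OF A c])
  have "linear (\<lambda>v. \<alpha> (?t v))"
    by (rule linearI) (use \<alpha> t add scale in \<open>auto simp: cotspace_def\<close>)
  from linear_apply_Basis[OF this, of "\<xi> c"]
  have "\<alpha> (?t (\<xi> c)) = (\<Sum>b\<in>Basis. (\<xi> c \<bullet> b) * \<alpha> (?t b))" by simp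
  also have "\<dots> = cov_coord A c x \<alpha> \<bullet> \<xi> c"
    by (simp add: cov_coord_def inner_sum_left inner_commute[of "\<xi> c"] mult.commute)
  finally show ?thesis using tvec_of_eq[OF A c \<xi>] by simp
qed

lemma cov_of_in_cotspace:
  assumes A: "smooth_atlas A"
  shows "cov_of A c x p \<in> cotspace A x"
  using tspace_add[OF A] tspace_scale[OF A] by (auto simp: cotspace_def cov_of_def inner_add_right)

lemma cov_coord_of:
  assumes "smooth_atlas A" "c \<in> A" "x \<in> fst c"
  shows "cov_coord A c x (cov_of A c x p) = p"
  using assms by (simp add: cov_coord_def cov_of_def tvec_of_in_tspace tvec_of_same euclidean_representation)

lemma cov_of_coord:
  assumes "smooth_atlas A" "c \<in> A" "x \<in> fst c" "\<alpha> \<in> cotspace A x"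
  shows "cov_of A c x (cov_coord A c x \<alpha>) = \<alpha>"
proof
  show "cov_of A c x (cov_coord A c x \<alpha>) \<xi> = \<alpha> \<xi>" for \<xi>
    using cotspace_apply[OF assms, of \<xi>] assms(4) by (auto simp: cov_of_def cotspace_def)
qed

lemma bij_betw_cotangent_coord:
  assumes "smooth_atlas A" "c \<in> A" "x \<in> fst c"
  shows "bij_betw (cov_coord A c x) (cotspace A x) UNIV"
  by (rule bij_betw_byWitness[where f' = "cov_of A c x"])
    (use cov_of_coord[OF assms] cov_coord_of[OF assms] cov_of_in_cotspace[OF assms(1), of c x] in auto)

lemma transition_inverse:
  assumes "smooth_atlas A" "c \<in> A" "d \<in> A" "u \<in> snd c ` (fst c \<inter> fst d)"
  shows "(snd d \<circ> chart_inv c) u \<in> snd d ` (fst d \<inter> fst c)"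
    "(snd c \<circ> chart_inv d) ((snd d \<circ> chart_inv c) u) = u"
  using assms(4) chart_inv_left[OF assms(1,2)] chart_inv_left[OF assms(1,3)] by auto

text \<open>The new fibre coordinates are the values of the covector on the coordinate vectors of
  \<open>d\<close>. In the chart \<open>c\<close> these vectors are the columns of
  \<open>?L\<close>, and pairing with the columns is applying the adjoint.\<close>

lemma cotangent_transition:
  assumes A: "smooth_atlas A" and c: "c \<in> A" "x \<in> fst c" and d: "d \<in> A" "x \<in> fst d" and \<alpha>: "\<alpha> \<in> cotspace A x"
  shows "cot_lift (snd d \<circ> chart_inv c) (snd c \<circ> chart_inv d) (snd c x, cov_coord A c x \<alpha>)
    = (snd d x, cov_coord A d x \<alpha>)"
proof -
  let ?L = "FD (snd c \<circ> chart_inv d) (snd d x)"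
  have "adjoint ?L (cov_coord A c x \<alpha>) = (\<Sum>b\<in>Basis. (cov_coord A c x \<alpha> \<bullet> ?L b) *\<^sub>R b)"
    by (rule adjoint_Basis[OF FD_transition_linear[OF A d(1) c(1) d(2) c(2)]])
  also have "\<dots> = (\<Sum>b\<in>Basis. \<alpha> (tvec_of A d x b) *\<^sub>R b)"
    using cotspace_apply[OF A c \<alpha> tvec_of_in_tspace[OF A d]] c by (simp add: tvec_of_def)
  finally show ?thesis using chart_inv_left[OF A c] by (simp add: cot_lift_def cov_coord_def)
qed

lemma cotangent_atlas:
  assumes A: "smooth_atlas A"
  shows smooth_cotangent_atlas: "smooth_atlas (cotangent_atlas A)"
    and cotangent_chart_image: "c \<in> A \<Longrightarrow> S \<subseteq> fst c \<Longrightarrow>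
      snd (cotangent_chart A c) ` (Sigma S (cotspace A)) = (snd c ` S) \<times> UNIV"
proof -
  have s: "smooth_on (snd c ` (fst c \<inter> fst d) \<times> UNIV) (cot_lift (snd d \<circ> chart_inv c) (snd c \<circ> chart_inv d))"
    if "c \<in> A" "d \<in> A" for c d
    by (rule smooth_on_cot_lift[OF transition_smooth[OF A that] transition_smooth[OF A that(2,1)]
          transition_inverse(1)[OF A that]])
  have g: "cot_lift (snd d \<circ> chart_inv c) (snd c \<circ> chart_inv d) (snd c x, cov_coord A c x \<alpha>)
      = (snd d x, cov_coord A d x \<alpha>)"
    if "c \<in> A" "d \<in> A" "x \<in> fst c" "x \<in> fst d" "\<alpha> \<in> cotspace A x" for c d x \<alpha>
    by (rule cotangent_transition[OF A that(1,3,2,4,5)])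
  note * = bundle_atlas[OF A fst_cotangent_chart snd_cotangent_chart bij_betw_cotangent_coord[OF A] s g]
  show "smooth_atlas (cotangent_atlas A)"
    unfolding cotangent_atlas_def by (rule *(1))
  show "c \<in> A \<Longrightarrow> S \<subseteq> fst c \<Longrightarrow>
      snd (cotangent_chart A c) ` (Sigma S (cotspace A)) = (snd c ` S) \<times> UNIV"
    by (rule *(2))
qed

section \<open>Products\<close>

definition prod_chart :: "('a, 'e) chart \<Rightarrow> ('b, 'f) chart \<Rightarrow> ('a \<times> 'b, 'e \<times> 'f) chart" where
  "prod_chart c d = (fst c \<times> fst d, map_prod (snd c) (snd d))"

lemma fst_prod_chart [simp]: "fst (prod_chart c d) = fst c \<times> fst d"
  and snd_prod_chart [simp]: "snd (prod_chart c d) (x, y) = (snd c x, snd d y)"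
  by (simp_all add: prod_chart_def)

lemma prod_chart_in_atlas: "c \<in> A \<Longrightarrow> d \<in> B \<Longrightarrow> prod_chart c d \<in> prod_atlas A B"
  unfolding prod_atlas_def prod_chart_def mem_Collect_eq
  by (intro exI[of _ c] exI[of _ d] conjI refl)

lemma prod_atlas_cases:
  assumes "C \<in> prod_atlas A B"
  obtains c d where "c \<in> A" "d \<in> B" "C = prod_chart c d"
  using assms by (auto simp: prod_atlas_def prod_chart_def)

lemma prod_chart_image: "snd (prod_chart c d) ` (S \<times> T) = (snd c ` S) \<times> (snd d ` T)"
  by (auto simp: prod_chart_def image_iff)

lemma smooth_prod_atlas:
  assumes A: "smooth_atlas A" and B: "smooth_atlas B"
  shows "smooth_atlas (prod_atlas A B)"
  unfolding smooth_atlas_def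
proof (intro conjI ballI)
  have inj: "inj_on (snd C) (fst C)" if "C \<in> prod_atlas A B" for C
    using that
  proof (rule prod_atlas_cases)
    fix c d assume "c \<in> A" "d \<in> B" "C = prod_chart c d"
    then show ?thesis using chart_inj[OF A, of c] chart_inj[OF B, of d] by (auto simp: inj_on_def)
  qed
  fix C assume C: "C \<in> prod_atlas A B"
  then obtain c d where cd: "c \<in> A" "d \<in> B" "C = prod_chart c d" by (rule prod_atlas_cases)
  show "inj_on (snd C) (fst C)" using inj[OF C] .
  show "open (snd C ` fst C)"
    using cd A B by (simp add: prod_chart_image open_Times smooth_atlas_def)
  fix C' assume "C' \<in> prod_atlas A B"
  then obtain c' d' where cd': "c' \<in> A" "d' \<in> B" "C' = prod_chart c' d'" by (rule prod_atlas_cases)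
  have im: "snd C ` (fst C \<inter> fst C') = (snd c ` (fst c \<inter> fst c')) \<times> (snd d ` (fst d \<inter> fst d'))"
    using cd cd' by (simp add: Times_Int_Times prod_chart_image)
  have s1: "smooth_on (snd c ` (fst c \<inter> fst c')) (snd c' \<circ> chart_inv c)"
    and s2: "smooth_on (snd d ` (fst d \<inter> fst d')) (snd d' \<circ> chart_inv d)"
    using transition_smooth A B cd cd' by blast+
  have o: "open (snd C ` (fst C \<inter> fst C'))"
    unfolding im using smooth_on_open[OF s1] smooth_on_open[OF s2] by (rule open_Times)
  have "smooth_on (snd C ` (fst C \<inter> fst C'))
      (\<lambda>u. ((snd c' \<circ> chart_inv c) (fst u), (snd d' \<circ> chart_inv d) (snd u)))"
    by (intro smooth_on_Pair smooth_on_compose[OF s1] smooth_on_compose[OF s2] smooth_on_intros o)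
      (auto simp: im)
  then show "smooth_on (snd C ` (fst C \<inter> fst C')) (snd C' \<circ> chart_inv C)"
  proof (rule smooth_on_cong)
    fix u assume "u \<in> snd C ` (fst C \<inter> fst C')"
    then obtain x y where u: "u = snd C (x, y)" "(x, y) \<in> fst C" by auto
    then have "chart_inv C u = (x, y)" using inj[OF C] by (simp add: chart_inv_def)
    then show "((snd c' \<circ> chart_inv c) (fst u), (snd d' \<circ> chart_inv d) (snd u)) = (snd C' \<circ> chart_inv C) u"
      using u cd cd' chart_inv_left[OF A, of c x] chart_inv_left[OF B, of d y] by simp
  qed
qed

lemma smooth_map_fst:
  assumes A: "smooth_atlas A" and B: "smooth_atlas B" and c: "c \<in> A" and d: "d \<in> B"
  shows "smooth_map (prod_atlas A B) A (fst c \<times> fst d) fst"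
    and "\<lbrakk>x \<in> fst c; y \<in> fst d; \<zeta> \<in> tspace (prod_atlas A B) (x, y)\<rbrakk> \<Longrightarrow>
      tmap (prod_atlas A B) A fst (x, y) \<zeta> c = fst (\<zeta> (prod_chart c d))"
proof -
  note P = smooth_prod_atlas[OF A B] and C = prod_chart_in_atlas[OF c d]
  have o: "open (snd (prod_chart c d) ` (fst c \<times> fst d))"
    using P C by (auto simp: smooth_atlas_def)
  have eq: "fst u = (snd c \<circ> fst \<circ> chart_inv (prod_chart c d)) u"
    if "u \<in> snd (prod_chart c d) ` (fst c \<times> fst d)" for u
    using that chart_inv_left[OF P C] by auto
  have s: "smooth_on (snd (prod_chart c d) ` (fst c \<times> fst d)) (snd c \<circ> fst \<circ> chart_inv (prod_chart c d))"
    by (rule smooth_on_cong[OF smooth_on_fst[OF smooth_on_ident[OF o]] eq])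
  then show "smooth_map (prod_atlas A B) A (fst c \<times> fst d) fst"
    by (intro smooth_map_chartI[OF P C c]) auto
  assume xy: "x \<in> fst c" "y \<in> fst d" and z: "\<zeta> \<in> tspace (prod_atlas A B) (x, y)"
  have "FD (snd c \<circ> fst \<circ> chart_inv (prod_chart c d)) (snd (prod_chart c d) (x, y)) = FD fst (snd (prod_chart c d) (x, y))"
    by (rule FD_cong_open[OF o _ eq[symmetric]]) (use xy in \<open>auto simp: prod_chart_image\<close>)
  also have "\<dots> = fst" by (rule FD_eqI) (auto intro!: derivative_eq_intros)
  finally show "tmap (prod_atlas A B) A fst (x, y) \<zeta> c = fst (\<zeta> (prod_chart c d))"
    using tmap_in_chart[OF P C _ c _ z, of fst] smooth_on_differentiable[OF s] xy
    by (auto simp: prod_chart_image)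
qed

lemma smooth_map_snd:
  assumes A: "smooth_atlas A" and B: "smooth_atlas B" and c: "c \<in> A" and d: "d \<in> B"
  shows "smooth_map (prod_atlas A B) B (fst c \<times> fst d) snd"
    and "\<lbrakk>x \<in> fst c; y \<in> fst d; \<zeta> \<in> tspace (prod_atlas A B) (x, y)\<rbrakk> \<Longrightarrow>
      tmap (prod_atlas A B) B snd (x, y) \<zeta> d = snd (\<zeta> (prod_chart c d))"
proof -
  note P = smooth_prod_atlas[OF A B] and C = prod_chart_in_atlas[OF c d]
  have o: "open (snd (prod_chart c d) ` (fst c \<times> fst d))"
    using P C by (auto simp: smooth_atlas_def)
  have eq: "snd u = (snd d \<circ> snd \<circ> chart_inv (prod_chart c d)) u"
    if "u \<in> snd (prod_chart c d) ` (fst c \<times> fst d)" for u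
    using that chart_inv_left[OF P C] by auto
  have s: "smooth_on (snd (prod_chart c d) ` (fst c \<times> fst d)) (snd d \<circ> snd \<circ> chart_inv (prod_chart c d))"
    by (rule smooth_on_cong[OF smooth_on_snd[OF smooth_on_ident[OF o]] eq])
  then show "smooth_map (prod_atlas A B) B (fst c \<times> fst d) snd"
    by (intro smooth_map_chartI[OF P C d]) auto
  assume xy: "x \<in> fst c" "y \<in> fst d" and z: "\<zeta> \<in> tspace (prod_atlas A B) (x, y)"
  have "FD (snd d \<circ> snd \<circ> chart_inv (prod_chart c d)) (snd (prod_chart c d) (x, y)) = FD snd (snd (prod_chart c d) (x, y))"
    by (rule FD_cong_open[OF o _ eq[symmetric]]) (use xy in \<open>auto simp: prod_chart_image\<close>)
  also have "\<dots> = snd" by (rule FD_eqI) (auto intro!: derivative_eq_intros)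
  finally show "tmap (prod_atlas A B) B snd (x, y) \<zeta> d = snd (\<zeta> (prod_chart c d))"
    using tmap_in_chart[OF P C _ d _ z, of snd] smooth_on_differentiable[OF s] xy
    by (auto simp: prod_chart_image)
qed

section \<open>The symplectic form and the canonical diffeomorphism in charts\<close>

lemma cotangent_tspace_transition:
  assumes A: "smooth_atlas A" and c: "c \<in> A" "fst z \<in> fst c" and d: "d \<in> A" "fst z \<in> fst d"
    and z: "snd z \<in> cotspace A (fst z)" and X: "X \<in> tspace (cotangent_atlas A) z"
  shows "X (cotangent_chart A d) = FD (cot_lift (snd d \<circ> chart_inv c) (snd c \<circ> chart_inv d))
    (snd (cotangent_chart A c) z) (X (cotangent_chart A c))"
proof -
  let ?C = "cotangent_chart A c" and ?D = "cotangent_chart A d"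
  note CA = smooth_cotangent_atlas[OF A]
  note C = cotangent_chart_in_atlas[OF c(1)] and D = cotangent_chart_in_atlas[OF d(1)]
  have o: "open (snd ?C ` (fst ?C \<inter> fst ?D))"
    by (rule smooth_on_open[OF transition_smooth[OF CA C D]])
  have zC: "z \<in> fst ?C" "z \<in> fst ?D" using c d z by (cases z; simp)+
  have "FD (snd ?D \<circ> chart_inv ?C) (snd ?C z)
      = FD (cot_lift (snd d \<circ> chart_inv c) (snd c \<circ> chart_inv d)) (snd ?C z)"
  proof (rule FD_cong_open[OF o])
    show "snd ?C z \<in> snd ?C ` (fst ?C \<inter> fst ?D)" using zC by blast
    fix u assume "u \<in> snd ?C ` (fst ?C \<inter> fst ?D)"
    then obtain x \<alpha> where u: "u = snd ?C (x, \<alpha>)" "x \<in> fst c" "x \<in> fst d" "\<alpha> \<in> cotspace A x" by auto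
    then have "chart_inv ?C u = (x, \<alpha>)" using chart_inv_left[OF CA C, of "(x, \<alpha>)"] by simp
    then show "(snd ?D \<circ> chart_inv ?C) u = cot_lift (snd d \<circ> chart_inv c) (snd c \<circ> chart_inv d) u"
      using cotangent_transition[OF A c(1) u(2) d(1) u(3,4)] u(1) by simp
  qed
  then show ?thesis using tspace_transition[OF X C D zC] by simp
qed

text \<open>\<open>omega\<close> is evaluated in the chart chosen at the base point. Changes of
  cotangent charts are cotangent lifts of changes of charts on Q, hence symplectic, so every chart
  gives the same value.\<close>

lemma omega_in_chart:
  assumes A: "smooth_atlas A" and c: "c \<in> A" "fst z \<in> fst c" and z: "snd z \<in> cotspace A (fst z)"
    and X: "X \<in> tspace (cotangent_atlas A) z" and Y: "Y \<in> tspace (cotangent_atlas A) z"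
  shows "omega A z X Y = sform (X (cotangent_chart A c)) (Y (cotangent_chart A c))"
proof -
  define d where "d = chart_at A (fst z)"
  have "fst z \<in> points A" using c by (auto simp: points_def)
  then have d: "d \<in> A" "fst z \<in> fst d" unfolding d_def by (rule chart_at)+
  have "fst (snd (cotangent_chart A c) z) \<in> snd c ` (fst c \<inter> fst d)" using c d by (cases z) auto
  from cot_lift_symplectic[OF transition_smooth[OF A c(1) d(1)] transition_smooth[OF A d(1) c(1)]
    transition_inverse[OF A c(1) d(1)] this]
  have "sform (X (cotangent_chart A d)) (Y (cotangent_chart A d))
      = sform (X (cotangent_chart A c)) (Y (cotangent_chart A c))"
    unfolding cotangent_tspace_transition[OF A c d z X] cotangent_tspace_transition[OF A c d z Y] .
  then show ?thesis by (simp add: omega_def Let_def d_def sform_def)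
qed

text \<open>The derivative of \<open>\<tau>\<close> is onto, being injective between spaces of equal
  dimension. The fibre part of the lift is therefore fixed by its pairings with
  \<open>FD \<tau> x e\<close>, and a guess \<open>P\<close> can be verified without computing an
  adjoint.\<close>

lemma cot_lift_eqI:
  assumes "smooth_on S \<tau>" "smooth_on T \<sigma>" "\<And>x. x \<in> S \<Longrightarrow> \<tau> x \<in> T" "\<And>x. x \<in> S \<Longrightarrow> \<sigma> (\<tau> x) = x"
    "x \<in> S" "\<And>e. P \<bullet> FD \<tau> x e = p \<bullet> e"
  shows "cot_lift \<tau> \<sigma> (x, p) = (\<tau> x, P)"
proof -
  have lin: "linear (FD \<tau> x)" using assms(1,5) by (rule smooth_on_FD_linear)
  have "inj (FD \<tau> x)" using FD_left_inverse[OF assms(1-5)] by (metis injI)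
  then have "surj (FD \<tau> x)" using lin linear_injective_imp_surjective by blast
  moreover have "snd (cot_lift \<tau> \<sigma> (x, p)) \<bullet> FD \<tau> x e = P \<bullet> FD \<tau> x e" for e
    using cot_lift_pairing[OF assms(1-4), of "(x, p)" e] assms(5,6) by simp
  ultimately have "snd (cot_lift \<tau> \<sigma> (x, p)) \<bullet> v = P \<bullet> v" for v by (metis surjD)
  then have "snd (cot_lift \<tau> \<sigma> (x, p)) = P" by (metis euclidean_eqI)
  then show ?thesis by (metis fst_conv fst_cot_lift prod.collapse)
qed

text \<open>The coordinate exchange \<open>(q, p, q', p') \<mapsto> (q, q', p', p)\<close> defining \<open>TT\<^sup>*Q \<rightarrow> T\<^sup>*TQ\<close>.\<close>

definition swap4 :: "('e \<times> 'e) \<times> ('e \<times> 'e) \<Rightarrow> ('e \<times> 'e) \<times> ('e \<times> 'e)" where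
  "swap4 = (\<lambda>z. ((fst (fst z), fst (snd z)), (snd (snd z), snd (fst z))))"

text \<open>Naturality of the coordinate exchange: it carries the tangent map of a cotangent lift to
  the cotangent lift of a tangent map. Tested by pairing, the two fibre blocks are fixed by the
  differentiated pairing and by the pairing itself; symmetry of the second derivative identifies the
  mixed terms.\<close>

lemma cot_lift_tlift:
  assumes "smooth_on S \<tau>" "smooth_on T \<sigma>" "\<And>x. x \<in> S \<Longrightarrow> \<tau> x \<in> T" "\<And>x. x \<in> S \<Longrightarrow> \<sigma> (\<tau> x) = x"
    "fst z \<in> S"
  shows "cot_lift (tlift \<tau>) (tlift \<sigma>) (swap4 (z, X)) = swap4 (tlift (cot_lift \<tau> \<sigma>) (z, X))"
proof -
  obtain q p where z: "z = (q, p)" by (cases z)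
  obtain q' p' where X: "X = (q', p')" by (cases X)
  let ?F = "cot_lift \<tau> \<sigma>"
  have q: "q \<in> S" using assms(5) z by simp
  have F1: "fst (FD ?F z X) = FD \<tau> q q'"
    using fst_FD_cot_lift[OF assms(1-3,5)] z X by simp
  have "cot_lift (tlift \<tau>) (tlift \<sigma>) ((q, q'), (p', p)) = (tlift \<tau> (q, q'), (snd (FD ?F z X), snd (?F z)))"
  proof (rule cot_lift_eqI[OF smooth_on_tlift[OF assms(1)] smooth_on_tlift[OF assms(2)]])
    show "tlift \<tau> x \<in> T \<times> UNIV" if "x \<in> S \<times> UNIV" for x
      using that assms(3) by (auto simp: tlift_def)
    show "tlift \<sigma> (tlift \<tau> x) = x" if "x \<in> S \<times> UNIV" for x
      using that assms(4) FD_left_inverse[OF assms(1-4)] by (auto simp: tlift_def)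
    show "(q, q') \<in> S \<times> UNIV" using q by simp
    fix e :: "'a \<times> 'a"
    have "snd (FD ?F z X) \<bullet> FD \<tau> q (fst e) + snd (?F z) \<bullet> FD (\<lambda>x. FD \<tau> x (fst e)) q q' = p' \<bullet> fst e"
      using cot_lift_pairing_derivative[OF assms, of X "fst e"] z X by simp
    moreover have "snd (?F z) \<bullet> FD \<tau> q (snd e) = p \<bullet> snd e"
      using cot_lift_pairing[OF assms, of "snd e"] z by simp
    moreover have "FD (\<lambda>x. FD \<tau> x (fst e)) q q' = FD (\<lambda>x. FD \<tau> x q') q (fst e)"
      by (rule second_derivative_symmetric[OF assms(1) q])
    ultimately show "(snd (FD ?F z X), snd (?F z)) \<bullet> FD (tlift \<tau>) (q, q') e = (p', p) \<bullet> e"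
      unfolding FD_tlift[OF assms(1) q] by (simp add: inner_Pair inner_add_right inner_prod_def)
  qed
  then show ?thesis using F1 by (simp add: z X swap4_def tlift_def)
qed

text \<open>Passing from the chosen chart \<open>d\<close> to \<open>c\<close> acts on the target of
  \<open>alpha_map\<close> by the cotangent lift of a tangent map and on its source by the tangent
  map of a cotangent lift. \<open>cot_lift_tlift\<close> matches the two, so one fixed chart
  describes \<open>alpha_map\<close> on its whole domain.\<close>

lemma alpha_map_in_chart:
  assumes A: "smooth_atlas A" and c: "c \<in> A" and w: "w \<in> points (tangent_atlas (cotangent_atlas A))"
    "fst (fst w) \<in> fst c"
  shows "alpha_map A w \<in> fst (cotangent_chart (tangent_atlas A) (tangent_chart A c))"
    "snd (cotangent_chart (tangent_atlas A) (tangent_chart A c)) (alpha_map A w)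
      = swap4 (snd (tangent_chart (cotangent_atlas A) (cotangent_chart A c)) w)"
proof -
  note CA = smooth_cotangent_atlas[OF A] and TA = smooth_tangent_atlas[OF A]
  note CTA = smooth_cotangent_atlas[OF TA]
  let ?K = "\<lambda>c. cotangent_chart (tangent_atlas A) (tangent_chart A c)"
  obtain z X where zX: "w = (z, X)" by (cases w)
  obtain x \<alpha> where z: "z = (x, \<alpha>)" by (cases z)
  have X: "X \<in> tspace (cotangent_atlas A) z" and \<alpha>: "\<alpha> \<in> cotspace A x"
    using w by (auto simp: zX z points_tangent_atlas points_cotangent_atlas)
  have xc: "x \<in> fst c" using w zX z by simp
  define d where "d = chart_at A x"
  have "x \<in> points A" using c xc by (auto simp: points_def)
  then have d: "d \<in> A" "x \<in> fst d" unfolding d_def by (rule chart_at)+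
  have K: "?K c \<in> cotangent_atlas (tangent_atlas A)" if "c \<in> A" for c
    using that by (simp add: cotangent_chart_in_atlas tangent_chart_in_atlas)
  obtain q p q' p' where co: "snd (tangent_chart (cotangent_atlas A) (cotangent_chart A d)) w = ((q, p), (q', p'))"
    by (metis surj_pair)
  have q: "q = snd d x" using co zX z by simp
  have alpha: "alpha_map A w = chart_inv (?K d) ((q, q'), (p', p))"
    using co zX z by (simp add: alpha_map_def Let_def d_def[symmetric])
  have imK: "snd (?K d) ` fst (?K d) = (snd d ` fst d \<times> UNIV) \<times> UNIV"
    using cotangent_chart_image[OF TA tangent_chart_in_atlas[OF d(1)] order_refl]
      tangent_chart_image[OF A d(1) order_refl] by simp
  have "((q, q'), (p', p)) \<in> snd (?K d) ` fst (?K d)" unfolding imK using q d by simp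
  from chart_inv_right[OF this order_refl]
  have mem: "alpha_map A w \<in> fst (?K d)" and val: "snd (?K d) (alpha_map A w) = ((q, q'), (p', p))"
    unfolding alpha .
  obtain y v \<beta> where av: "alpha_map A w = ((y, v), \<beta>)" by (metis surj_pair)
  have y: "y \<in> fst d" "v \<in> tspace A y" "\<beta> \<in> cotspace (tangent_atlas A) (y, v)" "snd d y = q"
    using mem val by (auto simp: av)
  have "y = x" using y(1,4) q d chart_inj[OF A d(1)] by (auto dest: inj_onD)
  then show mem': "alpha_map A w \<in> fst (?K c)" using y xc av by simp
  let ?\<tau> = "snd c \<circ> chart_inv d" and ?\<sigma> = "snd d \<circ> chart_inv c"
  let ?S = "snd d ` (fst d \<inter> fst c)" and ?T = "snd c ` (fst c \<inter> fst d)"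
  let ?Td = "tangent_chart A d" and ?Tc = "tangent_chart A c"
  have tl: "(snd (tangent_chart A e) \<circ> chart_inv (tangent_chart A f)) u = tlift (snd e \<circ> chart_inv f) u"
    if "e \<in> A" "f \<in> A" "u \<in> snd f ` (fst f \<inter> fst e) \<times> UNIV" for e f u
  proof -
    have "u \<in> snd (tangent_chart A f) ` Sigma (fst f \<inter> fst e) (tspace A)"
      using that tangent_chart_image[OF A that(2), of "fst f \<inter> fst e"] by simp
    then obtain a \<xi> where a: "u = (snd f a, \<xi> f)" "a \<in> fst f" "a \<in> fst e" "\<xi> \<in> tspace A a" by auto
    have "chart_inv (tangent_chart A f) u = (a, \<xi>)"
      using chart_inv_left[OF TA tangent_chart_in_atlas[OF that(2)], of "(a, \<xi>)"] a by simp
    then show ?thesis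
      using a chart_inv_left[OF A that(2) a(2)] tspace_transition[OF a(4) that(2,1) a(2,3)]
      by (simp add: tlift_def)
  qed
  have "snd (?K c) (alpha_map A w) = cot_lift (snd ?Tc \<circ> chart_inv ?Td) (snd ?Td \<circ> chart_inv ?Tc)
      (snd ?Td (y, v), cov_coord (tangent_atlas A) ?Td (y, v) \<beta>)"
    using cotangent_transition[OF TA tangent_chart_in_atlas[OF d(1)] _ tangent_chart_in_atlas[OF c] _ y(3)]
      \<open>y = x\<close> y d xc av by simp
  also have "\<dots> = cot_lift (snd ?Tc \<circ> chart_inv ?Td) (snd ?Td \<circ> chart_inv ?Tc) ((q, q'), (p', p))"
    using val av by simp
  also have "\<dots> = cot_lift (tlift ?\<tau>) (tlift ?\<sigma>) ((q, q'), (p', p))"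
  proof -
    have qS: "(q, q') \<in> ?S \<times> UNIV" using q d xc by simp
    have tq: "tlift ?\<tau> (q, q') \<in> ?T \<times> UNIV"
      using q d xc chart_inv_left[OF A d] by (auto simp: tlift_def)
    \<comment> \<open>\<open>cot_lift\<close> takes a derivative of its second argument, so equality
      with \<open>tlift ?\<sigma>\<close> at a point is not enough; it holds on an open set and
      therefore passes to derivatives.\<close>
    have o: "open (?T \<times> (UNIV::'b set))"
      by (rule smooth_on_open[OF smooth_on_tlift[OF transition_smooth[OF A c d(1)]]])
    have "FD (snd ?Td \<circ> chart_inv ?Tc) (tlift ?\<tau> (q, q')) = FD (tlift ?\<sigma>) (tlift ?\<tau> (q, q'))"
      by (rule FD_cong_open[OF o tq tl[OF d(1) c]])
    then show ?thesis using tl[OF c d(1) qS] by (simp add: cot_lift_def)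
  qed
  also have "\<dots> = swap4 (tlift (cot_lift ?\<tau> ?\<sigma>) ((q, p), (q', p')))"
  proof -
    have "cot_lift (tlift ?\<tau>) (tlift ?\<sigma>) (swap4 ((q, p), (q', p'))) = swap4 (tlift (cot_lift ?\<tau> ?\<sigma>) ((q, p), (q', p')))"
      by (rule cot_lift_tlift[OF transition_smooth[OF A d(1) c] transition_smooth[OF A c d(1)]
            transition_inverse[OF A d(1) c]])
        (use q d xc in auto)
    then show ?thesis by (simp add: swap4_def)
  qed
  also have "tlift (cot_lift ?\<tau> ?\<sigma>) ((q, p), (q', p')) = snd (tangent_chart (cotangent_atlas A) (cotangent_chart A c)) w"
  proof -
    let ?C = "cotangent_chart A c" and ?D = "cotangent_chart A d"
    have "X ?C = FD (cot_lift ?\<tau> ?\<sigma>) (snd ?D z) (X ?D)"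
      by (rule cotangent_tspace_transition[OF A d(1) _ c _ _ X]) (use z \<alpha> d xc in auto)
    moreover have "snd ?D z = (q, p)" "X ?D = (q', p')" using co zX by (cases z; simp)+
    moreover have "cot_lift ?\<tau> ?\<sigma> (snd ?D z) = snd ?C z"
      using cotangent_transition[OF A d c xc \<alpha>] z by simp
    ultimately show ?thesis using zX by (simp add: tlift_def)
  qed
  finally show "snd (?K c) (alpha_map A w) = swap4 (snd (tangent_chart (cotangent_atlas A) (cotangent_chart A c)) w)" .
qed

section \<open>Hamiltonian vector fields in charts\<close>

definition ham :: "('e::euclidean_space \<times> 'e \<Rightarrow> real) \<Rightarrow> 'e \<times> 'e \<Rightarrow> 'e \<times> 'e" where
  "ham \<eta> m = ((\<Sum>b\<in>Basis. FD \<eta> m (0, b) *\<^sub>R b), - (\<Sum>b\<in>Basis. FD \<eta> m (b, 0) *\<^sub>R b))"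

lemma sform_ham:
  assumes "\<eta> differentiable (at m)"
  shows "sform (ham \<eta> m) Y = FD \<eta> m Y"
proof -
  have lin: "linear (FD \<eta> m)" using assms by (rule FD_linear)
  have l1: "linear (\<lambda>v. FD \<eta> m (0, v))" and l2: "linear (\<lambda>v. FD \<eta> m (v, 0))"
    using linear_compose[OF _ lin, of "\<lambda>v. (0, v)"] linear_compose[OF _ lin, of "\<lambda>v. (v, 0)"]
    by (auto simp: o_def linear_iff)
  have "FD \<eta> m Y = FD \<eta> m (0, snd Y) + FD \<eta> m (fst Y, 0)"
    using linear_add[OF lin, of "(0, snd Y)" "(fst Y, 0)"] by simp
  also have "\<dots> = sform (ham \<eta> m) Y"
    unfolding linear_apply_Basis[OF l1, of "snd Y"] linear_apply_Basis[OF l2, of "fst Y"]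
    by (simp add: sform_def ham_def inner_sum_left inner_sum_right inner_commute mult.commute)
  finally show ?thesis by simp
qed

lemma sform_nondegenerate:
  assumes "\<And>Y. sform X Y = sform X' Y"
  shows "X = X'"
proof -
  have "fst X \<bullet> v = fst X' \<bullet> v" "v \<bullet> snd X = v \<bullet> snd X'" for v
    using assms[of "(0, v)"] assms[of "(v, 0)"] by (auto simp: sform_def)
  then show ?thesis by (metis euclidean_eqI inner_commute prod_eq_iff)
qed

lemma smooth_on_ham:
  assumes "smooth_on S \<eta>"
  shows "smooth_on S (ham \<eta>)"
proof -
  have "smooth_on S (\<lambda>m. ((\<Sum>b\<in>Basis. FD \<eta> m (0, b) *\<^sub>R b), - (\<Sum>b\<in>Basis. FD \<eta> m (b, 0) *\<^sub>R b)))"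
    by (intro smooth_on_intros smooth_on_FD_const assms smooth_on_open[OF assms])
  then show ?thesis by (simp add: ham_def[abs_def])
qed

text \<open>\<open>omega_sharp\<close> is an \<open>inv_into\<close> of \<open>omega_flat\<close>.
  The coordinate formula gives a preimage of the scaled differential, and nondegeneracy makes
  \<open>omega_flat\<close> injective, so the choice has to return this preimage.\<close>

lemma ham_vector_field_in_chart:
  assumes A: "smooth_atlas A" and c: "c \<in> A" and \<gamma>: "\<gamma> \<in> fst (cotangent_chart A c)"
    and H: "(H \<circ> chart_inv (cotangent_chart A c)) differentiable (at (snd (cotangent_chart A c) \<gamma>))"
  shows "omega_sharp A (\<gamma>, \<lambda>Y. h * differential (cotangent_atlas A) H \<gamma> Y)
    = (\<gamma>, tvec_of (cotangent_atlas A) (cotangent_chart A c) \<gamma>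
         (h *\<^sub>R ham (H \<circ> chart_inv (cotangent_chart A c)) (snd (cotangent_chart A c) \<gamma>)))"
proof -
  note CA = smooth_cotangent_atlas[OF A]
  let ?C = "cotangent_chart A c" and ?T = "tspace (cotangent_atlas A) \<gamma>"
  let ?\<eta> = "H \<circ> chart_inv ?C"
  let ?v = "h *\<^sub>R ham ?\<eta> (snd ?C \<gamma>)"
  let ?X = "tvec_of (cotangent_atlas A) ?C \<gamma> ?v"
  have C: "?C \<in> cotangent_atlas A" using c by (rule cotangent_chart_in_atlas)
  have X: "?X \<in> ?T" by (rule tvec_of_in_tspace[OF CA C \<gamma>])
  have \<gamma>': "fst \<gamma> \<in> fst c" "snd \<gamma> \<in> cotspace A (fst \<gamma>)" using \<gamma> by auto
  note om = omega_in_chart[OF A c \<gamma>']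
  have dH: "tmap (cotangent_atlas A) euclidean_atlas H \<gamma> Y (UNIV, id) = FD ?\<eta> (snd ?C \<gamma>) (Y ?C)" if "Y \<in> ?T" for Y
    using tmap_in_chart[OF CA C \<gamma>, of "(UNIV, id)" euclidean_atlas H Y] H that
    by (simp add: euclidean_atlas_def)
  have eq: "omega_flat A \<gamma> ?X = (\<lambda>Y. h * differential (cotangent_atlas A) H \<gamma> Y)"
  proof
    fix Y
    have "sform ?v (Y ?C) = h * sform (ham ?\<eta> (snd ?C \<gamma>)) (Y ?C)"
      by (simp add: sform_def right_diff_distrib)
    also have "\<dots> = h * FD ?\<eta> (snd ?C \<gamma>) (Y ?C)"
      using sform_ham[OF H] by simp
    finally show "omega_flat A \<gamma> ?X Y = h * differential (cotangent_atlas A) H \<gamma> Y"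
      using om[OF X] dH tvec_of_same[OF CA C \<gamma>] by (simp add: omega_flat_def differential_def)
  qed
  have "inj_on (omega_flat A \<gamma>) ?T"
  proof (rule inj_onI)
    fix X X' assume X: "X \<in> ?T" "X' \<in> ?T" and "omega_flat A \<gamma> X = omega_flat A \<gamma> X'"
    then have e: "omega A \<gamma> X Y = omega A \<gamma> X' Y" if "Y \<in> ?T" for Y
      using that unfolding omega_flat_def by metis
    have "sform (X ?C) v = sform (X' ?C) v" for v
      using e[OF tvec_of_in_tspace[OF CA C \<gamma>, of v]] om[OF X(1)] om[OF X(2)]
        tvec_of_in_tspace[OF CA C \<gamma>, of v] tvec_of_same[OF CA C \<gamma>, of v] by simp
    then have "X ?C = X' ?C" by (rule sform_nondegenerate)
    then show "X = X'" by (rule tspace_eqI[OF X C \<gamma>])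
  qed
  then have "inv_into ?T (omega_flat A \<gamma>) (omega_flat A \<gamma> ?X) = ?X" using X by simp
  then show ?thesis unfolding eq by (simp add: omega_sharp_def)
qed

section \<open>The cotangent lift in coordinates\<close>

text \<open>The inverse of the coordinate form of \<open>Phi_map\<close>.\<close>

definition sign4 :: "('e::euclidean_space \<times> 'e) \<times> ('e \<times> 'e) \<Rightarrow> ('e \<times> 'e) \<times> ('e \<times> 'e)" where
  "sign4 z = ((fst (fst z), - fst (snd z)), (snd (fst z), snd (snd z)))"

definition swap4_inv :: "('e \<times> 'e) \<times> ('e \<times> 'e) \<Rightarrow> ('e \<times> 'e) \<times> ('e \<times> 'e)" where
  "swap4_inv z = ((fst (fst z), snd (snd z)), (snd (fst z), fst (snd z)))"

text \<open>The coordinate form of \<open>Phi_map\<close> itself.\<close>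

definition sign4_inv :: "('e::euclidean_space \<times> 'e) \<times> ('e \<times> 'e) \<Rightarrow> ('e \<times> 'e) \<times> ('e \<times> 'e)" where
  "sign4_inv z = ((fst (fst z), fst (snd z)), (- snd (fst z), snd (snd z)))"

lemma swap4_inverse [simp]: "swap4_inv (swap4 z) = z" "sign4_inv (sign4 z) = z"
  by (simp_all add: swap4_inv_def swap4_def sign4_def sign4_inv_def)

lemma bounded_linear_swap4: "bounded_linear (swap4 :: ('e::euclidean_space \<times> 'e) \<times> ('e \<times> 'e) \<Rightarrow> _)"
  and bounded_linear_sign4: "bounded_linear (sign4 :: ('e \<times> 'e) \<times> ('e \<times> 'e) \<Rightarrow> _)"
  and bounded_linear_swap4_inv: "bounded_linear (swap4_inv :: ('e \<times> 'e) \<times> ('e \<times> 'e) \<Rightarrow> _)"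
  and bounded_linear_sign4_inv: "bounded_linear (sign4_inv :: ('e \<times> 'e) \<times> ('e \<times> 'e) \<Rightarrow> _)"
  unfolding linear_conv_bounded_linear[symmetric]
  by (auto intro!: linearI simp: swap4_def sign4_def swap4_inv_def sign4_inv_def)

text \<open>The three factors of \<open>cotangent_lift\<close> in one chart: \<open>swap4\<close>
  for \<open>alpha_map\<close>, \<open>cot_lift\<close> for \<open>hat\<close> and
  \<open>sign4\<close> for the inverse of \<open>Phi_map\<close>, with \<open>s\<close> in the place
  of a local inverse of \<open>r\<close>.\<close>

definition lift_coord ::
  "('e::euclidean_space \<times> 'e \<Rightarrow> 'e \<times> 'e) \<Rightarrow> ('e \<times> 'e \<Rightarrow> 'e \<times> 'e) \<Rightarrow>
   ('e \<times> 'e) \<times> ('e \<times> 'e) \<Rightarrow> ('e \<times> 'e) \<times> ('e \<times> 'e)" where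
  "lift_coord r s u = sign4 (cot_lift r s (swap4 u))"

lemma FD_bounded_linear_compose:
  assumes "bounded_linear L" "f differentiable (at x)"
  shows "FD (\<lambda>x. L (f x)) x v = L (FD f x v)"
  by (subst FD_eqI[OF bounded_linear.has_derivative[OF assms(1) FD_works[OF assms(2)]]]) simp

lemma FD_compose_bounded_linear:
  assumes "bounded_linear L" "f differentiable (at (L x))"
  shows "FD (\<lambda>x. f (L x)) x v = FD f (L x) (L v)"
proof -
  have "(L has_derivative L) (at x)" using assms(1) by (rule bounded_linear_imp_has_derivative)
  from has_derivative_compose[OF this FD_works[OF assms(2)]]
  have "FD (\<lambda>x. f (L x)) x = (\<lambda>v. FD f (L x) (L v))" by (rule FD_eqI)
  then show ?thesis by simp
qed

text \<open>Differentiating the identity \<open>diag\<close> along the zero section determines the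
  derivative of \<open>r\<close> in the base directions; only the fibre directions remain
  free.\<close>

lemma FD_diagonal:
  fixes r :: "'e::euclidean_space \<times> 'e \<Rightarrow> 'e \<times> 'e"
  assumes r: "smooth_on Y r" and y: "(q, 0) \<in> Y" and diag: "\<And>q. (q, 0) \<in> Y \<Longrightarrow> r (q, 0) = (q, q)"
  shows "FD r (q, 0) e = (fst e, fst e) + FD r (q, 0) (0, snd e)"
proof -
  have dr: "r differentiable (at (q, 0))" by (rule smooth_on_differentiable[OF r y])
  have "open ((\<lambda>q. (q, 0)) -` Y)"
    by (rule open_vimage[OF smooth_on_open[OF r]]) (intro continuous_intros)
  then have "FD (\<lambda>q. r (q, 0)) q = FD (\<lambda>q. (q, q)) q"
    by (rule FD_cong_open) (use y diag in auto)
  also have "\<dots> = (\<lambda>v. (v, v))" by (rule FD_eqI) (auto intro!: derivative_eq_intros)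
  finally have 1: "FD (\<lambda>q. r (q, 0)) q = (\<lambda>v. (v, v))" .
  have "bounded_linear (\<lambda>q. (q, 0::'e))"
    by (intro bounded_linear_Pair bounded_linear_zero bounded_linear_ident)
  from FD_compose_bounded_linear[OF this dr] 1 have "FD r (q, 0) (v, 0) = (v, v)" for v by simp
  moreover have "FD r (q, 0) e = FD r (q, 0) (fst e, 0) + FD r (q, 0) (0, snd e)"
    using linear_add[OF FD_linear[OF dr], of "(fst e, 0)" "(0, snd e)"] by simp
  ultimately show ?thesis by simp
qed

text \<open>In coordinates the base point of \<open>alpha_map\<close> is \<open>(q, q')\<close>; it
  has to lie in the set on which \<open>r\<close> is inverted.\<close>

definition lift_dom :: "('e \<times> 'e) set \<Rightarrow> (('e \<times> 'e) \<times> ('e \<times> 'e)) set" where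
  "lift_dom Y = {u. fst (swap4 u) \<in> Y}"

context
  fixes Y :: "('e::euclidean_space \<times> 'e) set" and r s :: "'e \<times> 'e \<Rightarrow> 'e \<times> 'e"
  assumes r: "smooth_on Y r" and s: "smooth_on (r ` Y) s" and sr: "\<And>y. y \<in> Y \<Longrightarrow> s (r y) = y"
begin

lemma open_lift_dom: "open (lift_dom Y)"
proof -
  have "continuous_on UNIV (\<lambda>u::('e \<times> 'e) \<times> ('e \<times> 'e). fst (swap4 u))"
    by (intro continuous_intros linear_continuous_on bounded_linear_swap4)
  then have "open ((\<lambda>u::('e \<times> 'e) \<times> ('e \<times> 'e). fst (swap4 u)) -` Y)"
    using smooth_on_open[OF r] by (simp add: continuous_on_open_vimage)
  then show ?thesis by (simp add: lift_dom_def vimage_def)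
qed

lemma cot_r: "smooth_on (Y \<times> UNIV) (cot_lift r s)" "smooth_on (r ` Y \<times> UNIV) (cot_lift s r)"
  by (rule smooth_on_cot_lift[OF r s] smooth_on_cot_lift[OF s r]; use sr in force)+

lemma smooth_on_lift_coord: "smooth_on (lift_dom Y) (lift_coord r s)"
proof -
  have "smooth_on (lift_dom Y) (\<lambda>u. sign4 (cot_lift r s (swap4 u)))"
    by (intro smooth_on_bounded_linear[OF bounded_linear_sign4] smooth_on_compose[OF cot_r(1)]
        smooth_on_linear[OF bounded_linear_swap4] open_lift_dom)
      (auto simp: lift_dom_def mem_Times_iff)
  then show ?thesis by (simp add: lift_coord_def[abs_def])
qed

text \<open>The lift maps onto whole fibres, so its image is described by base points alone. This
  form gives both the openness of the image and its containment in the range of the charts.\<close>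

lemma lift_coord_image: "lift_coord r s ` lift_dom Y = {v. fst (sign4_inv v) \<in> r ` Y}"
proof (intro equalityI subsetI)
  fix v assume "v \<in> lift_coord r s ` lift_dom Y"
  then show "v \<in> {v. fst (sign4_inv v) \<in> r ` Y}" by (auto simp: lift_coord_def lift_dom_def)
next
  fix v assume "v \<in> {v. fst (sign4_inv v) \<in> r ` Y}"
  then obtain y where y: "y \<in> Y" "fst (sign4_inv v) = r y" by auto
  define u where "u = swap4_inv (cot_lift s r (sign4_inv v))"
  have sw: "swap4 u = cot_lift s r (sign4_inv v)" by (simp add: u_def swap4_def swap4_inv_def prod_eq_iff)
  have "cot_lift r s (cot_lift s r (sign4_inv v)) = sign4_inv v"
    by (rule cot_lift_inverse[OF s r]) (use sr y in auto)
  then have "lift_coord r s u = v" by (simp add: lift_coord_def sw) (simp add: sign4_def sign4_inv_def)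
  moreover have "u \<in> lift_dom Y" using y sr by (simp add: lift_dom_def sw)
  ultimately show "v \<in> lift_coord r s ` lift_dom Y" by blast
qed

lemma smooth_on_lift_coord_inverse:
  shows "smooth_on (lift_coord r s ` lift_dom Y) (\<lambda>v. swap4_inv (cot_lift s r (sign4_inv v)))"
    and "u \<in> lift_dom Y \<Longrightarrow> swap4_inv (cot_lift s r (sign4_inv (lift_coord r s u))) = u"
proof -
  have "continuous_on UNIV (\<lambda>v::('e \<times> 'e) \<times> ('e \<times> 'e). fst (sign4_inv v))"
    by (intro continuous_intros linear_continuous_on bounded_linear_sign4_inv)
  then have "open ((\<lambda>v::('e \<times> 'e) \<times> ('e \<times> 'e). fst (sign4_inv v)) -` (r ` Y))"
    using smooth_on_open[OF s] by (simp add: continuous_on_open_vimage)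
  then have o: "open (lift_coord r s ` lift_dom Y)" by (simp add: lift_coord_image vimage_def)
  show "smooth_on (lift_coord r s ` lift_dom Y) (\<lambda>v. swap4_inv (cot_lift s r (sign4_inv v)))"
    by (intro smooth_on_bounded_linear[OF bounded_linear_swap4_inv] smooth_on_compose[OF cot_r(2)]
        smooth_on_linear[OF bounded_linear_sign4_inv] o)
      (unfold lift_coord_image, auto simp: mem_Times_iff)
  assume "u \<in> lift_dom Y"
  then have "cot_lift s r (cot_lift r s (swap4 u)) = swap4 u"
    by (intro cot_lift_inverse[OF r s]) (auto simp: sr lift_dom_def)
  then show "swap4_inv (cot_lift s r (sign4_inv (lift_coord r s u))) = u"
    by (simp add: lift_coord_def)
qed

text \<open>The form on the right is the canonical symplectic form of \<open>T\<^sup>*TQ\<close> pulled back to \<open>TT\<^sup>*Q\<close>.\<close>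

lemma lift_coord_symplectic:
  assumes "u \<in> lift_dom Y"
  shows "sform (snd (FD (lift_coord r s) u X)) (snd (FD (lift_coord r s) u Z))
    - sform (fst (FD (lift_coord r s) u X)) (fst (FD (lift_coord r s) u Z)) = sform (swap4 X) (swap4 Z)"
proof -
  have u: "fst (swap4 u) \<in> Y" using assms by (simp add: lift_dom_def)
  have d: "cot_lift r s differentiable (at (swap4 u))"
    by (rule smooth_on_differentiable[OF cot_r(1)]) (use u in \<open>simp add: mem_Times_iff\<close>)
  then have d': "(\<lambda>u. cot_lift r s (swap4 u)) differentiable (at u)"
    using differentiable_chain_at[OF bounded_linear_imp_differentiable[OF bounded_linear_swap4] d]
    by (simp add: o_def)
  have FD: "FD (lift_coord r s) u X = sign4 (FD (cot_lift r s) (swap4 u) (swap4 X))" for X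
    unfolding lift_coord_def[abs_def] FD_bounded_linear_compose[OF bounded_linear_sign4 d']
      FD_compose_bounded_linear[OF bounded_linear_swap4 d] ..
  have "sform (FD (cot_lift r s) (swap4 u) (swap4 X)) (FD (cot_lift r s) (swap4 u) (swap4 Z)) = sform (swap4 X) (swap4 Z)"
    by (rule cot_lift_symplectic[OF r s _ _ u]) (use sr in auto)
  then show ?thesis unfolding FD by (simp add: sign4_def sform_def inner_prod_def)
qed

text \<open>\<open>swap4\<close> sends the zero vector at \<open>(q, p)\<close> to the covector
  \<open>(0, p)\<close> at \<open>(q, 0)\<close>. The guess for the lifted covector is
  \<open>(- p, p)\<close>: paired with the derivative of \<open>r\<close>, the base contribution
  \<open>(v, v)\<close> cancels by the first axiom of a discretization map, and the fibre
  contribution reduces to \<open>p\<close> paired with the fibre part by the second.\<close>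

lemma lift_coord_zero:
  assumes diag: "\<And>q. (q, 0) \<in> Y \<Longrightarrow> r (q, 0) = (q, q)"
    and fib: "\<And>q v. (q, 0) \<in> Y \<Longrightarrow> snd (FD r (q, 0) (0, v)) - fst (FD r (q, 0) (0, v)) = v"
    and m: "(m, 0) \<in> lift_dom Y"
  shows "lift_coord r s (m, 0) = (m, m)"
proof -
  obtain q p where mq: "m = (q, p)" by (cases m)
  have y: "(q, 0) \<in> Y" using m by (simp add: lift_dom_def swap4_def mq)
  have FDe: "FD r (q, 0) e = (fst e, fst e) + FD r (q, 0) (0, snd e)" for e
    by (rule FD_diagonal[OF r y diag])
  have "cot_lift r s ((q, 0), (0, p)) = (r (q, 0), (- p, p))"
  proof (rule cot_lift_eqI[OF r s _ _ y])
    fix e :: "'e \<times> 'e"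
    have "snd (FD r (q, 0) (0, snd e)) = fst (FD r (q, 0) (0, snd e)) + snd e"
      using fib[OF y, of "snd e"] by (simp add: algebra_simps)
    then show "(- p, p) \<bullet> FD r (q, 0) e = (0, p) \<bullet> e"
      unfolding FDe[of e] by (simp add: inner_prod_def inner_add_right)
  qed (use sr in auto)
  then show ?thesis using diag[OF y] by (simp add: lift_coord_def swap4_def mq sign4_def)
qed

end

section \<open>The implicit step in coordinates\<close>

text \<open>To be solved for m is the equation that prescribes the first component of
  \<open>\<Psi>\<close> at (m, h X(m)). The map \<open>K\<close> preserves h and is the identity on
  the slice h = 0, so its derivative at \<open>(0, m0)\<close> has trivial kernel, and one
  application of the inverse function theorem covers all small h. The last two conclusions make
  \<open>G\<close> a left inverse on the box of pairs (h, m) and a right inverse on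
  \<open>S\<close>.\<close>

lemma implicit_step:
  fixes \<Psi> :: "'m::euclidean_space \<times> 'm \<Rightarrow> 'm \<times> 'm"
  assumes l: "smooth_on W \<Psi>" and diag: "\<And>m. (m, 0) \<in> W \<Longrightarrow> \<Psi> (m, 0) = (m, m)"
    and X: "smooth_on M X" and m0: "(m0, 0) \<in> W" "m0 \<in> M"
  obtains N S and G :: "real \<times> 'm \<Rightarrow> 'm" and a where "open N" "m0 \<in> N" "N \<subseteq> M"
    "smooth_on S G" "(0, m0) \<in> S" "G (0, m0) = m0" "a > 0"
    "\<And>h m. \<lbrakk>\<bar>h\<bar> < a; m \<in> N; (m, h *\<^sub>R X m) \<in> W\<rbrakk> \<Longrightarrow> G (h, fst (\<Psi> (m, h *\<^sub>R X m))) = m"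
    "\<And>h z. (h, z) \<in> S \<Longrightarrow> \<bar>h\<bar> < a \<and> G (h, z) \<in> N \<and> (G (h, z), h *\<^sub>R X (G (h, z))) \<in> W
       \<and> fst (\<Psi> (G (h, z), h *\<^sub>R X (G (h, z)))) = z"
proof -
  define P where "P = {x. snd x \<in> M \<and> (snd x, fst x *\<^sub>R X (snd x)) \<in> W}"
  define K where "K = (\<lambda>x. (fst x, fst (\<Psi> (snd x, fst x *\<^sub>R X (snd x)))))"
  have M: "open M" and W: "open W" using X l smooth_on_open by auto
  have UM: "open ((UNIV::real set) \<times> M)" using M by (simp add: open_Times)
  have kap: "smooth_on (UNIV \<times> M) (\<lambda>x. (snd x, fst x *\<^sub>R X (snd x)))"
    by (intro smooth_on_Pair smooth_on_bilinear[OF bounded_bilinear_scaleR] smooth_on_compose[OF X]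
        smooth_on_intros UM) auto
  have "P = (UNIV \<times> M) \<inter> (\<lambda>x. (snd x, fst x *\<^sub>R X (snd x))) -` W" by (auto simp: P_def)
  then have P: "open P"
    using continuous_open_preimage[OF smooth_on_continuous_on[OF kap] UM W] by simp
  have kapP: "smooth_on P (\<lambda>x. (snd x, fst x *\<^sub>R X (snd x)))"
    by (rule smooth_on_subset[OF kap P]) (auto simp: P_def mem_Times_iff)
  have K: "smooth_on P K" unfolding K_def
    by (intro smooth_on_Pair smooth_on_fst smooth_on_compose[OF l kapP] smooth_on_ident P)
      (auto simp: P_def)
  have x0: "(0, m0) \<in> P" using m0 by (simp add: P_def)
  have dK: "K differentiable (at (0, m0))" by (rule smooth_on_differentiable[OF K x0])
  have "inj (FD K (0, m0))"
  proof -
    have "FD (\<lambda>x. fst (K x)) (0, m0) v = fst (FD K (0, m0) v)" for v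
      by (rule FD_bounded_linear_compose[OF bounded_linear_fst dK])
    moreover have "FD (\<lambda>x. fst (K x)) (0, m0) = fst"
      by (rule FD_eqI) (auto simp: K_def intro!: derivative_eq_intros)
    ultimately have 1: "fst (FD K (0, m0) v) = fst v" for v by simp
    have "open ((\<lambda>m. (0, m)) -` P)"
      by (rule open_vimage[OF P]) (intro continuous_intros)
    then have "FD (\<lambda>m. K (0, m)) m0 = FD (\<lambda>m. (0, m)) m0"
      by (rule FD_cong_open) (use x0 diag in \<open>auto simp: K_def P_def\<close>)
    also have "\<dots> = (\<lambda>v. (0, v))" by (rule FD_eqI) (auto intro!: derivative_eq_intros)
    finally have 2: "FD (\<lambda>m. K (0, m)) m0 = (\<lambda>v. (0, v))" .
    have "bounded_linear (\<lambda>m. (0::real, m::'m))"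
      by (intro bounded_linear_Pair bounded_linear_zero bounded_linear_ident)
    from FD_compose_bounded_linear[OF this dK] 2 have 3: "FD K (0, m0) (0, v) = (0, v)" for v by simp
    show ?thesis
      unfolding linear_injective_0[OF FD_linear[OF dK]]
    proof (intro allI impI)
      fix v assume v: "FD K (0, m0) v = 0"
      then have "fst v = 0" using 1[of v] by simp
      then have "v = (0, snd v)" by (simp add: prod_eq_iff)
      then show "v = 0" using 3[of "snd v"] v by (metis snd_conv snd_zero zero_prod_def)
    qed
  qed
  from smooth_inverse_function[OF K x0 this] obtain T g where T: "open T" "(0, m0) \<in> T" "T \<subseteq> P"
    "\<And>x. x \<in> T \<Longrightarrow> g (K x) = x" "smooth_on (K ` T) g" by blast
  \<comment> \<open>A product neighborhood separates the condition on h from the condition on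
    m.\<close>
  obtain B N0 where B: "open B" "0 \<in> B" "open N0" "m0 \<in> N0" "B \<times> N0 \<subseteq> T"
    using T(1,2) by (auto elim!: open_prod_elim)
  obtain a where a: "a > 0" "\<And>h. \<bar>h\<bar> < a \<Longrightarrow> h \<in> B"
    using B(1,2) unfolding open_real_def[symmetric] by (metis dist_0_norm norm_conv_dist open_dist real_norm_def dist_commute)
  define N where "N = N0 \<inter> M"
  define Z where "Z = {h. \<bar>h\<bar> < a} \<times> N"
  \<comment> \<open>This is the image of the box \<open>Z\<close> under \<open>K\<close>, written
    with a preimage so that it is visibly open.\<close>
  define S where "S = K ` T \<inter> g -` Z"
  have oh: "open {h::real. \<bar>h\<bar> < a}"
    by (intro open_Collect_less continuous_intros)
  have N: "open N" "m0 \<in> N" using B M m0 by (auto simp: N_def)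
  have Z: "open Z" "Z \<subseteq> T" using oh N B a by (auto simp: Z_def N_def open_Times)
  have S: "open S" unfolding S_def
    by (rule continuous_open_preimage[OF smooth_on_continuous_on[OF T(5)] smooth_on_open[OF T(5)] Z(1)])
  have gS: "g y \<in> Z" "K (g y) = y" if "y \<in> S" for y
    using that T(4) Z by (auto simp: S_def)
  have KZ: "K x \<in> S" "g (K x) = x" if "x \<in> Z" for x
    using that T(4)[of x] Z(2) by (auto simp: S_def)
  have ZP: "x \<in> P" if "x \<in> Z" for x using that Z(2) T(3) by blast
  have 0: "K (0, m0) = (0, m0)" "(0, m0) \<in> Z"
    using diag[OF m0(1)] a(1) N by (auto simp: K_def Z_def)
  show ?thesis
  proof (rule that[of N S "\<lambda>y. snd (g y)" a])
    show "smooth_on S (\<lambda>y. snd (g y))"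
      by (rule smooth_on_snd[OF smooth_on_subset[OF T(5) S]]) (auto simp: S_def)
    show "(0, m0) \<in> S" using KZ(1)[OF 0(2)] 0(1) by simp
    show "snd (g (0, m0)) = m0" using KZ(2)[OF 0(2)] 0(1) by simp
    show "snd (g (h, fst (\<Psi> (m, h *\<^sub>R X m)))) = m" if "\<bar>h\<bar> < a" "m \<in> N" for h m
      using KZ(2)[of "(h, m)"] that by (simp add: Z_def K_def)
    show "\<bar>h\<bar> < a \<and> snd (g (h, z)) \<in> N \<and> (snd (g (h, z)), h *\<^sub>R X (snd (g (h, z)))) \<in> W
       \<and> fst (\<Psi> (snd (g (h, z)), h *\<^sub>R X (snd (g (h, z))))) = z" if "(h, z) \<in> S" for h z
    proof -
      have "fst (g (h, z)) = h" "fst (\<Psi> (snd (g (h, z)), fst (g (h, z)) *\<^sub>R X (snd (g (h, z))))) = z"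
        using gS(2)[OF that] by (auto simp: K_def prod_eq_iff)
      then show ?thesis using gS(1)[OF that] ZP[OF gS(1)[OF that]] by (auto simp: Z_def P_def)
    qed
  qed (use N a in \<open>auto simp: N_def\<close>)
qed

text \<open>Contracting the derivative of the Hamiltonian field with the form gives the Hessian of
  \<open>\<eta>\<close>. On two tangent vectors of the graph the value is therefore \<open>h\<close>
  times the difference of the Hessian and its transpose.\<close>

lemma ham_graph_isotropic:
  assumes e: "smooth_on M \<eta>" and m: "m \<in> M"
  shows "sform (swap4 (a, h *\<^sub>R FD (ham \<eta>) m a)) (swap4 (b, h *\<^sub>R FD (ham \<eta>) m b)) = 0"
proof -
  have dh: "(ham \<eta> has_derivative FD (ham \<eta>) m) (at m)"
    by (rule smooth_on_has_derivative[OF smooth_on_ham[OF e] m])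
  have D: "sform (FD (ham \<eta>) m b) a = FD (\<lambda>m. FD \<eta> m a) m b" for a b
  proof -
    have "linear (\<lambda>X. sform X a)"
      by (rule linearI) (auto simp: sform_def inner_simps algebra_simps)
    then have "bounded_linear (\<lambda>X. sform X a)" by (simp add: linear_conv_bounded_linear)
    from FD_bounded_linear_compose[OF this differentiableI[OF dh], of b]
    have "sform (FD (ham \<eta>) m b) a = FD (\<lambda>m. sform (ham \<eta> m) a) m b" by simp
    also have "FD (\<lambda>m. sform (ham \<eta> m) a) m = FD (\<lambda>m. FD \<eta> m a) m"
      by (rule FD_cong_open[OF smooth_on_open[OF e] m])
        (use sform_ham smooth_on_differentiable[OF e] in blast)
    finally show ?thesis .
  qed
  have "sform (swap4 (a, h *\<^sub>R FD (ham \<eta>) m a)) (swap4 (b, h *\<^sub>R FD (ham \<eta>) m b))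
    = h * (sform (FD (ham \<eta>) m a) b - sform (FD (ham \<eta>) m b) a)"
    by (simp add: sform_def swap4_def inner_prod_def algebra_simps inner_commute)
  also have "\<dots> = 0"
    unfolding D using second_derivative_symmetric[OF e m, of b a] by simp
  finally show ?thesis .
qed

text \<open>The map that sends z to \<open>\<Psi>\<close> at (G z, h X(G z)) is z paired with
  \<open>\<psi> z\<close>, and it factors through the graph of h X, where the form pulled back by
  \<open>\<Psi>\<close> vanishes. Hence the pullback of the canonical form by \<open>\<psi>\<close>
  minus the form itself is zero.\<close>

lemma implicit_step_symplectic:
  fixes \<Psi> :: "('e::euclidean_space \<times> 'e) \<times> ('e \<times> 'e) \<Rightarrow> ('e \<times> 'e) \<times> ('e \<times> 'e)"
  assumes l: "smooth_on W \<Psi>"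
    and symp: "\<And>u X Y. u \<in> W \<Longrightarrow> sform (snd (FD \<Psi> u X)) (snd (FD \<Psi> u Y))
      - sform (fst (FD \<Psi> u X)) (fst (FD \<Psi> u Y)) = sform (swap4 X) (swap4 Y)"
    and e: "smooth_on M \<eta>" and G: "smooth_on T G"
    and GT: "\<And>z. z \<in> T \<Longrightarrow> G z \<in> M \<and> (G z, h *\<^sub>R ham \<eta> (G z)) \<in> W \<and> fst (\<Psi> (G z, h *\<^sub>R ham \<eta> (G z))) = z"
    and z: "z \<in> T"
  defines "\<psi> \<equiv> \<lambda>z. snd (\<Psi> (G z, h *\<^sub>R ham \<eta> (G z)))"
  shows "smooth_on T \<psi>" "sform (FD \<psi> z X) (FD \<psi> z Y) = sform X Y"
proof -
  define \<kappa> where "\<kappa> = (\<lambda>m. (m, h *\<^sub>R ham \<eta> m))"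
  have T: "open T" using G by (rule smooth_on_open)
  have hG: "smooth_on T (\<lambda>z. ham \<eta> (G z))"
    by (rule smooth_on_compose[OF smooth_on_ham[OF e] G]) (use GT in auto)
  have kG: "smooth_on T (\<lambda>z. (G z, h *\<^sub>R ham \<eta> (G z)))"
    by (intro smooth_on_Pair smooth_on_bounded_linear[OF bounded_linear_scaleR_right] hG G)
  have lkG: "smooth_on T (\<lambda>z. \<Psi> (G z, h *\<^sub>R ham \<eta> (G z)))"
    by (rule smooth_on_compose[OF l kG]) (use GT in auto)
  then show "smooth_on T \<psi>" unfolding \<psi>_def by (rule smooth_on_snd)
  let ?u = "(G z, h *\<^sub>R ham \<eta> (G z))"
  let ?F = "\<lambda>X. FD \<Psi> ?u (FD G z X, h *\<^sub>R FD (ham \<eta>) (G z) (FD G z X))"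
  have dG: "(G has_derivative FD G z) (at z)" by (rule smooth_on_has_derivative[OF G z])
  have "((\<lambda>z. ham \<eta> (G z)) has_derivative (\<lambda>X. FD (ham \<eta>) (G z) (FD G z X))) (at z)"
    by (rule has_derivative_compose[OF dG smooth_on_has_derivative[OF smooth_on_ham[OF e]]])
      (use GT z in auto)
  then have "((\<lambda>z. (G z, h *\<^sub>R ham \<eta> (G z))) has_derivative
      (\<lambda>X. (FD G z X, h *\<^sub>R FD (ham \<eta>) (G z) (FD G z X)))) (at z)"
    by (intro has_derivative_Pair dG has_derivative_scaleR_right)
  from has_derivative_compose[OF this smooth_on_has_derivative[OF l]]
  have D: "((\<lambda>z. \<Psi> (G z, h *\<^sub>R ham \<eta> (G z))) has_derivative ?F) (at z)"
    using GT z by simp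
  have psi: "FD \<psi> z = (\<lambda>X. snd (?F X))"
    unfolding \<psi>_def by (rule FD_eqI[OF has_derivative_snd[OF D]])
  \<comment> \<open>By \<open>GT\<close> the first component is the identity on \<open>T\<close>, so
    its derivative returns each vector unchanged.\<close>
  have "((\<lambda>z. z) has_derivative (\<lambda>X. fst (?F X))) (at z)"
    by (rule has_derivative_transform_within_open[OF has_derivative_fst[OF D] T z]) (use GT in auto)
  from FD_eqI[OF this] have fst: "fst (?F X) = X" for X by (metis frechet_derivative_ident)
  have "sform (snd (?F X)) (snd (?F Y)) - sform (fst (?F X)) (fst (?F Y)) = 0"
    using symp[of ?u] GT[OF z] ham_graph_isotropic[OF e] by auto
  then show "sform (FD \<psi> z X) (FD \<psi> z Y) = sform X Y"
    unfolding psi fst by simp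
qed

section \<open>Discretization maps in charts\<close>

lemma fibre_chart_in_atlas: "c \<in> A \<Longrightarrow> x \<in> fst c \<Longrightarrow> (tspace A x, \<lambda>\<xi>. \<xi> c) \<in> fibre_atlas A x"
  unfolding fibre_atlas_def by blast

lemma fibre_chart_inv:
  assumes A: "smooth_atlas A" and c: "c \<in> A" "x \<in> fst c"
  shows "chart_inv (tspace A x, \<lambda>\<xi>. \<xi> c) v = tvec_of A c x v"
proof -
  have "inv_into (tspace A x) (\<lambda>\<xi>. \<xi> c) (tvec_of A c x v c) = tvec_of A c x v"
    by (rule inv_into_f_f[OF bij_betw_imp_inj_on[OF bij_betw_tangent_coord[OF A c]] tvec_of_in_tspace[OF A c]])
  then show ?thesis by (simp add: chart_inv_def tvec_of_same[OF A c])
qed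

lemma fibre_transition:
  assumes A: "smooth_atlas A" and c: "c \<in> A" "x \<in> fst c" and d: "d \<in> A" "x \<in> fst d"
  shows "(\<lambda>\<xi>. \<xi> d) \<circ> chart_inv (tspace A x, \<lambda>\<xi>. \<xi> c) = FD (snd d \<circ> chart_inv c) (snd c x)"
  using d by (auto simp: fibre_chart_inv[OF A c] tvec_of_def)

lemma smooth_fibre_atlas:
  assumes A: "smooth_atlas A"
  shows "smooth_atlas (fibre_atlas A x)"
  unfolding smooth_atlas_def
proof (intro conjI ballI)
  fix C assume "C \<in> fibre_atlas A x"
  then obtain c where c: "c \<in> A" "x \<in> fst c" "C = (tspace A x, \<lambda>\<xi>. \<xi> c)"
    by (auto simp: fibre_atlas_def)
  have bij: "bij_betw (snd C) (fst C) UNIV" using bij_betw_tangent_coord[OF A c(1,2)] c(3) by simp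
  then show "inj_on (snd C) (fst C)" "open (snd C ` fst C)" by (simp_all add: bij_betw_def)
  fix D assume "D \<in> fibre_atlas A x"
  then obtain d where d: "d \<in> A" "x \<in> fst d" "D = (tspace A x, \<lambda>\<xi>. \<xi> d)"
    by (auto simp: fibre_atlas_def)
  have "bounded_linear (FD (snd d \<circ> chart_inv c) (snd c x))"
    using FD_transition_linear[OF A c(1) d(1) c(2) d(2)] by (simp add: linear_conv_bounded_linear)
  then have "smooth_on UNIV (FD (snd d \<circ> chart_inv c) (snd c x))" by (rule smooth_on_linear) simp
  moreover have "snd C ` (fst C \<inter> fst D) = UNIV" using bij c d by (simp add: bij_betw_def)
  moreover have "snd D \<circ> chart_inv C = FD (snd d \<circ> chart_inv c) (snd c x)"
    using fibre_transition[OF A c(1,2) d(1,2)] c(3) d(3) by simp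
  ultimately show "smooth_on (snd C ` (fst C \<inter> fst D)) (snd D \<circ> chart_inv C)" by simp
qed

lemma fibre_tvec_in_tspace:
  assumes A: "smooth_atlas A" and \<xi>: "\<xi> \<in> tspace A x"
  shows "fibre_tvec A x \<xi> \<in> tspace (fibre_atlas A x) (\<lambda>_. 0)"
proof (rule tspaceI)
  show "fibre_tvec A x \<xi> C = 0" if "\<not> (C \<in> fibre_atlas A x \<and> (\<lambda>_. 0) \<in> fst C)" for C
    using that tspace_zero[OF A] by (auto simp: fibre_tvec_def fibre_atlas_def)
  fix C D assume C: "C \<in> fibre_atlas A x" and D: "D \<in> fibre_atlas A x"
  then obtain c d where c: "c \<in> A" "x \<in> fst c" "C = (tspace A x, \<lambda>\<xi>. \<xi> c)"
    and d: "d \<in> A" "x \<in> fst d" "D = (tspace A x, \<lambda>\<xi>. \<xi> d)"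
    by (auto simp: fibre_atlas_def)
  let ?L = "FD (snd d \<circ> chart_inv c) (snd c x)"
  have "bounded_linear ?L"
    using FD_transition_linear[OF A c(1) d(1) c(2) d(2)] by (simp add: linear_conv_bounded_linear)
  from FD_eqI[OF bounded_linear_imp_has_derivative[OF this]]
  have "FD (snd D \<circ> chart_inv C) (snd C (\<lambda>_. 0)) = ?L"
    using fibre_transition[OF A c(1,2) d(1,2)] c(3) d(3) by simp
  then show "fibre_tvec A x \<xi> D = FD (snd D \<circ> chart_inv C) (snd C (\<lambda>_. 0)) (fibre_tvec A x \<xi> C)"
    using C D tspace_transition[OF \<xi> c(1) d(1) c(2) d(2)] c(3) d(3) by (simp add: fibre_tvec_def)
qed

lemma tangent_chart_inv:
  assumes A: "smooth_atlas A" and c: "c \<in> A" "x \<in> fst c"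
  shows "chart_inv (tangent_chart A c) (snd c x, v) = (x, tvec_of A c x v)"
  using chart_inv_left[OF smooth_tangent_atlas[OF A] tangent_chart_in_atlas[OF c(1)], of "(x, tvec_of A c x v)"]
    tvec_of_in_tspace[OF A c] tvec_of_same[OF A c] c by simp

lemma snd_prod_chart': "snd (prod_chart c d) p = (snd c (fst p), snd d (snd p))"
  by (cases p) simp

text \<open>The second axiom of a discretization map is stated on the fibre as a manifold, through
  \<open>fibre_atlas\<close> and \<open>fibre_tvec\<close>. In the linear fibre chart induced by
  \<open>c\<close> it becomes a condition on the derivative of \<open>r\<close> in the fibre
  directions.\<close>

lemma discretization_fibre_derivative:
  assumes A: "smooth_atlas A" and R: "discretization_map A U R" and c: "c \<in> A" "x \<in> fst c"
  defines "r \<equiv> snd (prod_chart c c) \<circ> R \<circ> chart_inv (tangent_chart A c)"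
  assumes dr: "r differentiable (at (snd c x, 0))"
  shows "snd (FD r (snd c x, 0) (0, v)) - fst (FD r (snd c x, 0) (0, v)) = v"
proof -
  define \<xi> where "\<xi> = tvec_of A c x v"
  have \<xi>: "\<xi> \<in> tspace A x" "\<xi> c = v"
    unfolding \<xi>_def using tvec_of_in_tspace[OF A c] tvec_of_same[OF A c] by auto
  have x: "x \<in> points A" using c by (auto simp: points_def)
  have Rx: "R (x, \<lambda>_. 0) = (x, x)" using R x by (simp add: discretization_map_def)
  let ?C = "(tspace A x, \<lambda>\<xi>. \<xi> c)"
  note F = smooth_fibre_atlas[OF A, of x] fibre_chart_in_atlas[OF c]
  have ft: "fibre_tvec A x \<xi> ?C = v" using F(2) \<xi> by (simp add: fibre_tvec_def)
  have "((\<lambda>e. (snd c x, e)) has_derivative (\<lambda>e. (0, e))) (at 0)"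
    by (auto intro!: derivative_eq_intros)
  from has_derivative_compose[OF this, of r "FD r (snd c x, 0)"] FD_works[OF dr]
  have D: "((\<lambda>e. r (snd c x, e)) has_derivative (\<lambda>e. FD r (snd c x, 0) (0, e))) (at 0)" by simp
  have re: "r (snd c x, e) = (snd c (fst (R (x, tvec_of A c x e))), snd c (snd (R (x, tvec_of A c x e))))" for e
    unfolding r_def by (simp add: tangent_chart_inv[OF A c] snd_prod_chart')
  have "snd c \<circ> (\<lambda>v. snd (R (x, v))) \<circ> chart_inv ?C = (\<lambda>e. snd (r (snd c x, e)))"
    by (auto simp: re fibre_chart_inv[OF A c])
  with has_derivative_snd[OF D]
  have d1: "((snd c \<circ> (\<lambda>v. snd (R (x, v))) \<circ> chart_inv ?C) has_derivative (\<lambda>e. snd (FD r (snd c x, 0) (0, e)))) (at 0)"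
    by simp
  have "snd c \<circ> (\<lambda>v. fst (R (x, v))) \<circ> chart_inv ?C = (\<lambda>e. fst (r (snd c x, e)))"
    by (auto simp: re fibre_chart_inv[OF A c])
  with has_derivative_fst[OF D]
  have d2: "((snd c \<circ> (\<lambda>v. fst (R (x, v))) \<circ> chart_inv ?C) has_derivative (\<lambda>e. fst (FD r (snd c x, 0) (0, e)))) (at 0)"
    by simp
  have z: "(\<lambda>_. 0) \<in> fst ?C" using tspace_zero[OF A] by simp
  have "tmap (fibre_atlas A x) A (\<lambda>v. snd (R (x, v))) (\<lambda>_. 0) (fibre_tvec A x \<xi>) c = snd (FD r (snd c x, 0) (0, v))"
    using tmap_in_chart[OF F z c(1), of "\<lambda>v. snd (R (x, v))" "fibre_tvec A x \<xi>"]
      fibre_tvec_in_tspace[OF A \<xi>(1)] c Rx differentiableI[OF d1] FD_eqI[OF d1] ft by simp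
  moreover have "tmap (fibre_atlas A x) A (\<lambda>v. fst (R (x, v))) (\<lambda>_. 0) (fibre_tvec A x \<xi>) c = fst (FD r (snd c x, 0) (0, v))"
    using tmap_in_chart[OF F z c(1), of "\<lambda>v. fst (R (x, v))" "fibre_tvec A x \<xi>"]
      fibre_tvec_in_tspace[OF A \<xi>(1)] c Rx differentiableI[OF d2] FD_eqI[OF d2] ft by simp
  moreover have "(\<lambda>c. tmap (fibre_atlas A x) A (\<lambda>v. snd (R (x, v))) (\<lambda>_. 0) (fibre_tvec A x \<xi>) c
    - tmap (fibre_atlas A x) A (\<lambda>v. fst (R (x, v))) (\<lambda>_. 0) (fibre_tvec A x \<xi>) c) = \<xi>"
    using R x \<xi>(1) unfolding discretization_map_def by blast
  from fun_cong[OF this, of c]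
  have "tmap (fibre_atlas A x) A (\<lambda>v. snd (R (x, v))) (\<lambda>_. 0) (fibre_tvec A x \<xi>) c
    - tmap (fibre_atlas A x) A (\<lambda>v. fst (R (x, v))) (\<lambda>_. 0) (fibre_tvec A x \<xi>) c = \<xi> c" .
  ultimately show ?thesis using \<xi>(2) by simp
qed

text \<open>The two axioms are recorded at every zero vector in \<open>Y\<close> and not only at the
  one over \<open>x0\<close>, because the base point of the Hamiltonian vector varies in the
  integrator equation. \<open>Y\<close> itself comes from the inverse function theorem at the zero
  vector over \<open>x0\<close>.\<close>

lemma discretization_in_chart:
  assumes A: "smooth_atlas A" and R: "discretization_map A U R" and c: "c \<in> A" "x0 \<in> fst c"
  defines "r \<equiv> snd (prod_chart c c) \<circ> R \<circ> chart_inv (tangent_chart A c)"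
  obtains Y s where "smooth_on Y r" "smooth_on (r ` Y) s" "\<And>y. y \<in> Y \<Longrightarrow> s (r y) = y" "(snd c x0, 0) \<in> Y"
    "Y \<subseteq> (snd c ` fst c) \<times> UNIV" "r ` Y \<subseteq> (snd c ` fst c) \<times> (snd c ` fst c)"
    "\<And>z. \<lbrakk>z \<in> fst (tangent_chart A c); snd (tangent_chart A c) z \<in> Y\<rbrakk> \<Longrightarrow>
      z \<in> U \<and> R z \<in> fst (prod_chart c c) \<and> snd (prod_chart c c) (R z) = r (snd (tangent_chart A c) z)"
    "\<And>q. (q, 0) \<in> Y \<Longrightarrow> r (q, 0) = (q, q)"
    "\<And>q v. (q, 0) \<in> Y \<Longrightarrow> snd (FD r (q, 0) (0, v)) - fst (FD r (q, 0) (0, v)) = v"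
proof -
  let ?T = "tangent_chart A c" and ?P = "prod_chart c c"
  note TA = smooth_tangent_atlas[OF A] and PA = smooth_prod_atlas[OF A A]
  note T = tangent_chart_in_atlas[OF c(1)] and P = prod_chart_in_atlas[OF c(1) c(1)]
  have Rs: "smooth_map (tangent_atlas A) (prod_atlas A A) U R" using R by (simp add: discretization_map_def)
  have R0: "R (x, \<lambda>_. 0) = (x, x)" "(x, \<lambda>_. 0) \<in> U" if "x \<in> fst c" for x
    using R that c by (auto simp: discretization_map_def points_def)
  define N where "N = {z \<in> U. R z \<in> fst ?P} \<inter> fst ?T"
  have N: "openin (manifold_top (tangent_atlas A)) N" unfolding N_def
    using smooth_map_preimage[OF TA PA Rs openin_chart_domain[OF PA P]] openin_chart_domain[OF TA T] by blast
  define Y1 where "Y1 = snd ?T ` N"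
  have r1: "smooth_on Y1 r" unfolding Y1_def r_def
    by (rule smooth_map_in_charts[OF TA PA Rs T P N]) (auto simp: N_def)
  have im: "snd ?T ` fst ?T = (snd c ` fst c) \<times> UNIV"
    using tangent_chart_image[OF A c(1) order_refl] by simp
  have YT: "Y1 \<subseteq> (snd c ` fst c) \<times> UNIV" unfolding im[symmetric] Y1_def N_def by blast
  have inN: "z \<in> N" if zT: "z \<in> fst ?T" and zY: "snd ?T z \<in> Y1" for z
  proof -
    obtain z' where z': "z' \<in> N" "snd ?T z = snd ?T z'" using zY by (auto simp: Y1_def)
    then have "z = z'" using inj_onD[OF chart_inj[OF TA T] z'(2) zT] by (simp add: N_def)
    then show ?thesis using z' by simp
  qed
  have z0: "(x, \<lambda>_. 0) \<in> fst ?T" "snd ?T (x, \<lambda>_. 0) = (snd c x, 0)" if "x \<in> fst c" for x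
    using that tspace_zero[OF A] by auto
  have rT: "r (snd ?T z) = snd ?P (R z)" if "z \<in> fst ?T" for z
    using chart_inv_left[OF TA T that] by (simp add: r_def)
  have diag: "r (q, 0) = (q, q)" if q: "(q, 0) \<in> Y1" for q
  proof -
    obtain x where x: "x \<in> fst c" "q = snd c x" using YT q by blast
    then show ?thesis using rT[OF z0(1)[OF x(1)]] z0(2)[OF x(1)] R0[OF x(1)] by simp
  qed
  have fib: "snd (FD r (q, 0) (0, v)) - fst (FD r (q, 0) (0, v)) = v" if q: "(q, 0) \<in> Y1" for q v
  proof -
    obtain x where x: "x \<in> fst c" "q = snd c x" using YT q by blast
    then show ?thesis
      using discretization_fibre_derivative[OF A R c(1) x(1), of v] smooth_on_differentiable[OF r1 q]
      by (simp add: r_def)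
  qed
  have x0: "(snd c x0, 0) \<in> Y1"
  proof -
    have "(x0, \<lambda>_. 0) \<in> N" using R0[OF c(2)] z0(1)[OF c(2)] c(2) by (simp add: N_def)
    then show ?thesis unfolding Y1_def using z0(2)[OF c(2)] by (metis imageI)
  qed
  \<comment> \<open>On a kernel vector, the second component of the derivative minus the first is
    the fibre part, which thus vanishes; what is left is the diagonal term
    \<open>(fst e, fst e)\<close>, which then vanishes too.\<close>
  have "inj (FD r (snd c x0, 0))"
  proof -
    have dr: "r differentiable (at (snd c x0, 0))" by (rule smooth_on_differentiable[OF r1 x0])
    show ?thesis unfolding linear_injective_0[OF FD_linear[OF dr]]
    proof (intro allI impI)
      fix e assume e: "FD r (snd c x0, 0) e = 0"
      have 1: "FD r (snd c x0, 0) e = (fst e, fst e) + FD r (snd c x0, 0) (0, snd e)"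
        by (rule FD_diagonal[OF r1 x0 diag])
      have 2: "snd (FD r (snd c x0, 0) (0, snd e)) - fst (FD r (snd c x0, 0) (0, snd e)) = snd e"
        by (rule fib[OF x0])
      have "snd (FD r (snd c x0, 0) e) - fst (FD r (snd c x0, 0) e) = snd e" unfolding 1 using 2 by simp
      then have "snd e = 0" using e by simp
      moreover have "FD r (snd c x0, 0) (0, 0) = 0"
        using linear_0[OF FD_linear[OF dr]] by (simp add: zero_prod_def)
      ultimately have "(fst e, fst e) = 0" using 1 e by simp
      then have "fst e = 0" by (simp add: zero_prod_def)
      then show "e = 0" using \<open>snd e = 0\<close> by (simp add: prod_eq_iff)
    qed
  qed
  from smooth_inverse_function[OF r1 x0 this] obtain Y s where Y: "open Y" "(snd c x0, 0) \<in> Y" "Y \<subseteq> Y1"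
    "\<And>y. y \<in> Y \<Longrightarrow> s (r y) = y" "smooth_on (r ` Y) s" by blast
  show ?thesis
  proof (rule that[of Y s])
    show "smooth_on Y r" by (rule smooth_on_subset[OF r1 Y(1,3)])
    show "Y \<subseteq> (snd c ` fst c) \<times> UNIV" using Y(3) YT by blast
    show zY: "z \<in> U \<and> R z \<in> fst ?P \<and> snd ?P (R z) = r (snd ?T z)" if "z \<in> fst ?T" "snd ?T z \<in> Y" for z
      using inN[OF that(1)] that Y(3) rT[OF that(1)] by (auto simp: N_def)
    show "r ` Y \<subseteq> (snd c ` fst c) \<times> (snd c ` fst c)"
    proof
      fix u assume "u \<in> r ` Y"
      then obtain y where y: "y \<in> Y" "u = r y" by auto
      then obtain z where "z \<in> N" "y = snd ?T z" using Y(3) by (auto simp: Y1_def)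
      then have "R z \<in> fst ?P" "u = snd ?P (R z)" using rT y by (auto simp: N_def)
      then show "u \<in> (snd c ` fst c) \<times> (snd c ` fst c)" by (auto simp: snd_prod_chart')
    qed
  qed (use Y diag fib in auto)
qed

section \<open>The cotangent lift in charts\<close>

lemma Phi_map_in_chart:
  assumes A: "smooth_atlas A" and c: "c \<in> A" "x0 \<in> fst c" and d: "d \<in> A" "x1 \<in> fst d"
    and p: "p0 \<in> cotspace A x0" "p1 \<in> cotspace A x1" and \<zeta>: "\<zeta> \<in> tspace (prod_atlas A A) (x0, x1)"
  shows "snd (Phi_map A ((x0, p0), (x1, p1))) \<zeta>
    = (- cov_coord A c x0 p0, cov_coord A d x1 p1) \<bullet> \<zeta> (prod_chart c d)"
proof -
  note PA = smooth_prod_atlas[OF A A]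
  have m: "(x0, x1) \<in> fst c \<times> fst d" using c d by simp
  have "tmap (prod_atlas A A) A fst (x0, x1) \<zeta> \<in> tspace A x0"
    using tmap_in_tspace[OF PA A smooth_map_fst(1)[OF A A c(1) d(1)] m \<zeta>] by simp
  from cotspace_apply[OF A c p(1) this]
  have 1: "p0 (tmap (prod_atlas A A) A fst (x0, x1) \<zeta>) = cov_coord A c x0 p0 \<bullet> fst (\<zeta> (prod_chart c d))"
    using smooth_map_fst(2)[OF A A c(1) d(1) c(2) d(2) \<zeta>] by simp
  have "tmap (prod_atlas A A) A snd (x0, x1) \<zeta> \<in> tspace A x1"
    using tmap_in_tspace[OF PA A smooth_map_snd(1)[OF A A c(1) d(1)] m \<zeta>] by simp
  from cotspace_apply[OF A d p(2) this]
  have 2: "p1 (tmap (prod_atlas A A) A snd (x0, x1) \<zeta>) = cov_coord A d x1 p1 \<bullet> snd (\<zeta> (prod_chart c d))"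
    using smooth_map_snd(2)[OF A A c(1) d(1) c(2) d(2) \<zeta>] by simp
  show ?thesis using \<zeta> by (simp add: Phi_map_def 1 2 inner_prod_def)
qed

lemma fst_Phi_map [simp]: "fst (Phi_map A (z0, z1)) = (fst z0, fst z1)"
  by (simp add: Phi_map_def case_prod_beta)

text \<open>\<open>cotangent_lift\<close> uses an \<open>inv_into\<close> of \<open>Phi_map\<close>,
  and injectivity is what pins down its value. Testing on all tangent vectors of the product
  recovers both fibre coordinates.\<close>

lemma inj_on_Phi_map:
  assumes A: "smooth_atlas A"
  shows "inj_on (Phi_map A) (points (cotangent_atlas A) \<times> points (cotangent_atlas A))"
proof (rule inj_onI)
  note PA = smooth_prod_atlas[OF A A]
  fix Z W assume Z: "Z \<in> points (cotangent_atlas A) \<times> points (cotangent_atlas A)"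
    and W: "W \<in> points (cotangent_atlas A) \<times> points (cotangent_atlas A)"
    and eq: "Phi_map A Z = Phi_map A W"
  obtain x0 p0 x1 p1 where Z': "Z = ((x0, p0), (x1, p1))" by (metis surj_pair)
  obtain y0 p0' y1 p1' where W': "W = ((y0, p0'), (y1, p1'))" by (metis surj_pair)
  have xy: "y0 = x0" "y1 = x1" using arg_cong[OF eq, of fst] unfolding Z' W' fst_Phi_map by auto
  define c d where "c = chart_at A x0" and "d = chart_at A x1"
  have x: "x0 \<in> points A" "x1 \<in> points A" using Z Z' by (auto simp: points_cotangent_atlas)
  have c: "c \<in> A" "x0 \<in> fst c" and d: "d \<in> A" "x1 \<in> fst d"
    unfolding c_def d_def by (rule chart_at[OF x(1)] chart_at[OF x(2)])+
  have p: "p0 \<in> cotspace A x0" "p1 \<in> cotspace A x1" "p0' \<in> cotspace A x0" "p1' \<in> cotspace A x1"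
    using Z W by (auto simp: Z' W' xy points_cotangent_atlas)
  have m: "(x0, x1) \<in> fst (prod_chart c d)" using c d by simp
  have "(- cov_coord A c x0 p0, cov_coord A d x1 p1) \<bullet> e = (- cov_coord A c x0 p0', cov_coord A d x1 p1') \<bullet> e" for e
  proof -
    let ?\<zeta> = "tvec_of (prod_atlas A A) (prod_chart c d) (x0, x1) e"
    have t: "?\<zeta> \<in> tspace (prod_atlas A A) (x0, x1)" "?\<zeta> (prod_chart c d) = e"
      using tvec_of_in_tspace[OF PA prod_chart_in_atlas[OF c(1) d(1)] m]
        tvec_of_same[OF PA prod_chart_in_atlas[OF c(1) d(1)] m] by auto
    show ?thesis
      using Phi_map_in_chart[OF A c d p(1,2) t(1)] Phi_map_in_chart[OF A c d p(3,4) t(1)] eq t(2)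
      by (simp add: Z' W' xy)
  qed
  then have "(- cov_coord A c x0 p0, cov_coord A d x1 p1) = (- cov_coord A c x0 p0', cov_coord A d x1 p1')"
    by (metis euclidean_eqI)
  then have "cov_coord A c x0 p0 = cov_coord A c x0 p0'" "cov_coord A d x1 p1 = cov_coord A d x1 p1'" by auto
  then have "p0 = p0'" "p1 = p1'"
    using bij_betw_imp_inj_on[OF bij_betw_cotangent_coord[OF A c]]
      bij_betw_imp_inj_on[OF bij_betw_cotangent_coord[OF A d]] p by (blast dest: inj_onD)+
  then show "Z = W" by (simp add: Z' W' xy)
qed

text \<open>Two choices are hidden in \<open>cotangent_lift\<close>, the \<open>inv_into\<close> in
  \<open>hat\<close> and that of \<open>Phi_map\<close>. Both are resolved by explicit preimages:
  the derivative of \<open>s\<close> inverts the tangent map of \<open>R\<close>, and the two blocks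
  of its adjoint supply the fibre coordinates.\<close>

lemma cotangent_lift_in_chart:
  fixes A :: "('a, 'e::euclidean_space) atlas" and R :: "('a, 'e) tangent \<Rightarrow> 'a \<times> 'a"
  assumes A: "smooth_atlas A" and c: "c \<in> A"
  defines "r \<equiv> snd (prod_chart c c) \<circ> R \<circ> chart_inv (tangent_chart A c)"
  assumes r: "smooth_on Y r" and s: "smooth_on (r ` Y) s" and sr: "\<And>y. y \<in> Y \<Longrightarrow> s (r y) = y"
    and YR: "\<And>z. \<lbrakk>z \<in> fst (tangent_chart A c); snd (tangent_chart A c) z \<in> Y\<rbrakk> \<Longrightarrow> R z \<in> fst (prod_chart c c)"
    and RV: "smooth_map (tangent_atlas A) (prod_atlas A A) {z \<in> fst (tangent_chart A c). snd (tangent_chart A c) z \<in> Y} R"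
    and w: "w \<in> fst (tangent_chart (cotangent_atlas A) (cotangent_chart A c))"
      "fst (swap4 (snd (tangent_chart (cotangent_atlas A) (cotangent_chart A c)) w)) \<in> Y"
  shows "cotangent_lift A R w \<in> fst (prod_chart (cotangent_chart A c) (cotangent_chart A c))"
    "snd (prod_chart (cotangent_chart A c) (cotangent_chart A c)) (cotangent_lift A R w)
      = lift_coord r s (snd (tangent_chart (cotangent_atlas A) (cotangent_chart A c)) w)"
    "fst (alpha_map A w) \<in> {z \<in> fst (tangent_chart A c). snd (tangent_chart A c) z \<in> Y}"
proof -
  let ?T = "tangent_chart A c" and ?P = "prod_chart c c" and ?C = "cotangent_chart A c"
  let ?TC = "tangent_chart (cotangent_atlas A) ?C" and ?PA = "prod_atlas A A" and ?TA = "tangent_atlas A"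
  note TA = smooth_tangent_atlas[OF A] and PA = smooth_prod_atlas[OF A A] and CA = smooth_cotangent_atlas[OF A]
  note T = tangent_chart_in_atlas[OF c] and P = prod_chart_in_atlas[OF c c] and C = cotangent_chart_in_atlas[OF c]
  have wp: "w \<in> points (tangent_atlas (cotangent_atlas A))"
    using w(1) tangent_chart_in_atlas[OF C] by (auto simp only: points_def)
  have wc: "fst (fst w) \<in> fst c" using w(1) by (cases w) auto
  obtain y \<beta> where al: "alpha_map A w = (y, \<beta>)" by (metis surj_pair)
  from alpha_map_in_chart[OF A c wp wc] al
  have y: "y \<in> fst ?T" and \<beta>: "\<beta> \<in> cotspace ?TA y"
    and sw: "swap4 (snd ?TC w) = (snd ?T y, cov_coord ?TA ?T y \<beta>)" by auto
  define \<pi> where "\<pi> = cov_coord ?TA ?T y \<beta>"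
  have yY: "snd ?T y \<in> Y" using w(2) sw by simp
  let ?V = "{z \<in> fst ?T. snd ?T z \<in> Y}"
  have yV: "y \<in> ?V" using y yY by simp
  then show "fst (alpha_map A w) \<in> ?V" using al by simp
  have Ry: "R y \<in> fst ?P" by (rule YR[OF y yY])
  have rT: "r (snd ?T y) = snd ?P (R y)" using chart_inv_left[OF TA T y] by (simp add: r_def)
  obtain x0 x1 where x: "R y = (x0, x1)" by (metis surj_pair)
  have x01: "x0 \<in> fst c" "x1 \<in> fst c" using Ry x by auto
  obtain a b where ab: "adjoint (FD s (r (snd ?T y))) \<pi> = (a, b)" by (metis surj_pair)
  \<comment> \<open>The sign anticipates the one in \<open>Phi_map\<close>, whose first block is
    minus the coordinate of \<open>p0\<close>.\<close>
  define p0 p1 where "p0 = cov_of A c x0 (- a)" and "p1 = cov_of A c x1 b"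
  have p: "p0 \<in> cotspace A x0" "p1 \<in> cotspace A x1" "cov_coord A c x0 p0 = - a" "cov_coord A c x1 p1 = b"
    unfolding p0_def p1_def using cov_of_in_cotspace[OF A] cov_coord_of[OF A c] x01 by auto
  have "Phi_map A ((x0, p0), (x1, p1)) = hat ?TA ?PA R (y, \<beta>)"
  proof -
    have tm: "tmap ?TA ?PA R y \<zeta> ?P = FD r (snd ?T y) (\<zeta> ?T)" if "\<zeta> \<in> tspace ?TA y" for \<zeta>
      using tmap_in_chart[where F = R and x = y, OF TA T y P Ry that] smooth_on_differentiable[OF r yY] by (simp add: r_def)
    have tm_in: "tmap ?TA ?PA R y \<zeta> \<in> tspace ?PA (x0, x1)" if "\<zeta> \<in> tspace ?TA y" for \<zeta>
      using tmap_in_tspace[OF TA PA RV yV that] x by simp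
    have sR: "FD s (r (snd ?T y)) (FD r (snd ?T y) e) = e" for e
      by (rule FD_left_inverse[OF r s _ _ yY]) (use sr in auto)
    have Rs: "FD r (snd ?T y) (FD s (r (snd ?T y)) e) = e" for e
    proof -
      have "FD r (s (r (snd ?T y))) (FD s (r (snd ?T y)) e) = e"
      proof (rule FD_left_inverse[OF s r])
        show "s u \<in> Y" "r (s u) = u" if "u \<in> r ` Y" for u using that sr by auto
      qed (use yY in simp)
      then show ?thesis using sr[OF yY] by simp
    qed
    have inj: "inj_on (tmap ?TA ?PA R y) (tspace ?TA y)"
    proof (rule inj_onI)
      fix \<zeta> \<zeta>' assume z: "\<zeta> \<in> tspace ?TA y" "\<zeta>' \<in> tspace ?TA y" "tmap ?TA ?PA R y \<zeta> = tmap ?TA ?PA R y \<zeta>'"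
      then have "FD r (snd ?T y) (\<zeta> ?T) = FD r (snd ?T y) (\<zeta>' ?T)" using tm by metis
      then have "\<zeta> ?T = \<zeta>' ?T" using sR by metis
      then show "\<zeta> = \<zeta>'" by (rule tspace_eqI[OF z(1,2) T y])
    qed
    have "snd (Phi_map A ((x0, p0), (x1, p1))) \<eta> = \<beta> (inv_into (tspace ?TA y) (tmap ?TA ?PA R y) \<eta>)"
      if \<eta>: "\<eta> \<in> tspace ?PA (x0, x1)" for \<eta>
    proof -
      \<comment> \<open>This is the preimage of \<open>\<eta>\<close> under the tangent map of
        \<open>R\<close>.\<close>
      define \<zeta> where "\<zeta> = tvec_of ?TA ?T y (FD s (r (snd ?T y)) (\<eta> ?P))"
      have \<zeta>: "\<zeta> \<in> tspace ?TA y" "\<zeta> ?T = FD s (r (snd ?T y)) (\<eta> ?P)"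
        unfolding \<zeta>_def using tvec_of_in_tspace[OF TA T y] tvec_of_same[OF TA T y] by auto
      have "tmap ?TA ?PA R y \<zeta> = \<eta>"
      proof (rule tspace_eqI[OF tm_in[OF \<zeta>(1)] \<eta> P])
        show "(x0, x1) \<in> fst ?P" using x01 by simp
        show "tmap ?TA ?PA R y \<zeta> ?P = \<eta> ?P" using tm[OF \<zeta>(1)] \<zeta>(2) Rs by simp
      qed
      then have "inv_into (tspace ?TA y) (tmap ?TA ?PA R y) \<eta> = \<zeta>"
        using inj \<zeta>(1) by (metis inv_into_f_f)
      then have "\<beta> (inv_into (tspace ?TA y) (tmap ?TA ?PA R y) \<eta>) = \<pi> \<bullet> FD s (r (snd ?T y)) (\<eta> ?P)"
        using cotspace_apply[OF TA T y \<beta> \<zeta>(1)] \<zeta>(2) by (simp add: \<pi>_def)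
      also have "\<dots> = (a, b) \<bullet> \<eta> ?P"
        using smooth_on_FD_linear[OF s] yY ab by (metis adjoint_clauses(2) imageI)
      also have "\<dots> = snd (Phi_map A ((x0, p0), (x1, p1))) \<eta>"
        using Phi_map_in_chart[OF A c x01(1) c x01(2) p(1,2) \<eta>] p(3,4) by simp
      finally show ?thesis by simp
    qed
    moreover have "snd (Phi_map A ((x0, p0), (x1, p1))) \<eta> = 0" if "\<eta> \<notin> tspace ?PA (x0, x1)" for \<eta>
      using that by (simp add: Phi_map_def)
    ultimately show ?thesis by (intro prod_eqI) (auto simp: hat_def x)
  qed
  then have al': "hat ?TA ?PA R (alpha_map A w) = Phi_map A ((x0, p0), (x1, p1))" using al by simp
  have "x0 \<in> points A" "x1 \<in> points A" using x01 c by (auto simp: points_def)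
  then have "((x0, p0), (x1, p1)) \<in> points (cotangent_atlas A) \<times> points (cotangent_atlas A)"
    using p(1,2) by (simp add: points_cotangent_atlas)
  from inv_into_f_f[OF inj_on_Phi_map[OF A] this]
  have lift: "cotangent_lift A R w = ((x0, p0), (x1, p1))"
    by (simp add: cotangent_lift_def al')
  show "cotangent_lift A R w \<in> fst (prod_chart ?C ?C)" unfolding lift using x01 p by simp
  have "cot_lift r s (swap4 (snd ?TC w)) = ((snd c x0, snd c x1), (a, b))"
    unfolding sw cot_lift_def using ab rT x by (simp add: \<pi>_def)
  then show "snd (prod_chart ?C ?C) (cotangent_lift A R w) = lift_coord r s (snd ?TC w)"
    unfolding lift lift_coord_def using p by (simp add: sign4_def)
qed

lemma chart_preimage_image: "S \<subseteq> snd c ` fst c \<Longrightarrow> snd c ` {x \<in> fst c. snd c x \<in> S} = S"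
  by auto

lemma cotangent_chart_range:
  assumes "smooth_atlas A" "c \<in> A"
  shows "snd (cotangent_chart A c) ` fst (cotangent_chart A c) = (snd c ` fst c) \<times> UNIV"
  using cotangent_chart_image[OF assms order_refl] by simp

lemma tangent_chart_range:
  assumes "smooth_atlas A" "c \<in> A"
  shows "snd (tangent_chart A c) ` fst (tangent_chart A c) = (snd c ` fst c) \<times> UNIV"
  using tangent_chart_image[OF assms order_refl] by simp

text \<open>It has two uses: the invertible restriction shows that the lift has local inverses
  around each zero vector, and \<open>\<Psi>\<close> with its properties is all that the
  construction of the step needs to know about how the lift acts there.\<close>

lemma cotangent_lift_local_form:
  fixes A :: "('a, 'e::euclidean_space) atlas"
  assumes A: "smooth_atlas A" and R: "discretization_map A U R" and c: "c \<in> A"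
    and z: "z \<in> fst (cotangent_chart A c)"
  defines "C \<equiv> cotangent_chart A c" and "TC \<equiv> tangent_chart (cotangent_atlas A) (cotangent_chart A c)"
  obtains W \<Psi> D where "smooth_on W \<Psi>" "(snd C z, 0) \<in> W"
    "lift_invertible_on A U R {w \<in> fst TC. snd TC w \<in> W} D"
    "\<And>w. \<lbrakk>w \<in> fst TC; snd TC w \<in> W\<rbrakk> \<Longrightarrow> cotangent_lift A R w \<in> fst (prod_chart C C) \<and>
       snd (prod_chart C C) (cotangent_lift A R w) = \<Psi> (snd TC w)"
    "\<And>m. (m, 0) \<in> W \<Longrightarrow> \<Psi> (m, 0) = (m, m)"
    "\<And>u X Y. u \<in> W \<Longrightarrow> sform (snd (FD \<Psi> u X)) (snd (FD \<Psi> u Y))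
      - sform (fst (FD \<Psi> u X)) (fst (FD \<Psi> u Y)) = sform (swap4 X) (swap4 Y)"
proof -
  let ?T = "tangent_chart A c" and ?P = "prod_chart c c"
  let ?TA = "tangent_atlas A" and ?PA = "prod_atlas A A" and ?CA = "cotangent_atlas A"
  note CA = smooth_cotangent_atlas[OF A] and TA = smooth_tangent_atlas[OF A] and PA = smooth_prod_atlas[OF A A]
  note TCA = smooth_tangent_atlas[OF CA] and PCA = smooth_prod_atlas[OF CA CA]
  have T: "?T \<in> ?TA" by (rule tangent_chart_in_atlas[OF c])
  have P: "?P \<in> ?PA" by (rule prod_chart_in_atlas[OF c c])
  have C: "C \<in> ?CA" unfolding C_def by (rule cotangent_chart_in_atlas[OF c])
  have TC: "TC \<in> tangent_atlas ?CA" unfolding TC_def C_def[symmetric] by (rule tangent_chart_in_atlas[OF C])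
  have PC: "prod_chart C C \<in> prod_atlas ?CA ?CA" by (rule prod_chart_in_atlas[OF C C])
  define r where "r = snd ?P \<circ> R \<circ> chart_inv ?T"
  have x0: "fst z \<in> fst c" using z by auto
  from discretization_in_chart[OF A R c x0, folded r_def]
  obtain Y s where Y: "smooth_on Y r" "smooth_on (r ` Y) s" "\<And>y. y \<in> Y \<Longrightarrow> s (r y) = y" "(snd c (fst z), 0) \<in> Y"
    "Y \<subseteq> (snd c ` fst c) \<times> UNIV" "r ` Y \<subseteq> (snd c ` fst c) \<times> (snd c ` fst c)"
    "\<And>z. \<lbrakk>z \<in> fst ?T; snd ?T z \<in> Y\<rbrakk> \<Longrightarrow> z \<in> U \<and> R z \<in> fst ?P \<and> snd ?P (R z) = r (snd ?T z)"
    "\<And>q. (q, 0) \<in> Y \<Longrightarrow> r (q, 0) = (q, q)"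
    "\<And>q v. (q, 0) \<in> Y \<Longrightarrow> snd (FD r (q, 0) (0, v)) - fst (FD r (q, 0) (0, v)) = v" by metis
  \<comment> \<open>\<open>R\<close> will be a diffeomorphism from \<open>V\<close> onto
    \<open>DR\<close>, which is the witness required by \<open>cotangent_lift_dom\<close>.\<close>
  define V where "V = {z \<in> fst ?T. snd ?T z \<in> Y}"
  define DR where "DR = {p \<in> fst ?P. snd ?P p \<in> r ` Y}"
  have imV: "snd ?T ` V = Y"
    unfolding V_def by (rule chart_preimage_image) (use Y(5) tangent_chart_range[OF A c] in simp)
  have imDR: "snd ?P ` DR = r ` Y"
    unfolding DR_def by (rule chart_preimage_image) (use Y(6) in \<open>simp add: prod_chart_image\<close>)
  have dR: "diffeomorphism ?TA ?PA V DR R"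
    by (rule diffeomorphism_chartI[OF TA PA T P, of V R r DR s])
      (use imV imDR Y(1-3,7) in \<open>auto simp: V_def DR_def\<close>)
  then have RV: "smooth_map ?TA ?PA {z \<in> fst ?T. snd ?T z \<in> Y} R" by (simp add: diffeomorphism_def V_def)
  define W where "W = lift_dom Y"
  define \<Psi> where "\<Psi> = lift_coord r s"
  have sW: "smooth_on W \<Psi>" unfolding W_def \<Psi>_def by (rule smooth_on_lift_coord[OF Y(1-3)])
  note lift = cotangent_lift_in_chart[OF A c, where R = R, folded r_def TC_def C_def, OF Y(1-3) _ RV]
  have lift1: "cotangent_lift A R w \<in> fst (prod_chart C C)"
     "snd (prod_chart C C) (cotangent_lift A R w) = \<Psi> (snd TC w)" "fst (alpha_map A w) \<in> V"
    if w: "w \<in> fst TC" "snd TC w \<in> W" for w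
  proof -
    have w2: "fst (swap4 (snd TC w)) \<in> Y" using w(2) by (simp add: W_def lift_dom_def)
    show "cotangent_lift A R w \<in> fst (prod_chart C C)" by (rule lift(1)[OF _ _ w(1) w2]) (use Y(7) in blast)+
    show "snd (prod_chart C C) (cotangent_lift A R w) = \<Psi> (snd TC w)"
      unfolding \<Psi>_def by (rule lift(2)[OF _ _ w(1) w2]) (use Y(7) in blast)+
    show "fst (alpha_map A w) \<in> V" unfolding V_def by (rule lift(3)[OF _ _ w(1) w2]) (use Y(7) in blast)+
  qed
  define V1 where "V1 = {w \<in> fst TC. snd TC w \<in> W}"
  define D1 where "D1 = {p \<in> fst (prod_chart C C). snd (prod_chart C C) p \<in> \<Psi> ` W}"
  have rC: "snd C ` fst C = (snd c ` fst c) \<times> UNIV" unfolding C_def by (rule cotangent_chart_range[OF A c])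
  have rTC: "snd TC ` fst TC = (snd C ` fst C) \<times> UNIV"
    unfolding TC_def C_def[symmetric] by (rule tangent_chart_range[OF CA C])
  have imV1: "snd TC ` V1 = W"
    unfolding V1_def
  proof (rule chart_preimage_image, unfold rTC rC, rule subsetI)
    fix u assume "u \<in> W"
    then have "fst (swap4 u) \<in> Y" by (simp add: W_def lift_dom_def)
    then have "fst (fst (swap4 u)) \<in> snd c ` fst c" using Y(5) by (auto simp: mem_Times_iff)
    then show "u \<in> ((snd c ` fst c) \<times> UNIV) \<times> UNIV" by (simp add: swap4_def mem_Times_iff)
  qed
  have imD1: "snd (prod_chart C C) ` D1 = \<Psi> ` W"
    unfolding D1_def
  proof (rule chart_preimage_image, rule subsetI)
    have "\<Psi> ` W = {v. fst (sign4_inv v) \<in> r ` Y}"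
      unfolding \<Psi>_def W_def by (rule lift_coord_image[OF Y(1-3)])
    moreover fix v assume "v \<in> \<Psi> ` W"
    ultimately have "fst (sign4_inv v) \<in> r ` Y" by simp
    then have "fst (sign4_inv v) \<in> (snd c ` fst c) \<times> (snd c ` fst c)" using Y(6) by blast
    then have "v \<in> ((snd c ` fst c) \<times> UNIV) \<times> ((snd c ` fst c) \<times> UNIV)"
      by (simp add: sign4_inv_def mem_Times_iff)
    then show "v \<in> snd (prod_chart C C) ` fst (prod_chart C C)"
      unfolding fst_prod_chart prod_chart_image rC .
  qed
  have dif: "diffeomorphism (tangent_atlas ?CA) (prod_atlas ?CA ?CA) V1 D1 (cotangent_lift A R)"
  proof (rule diffeomorphism_chartI[OF TCA PCA TC PC])
    show "V1 \<subseteq> fst TC" "D1 \<subseteq> fst (prod_chart C C)" by (auto simp: V1_def D1_def)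
    show "cotangent_lift A R w \<in> fst (prod_chart C C) \<and>
      snd (prod_chart C C) (cotangent_lift A R w) = \<Psi> (snd TC w)" if "w \<in> V1" for w
      using lift1(1,2)[of w] that unfolding V1_def by blast
    show "snd (prod_chart C C) ` D1 = \<Psi> ` snd TC ` V1" unfolding imD1 imV1 ..
    show "smooth_on (snd TC ` V1) \<Psi>" unfolding imV1 by (rule sW)
    show "smooth_on (snd (prod_chart C C) ` D1) (\<lambda>v. swap4_inv (cot_lift s r (sign4_inv v)))"
      unfolding imD1 unfolding W_def \<Psi>_def by (rule smooth_on_lift_coord_inverse(1)[OF Y(1-3)])
    show "swap4_inv (cot_lift s r (sign4_inv (\<Psi> u))) = u" if "u \<in> snd TC ` V1" for u
      unfolding \<Psi>_def by (rule smooth_on_lift_coord_inverse(2)[OF Y(1-3)]) (use that imV1 W_def in simp)+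
  qed
  have dom: "V1 \<subseteq> cotangent_lift_dom A U R"
  proof
    fix w assume w: "w \<in> V1"
    then have "w \<in> points (tangent_atlas ?CA)" using TC by (auto simp: V1_def points_def simp del: fst_tangent_chart)
    moreover have "fst (alpha_map A w) \<in> V" using lift1(3)[of w] w by (simp add: V1_def)
    moreover have "V \<subseteq> U" using Y(7) by (auto simp: V_def)
    ultimately show "w \<in> cotangent_lift_dom A U R"
      unfolding cotangent_lift_dom_def using dR by blast
  qed
  show ?thesis
  proof (rule that[OF sW])
    show "(snd C z, 0) \<in> W" using Y(4) by (cases z) (simp add: W_def lift_dom_def swap4_def C_def)
    show "lift_invertible_on A U R {w \<in> fst TC. snd TC w \<in> W} D1"
      using dif dom unfolding lift_invertible_on_def V1_def by blast
    show "cotangent_lift A R w \<in> fst (prod_chart C C) \<and>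
       snd (prod_chart C C) (cotangent_lift A R w) = \<Psi> (snd TC w)" if "w \<in> fst TC" "snd TC w \<in> W" for w
      using lift1(1,2)[OF that] by blast
    show "\<Psi> (m, 0) = (m, m)" if "(m, 0) \<in> W" for m
      unfolding \<Psi>_def by (rule lift_coord_zero[OF Y(1-3,8,9)]) (use that W_def in simp)+
    show "sform (snd (FD \<Psi> u X)) (snd (FD \<Psi> u Z)) - sform (fst (FD \<Psi> u X)) (fst (FD \<Psi> u Z))
      = sform (swap4 X) (swap4 Z)" if "u \<in> W" for u X Z
      unfolding \<Psi>_def by (rule lift_coord_symplectic[OF Y(1-3)]) (use that W_def in simp)+
  qed
qed

section \<open>The integrator\<close>

lemma smooth_euclidean_atlas: "smooth_atlas (euclidean_atlas :: ('e::euclidean_space, 'e) atlas)"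
proof -
  have "chart_inv (UNIV, id :: 'e \<Rightarrow> 'e) = id" by (auto simp: chart_inv_def inv_id)
  then show ?thesis
    by (simp add: smooth_atlas_def euclidean_atlas_def id_def smooth_on_ident o_def)
qed

lemma function_in_chart:
  fixes H :: "'b \<Rightarrow> real"
  assumes B: "smooth_atlas B" and H: "smooth_map B euclidean_atlas (points B) H" and K: "K \<in> B"
  shows "smooth_on (snd K ` fst K) (H \<circ> chart_inv K)"
proof -
  have "smooth_on (snd K ` fst K) (snd (UNIV :: real set, id) \<circ> H \<circ> chart_inv K)"
    by (rule smooth_map_in_charts[OF B smooth_euclidean_atlas H K _ openin_chart_domain[OF B K]])
      (use K in \<open>auto simp: euclidean_atlas_def points_def\<close>)
  then show ?thesis by simp
qed


text \<open>The sets \<open>V\<close> and \<open>D\<close> are given in advance and are unrelated to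
  the chart domain of \<open>cotangent_lift_local_form\<close>. The proof works where both are
  available and translates between the given inverse and the coordinate map
  \<open>\<Psi>\<close>.\<close>

lemma symplectic_integrator_of_lift:
  fixes A :: "('a, 'e::euclidean_space) atlas"
  assumes A: "smooth_atlas A" and R: "discretization_map A U R"
    and H: "smooth_map (cotangent_atlas A) euclidean_atlas (points (cotangent_atlas A)) H"
    and L: "lift_invertible_on A U R V D" and z: "z \<in> points (cotangent_atlas A)" and zV: "(z, \<lambda>_. 0) \<in> V"
  shows "symplectic_integrator_at A (integrator_equation A (inv_into V (cotangent_lift A R)) D H) z"
proof -
  let ?CA = "cotangent_atlas A" and ?L = "cotangent_lift A R"
  note CA = smooth_cotangent_atlas[OF A]
  note TCA = smooth_tangent_atlas[OF CA] and PCA = smooth_prod_atlas[OF CA CA]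
  define c where "c = chart_at A (fst z)"
  have "fst z \<in> points A" using z by (auto simp: points_cotangent_atlas)
  then have c: "c \<in> A" "fst z \<in> fst c" unfolding c_def by (rule chart_at)+
  define C where "C = cotangent_chart A c"
  define TC where "TC = tangent_chart ?CA C"
  let ?PC = "prod_chart C C"
  have C: "C \<in> ?CA" unfolding C_def by (rule cotangent_chart_in_atlas[OF c(1)])
  have TC: "TC \<in> tangent_atlas ?CA" unfolding TC_def by (rule tangent_chart_in_atlas[OF C])
  have PC: "?PC \<in> prod_atlas ?CA ?CA" by (rule prod_chart_in_atlas[OF C C])
  have zC: "z \<in> fst C" using z c unfolding C_def by (auto simp: points_cotangent_atlas)
  define m0 where "m0 = snd C z"
  define M where "M = snd C ` fst C"
  have TCfst: "fst TC = Sigma (fst C) (tspace ?CA)" and TCsnd: "\<And>\<gamma> X. snd TC (\<gamma>, X) = (snd C \<gamma>, X C)"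
    by (auto simp: TC_def)
  have rTC: "snd TC ` fst TC = M \<times> UNIV"
    unfolding TC_def M_def by (rule tangent_chart_range[OF CA C])
  define \<eta> where "\<eta> = H \<circ> chart_inv C"
  have \<eta>: "smooth_on M \<eta>" unfolding M_def \<eta>_def by (rule function_in_chart[OF CA H C])
  have inv: "chart_inv C (snd C y) = y" if "y \<in> fst C" for y by (rule chart_inv_left[OF CA C that])
  have inv': "chart_inv C m \<in> fst C" "snd C (chart_inv C m) = m" if "m \<in> M" for m
    using chart_inv_right[of m C "fst C"] that by (auto simp: M_def)
  obtain W0 \<Psi> D0 where W0: "smooth_on W0 \<Psi>" "(m0, 0) \<in> W0"
    and "lift_invertible_on A U R {w \<in> fst TC. snd TC w \<in> W0} D0"
    and W0': "\<And>w. \<lbrakk>w \<in> fst TC; snd TC w \<in> W0\<rbrakk> \<Longrightarrow> ?L w \<in> fst ?PC \<and> snd ?PC (?L w) = \<Psi> (snd TC w)"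
    "\<And>m. (m, 0) \<in> W0 \<Longrightarrow> \<Psi> (m, 0) = (m, m)"
    "\<And>u X Y. u \<in> W0 \<Longrightarrow> sform (snd (FD \<Psi> u X)) (snd (FD \<Psi> u Y))
      - sform (fst (FD \<Psi> u X)) (fst (FD \<Psi> u Y)) = sform (swap4 X) (swap4 Y)"
    by (rule cotangent_lift_local_form[OF A R c(1) zC[unfolded C_def], folded C_def, folded TC_def m0_def])
      (rule that)
  have dL: "diffeomorphism (tangent_atlas ?CA) (prod_atlas ?CA ?CA) V D ?L"
    using L by (simp add: lift_invertible_on_def)
  then have bij: "bij_betw ?L V D" and sL: "smooth_map (tangent_atlas ?CA) (prod_atlas ?CA ?CA) V ?L"
    and sLi: "smooth_map (prod_atlas ?CA ?CA) (tangent_atlas ?CA) D (inv_into V ?L)"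
    by (auto simp: diffeomorphism_def)
  \<comment> \<open>\<open>W\<close> keeps only coordinates of vectors in \<open>V\<close>, where
    the given inverse undoes the lift.\<close>
  define W where "W = W0 \<inter> snd TC ` (V \<inter> fst TC)"
  have oVT: "openin (manifold_top (tangent_atlas ?CA)) (V \<inter> fst TC)"
    using smooth_map_openin[OF sL] openin_chart_domain[OF TCA TC] by blast
  then have oW: "open W"
    unfolding W_def using openin_chart[OF TCA TC, of "V \<inter> fst TC"] smooth_on_open[OF W0(1)] by auto
  have \<Psi>W: "smooth_on W \<Psi>" by (rule smooth_on_subset[OF W0(1) oW]) (simp add: W_def)
  have z0: "(z, \<lambda>_. 0) \<in> fst TC" "snd TC (z, \<lambda>_. 0) = (m0, 0)"
    using zC tspace_zero[OF CA] by (auto simp: TCfst TCsnd m0_def)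
  have m0W: "(m0, 0) \<in> W" "m0 \<in> M"
    using W0(2) z0 zV zC by (auto simp: W_def M_def m0_def intro!: image_eqI[of _ _ "(z, \<lambda>_. 0)"])
  have inV: "w \<in> V" if w: "w \<in> fst TC" "snd TC w \<in> W" for w
  proof -
    obtain w' where w': "w' \<in> V \<inter> fst TC" "snd TC w = snd TC w'" using w(2) by (auto simp: W_def)
    then have "w = w'" using inj_onD[OF chart_inj[OF TCA TC] w'(2) w(1)] by simp
    then show ?thesis using w' by simp
  qed
  have LW: "?L w \<in> fst ?PC" "snd ?PC (?L w) = \<Psi> (snd TC w)" if "w \<in> fst TC" "snd TC w \<in> W" for w
    using W0'(1)[OF that(1)] that(2) by (auto simp: W_def)
  have diag: "\<Psi> (m, 0) = (m, m)" if "(m, 0) \<in> W" for m using W0'(2) that by (simp add: W_def)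
  have symp: "sform (snd (FD \<Psi> u X)) (snd (FD \<Psi> u Y))
      - sform (fst (FD \<Psi> u X)) (fst (FD \<Psi> u Y)) = sform (swap4 X) (swap4 Y)" if "u \<in> W" for u X Y
    using W0'(3) that by (simp add: W_def)
  let ?X = "ham \<eta>"
  obtain N S and G :: "real \<times> ('e \<times> 'e) \<Rightarrow> 'e \<times> 'e" and a where
    N: "open N" "m0 \<in> N" "N \<subseteq> M" and G: "smooth_on S G" "(0, m0) \<in> S" "G (0, m0) = m0" and "a > 0"
    and GK: "\<And>h m. \<lbrakk>\<bar>h\<bar> < a; m \<in> N; (m, h *\<^sub>R ?X m) \<in> W\<rbrakk> \<Longrightarrow> G (h, fst (\<Psi> (m, h *\<^sub>R ?X m))) = m"
    and KG: "\<And>h z. (h, z) \<in> S \<Longrightarrow> \<bar>h\<bar> < a \<and> G (h, z) \<in> N \<and> (G (h, z), h *\<^sub>R ?X (G (h, z))) \<in> W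
       \<and> fst (\<Psi> (G (h, z), h *\<^sub>R ?X (G (h, z)))) = z"
    by (rule implicit_step[OF \<Psi>W diag smooth_on_ham[OF \<eta>] m0W]) (assumption | rule that)+
  define F where "F = (\<lambda>(h, \<zeta>). snd (\<Psi> (G (h, \<zeta>), h *\<^sub>R ?X (G (h, \<zeta>)))))"
  define w_of where "w_of = (\<lambda>h m. (chart_inv C m, tvec_of ?CA C (chart_inv C m) (h *\<^sub>R ?X m)))"
  have w_of: "w_of h m \<in> fst TC" "snd TC (w_of h m) = (m, h *\<^sub>R ?X m)" if "m \<in> M" for h m
    using inv'[OF that] tvec_of_in_tspace[OF CA C] tvec_of_same[OF CA C]
    by (auto simp: w_of_def TCfst TCsnd)
  have field: "omega_sharp A (\<gamma>, \<lambda>Y. h * differential ?CA H \<gamma> Y) = w_of h (snd C \<gamma>)" if \<gamma>: "\<gamma> \<in> fst C" for \<gamma> h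
  proof -
    have "\<eta> differentiable (at (snd C \<gamma>))"
      by (rule smooth_on_differentiable[OF \<eta>]) (use \<gamma> in \<open>simp add: M_def\<close>)
    then show ?thesis
      using ham_vector_field_in_chart[OF A c(1), of \<gamma> H h] \<gamma> inv[OF \<gamma>]
      by (simp add: C_def[symmetric] \<eta>_def w_of_def del: fst_cotangent_chart)
  qed
  \<comment> \<open>These are the vectors whose coordinates meet the conditions of the uniqueness
    statement \<open>GK\<close>.\<close>
  define \<Omega> where "\<Omega> = {w \<in> V \<inter> fst TC. snd TC w \<in> W \<inter> N \<times> UNIV}"
  have o\<Omega>: "openin (manifold_top (tangent_atlas ?CA)) \<Omega>"
  proof -
    have "{w \<in> V \<inter> fst TC. snd TC w \<in> W \<inter> N \<times> UNIV} = {w \<in> fst TC. snd TC w \<in> W \<inter> N \<times> UNIV}"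
      using inV by blast
    then have "snd TC ` \<Omega> = W \<inter> N \<times> UNIV"
      unfolding \<Omega>_def by (simp only:) (rule chart_preimage_image, unfold rTC, use N(3) in blast)
    then have "open (snd TC ` \<Omega>)" using oW N(1) by (simp add: open_Times open_Int)
    then show ?thesis using openin_chart[OF TCA TC, of \<Omega>] by (simp add: \<Omega>_def subset_iff)
  qed
  \<comment> \<open>These are the pairs whose preimage under the lift lies in
    \<open>\<Omega>\<close>. Continuity of the inverse makes \<open>B\<close> a neighborhood of
    \<open>(z, z)\<close>, so a product of neighborhoods inside it keeps every solution with both
    ends there within reach of \<open>GK\<close>.\<close>
  define B where "B = {p \<in> D. inv_into V ?L p \<in> \<Omega>} \<inter> fst ?PC"
  have oB: "open (snd ?PC ` B)"
  proof -
    have "openin (manifold_top (prod_atlas ?CA ?CA)) B"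
      unfolding B_def using smooth_map_preimage[OF PCA TCA sLi o\<Omega>] openin_chart_domain[OF PCA PC] by blast
    then show ?thesis using openin_chart[OF PCA PC, of B] by (simp add: B_def del: fst_prod_chart)
  qed
  have inB: "p \<in> B" if p: "p \<in> fst ?PC" "snd ?PC p \<in> snd ?PC ` B" for p
  proof -
    obtain p' where p': "p' \<in> B" "snd ?PC p = snd ?PC p'" using p(2) by auto
    then have "p' \<in> fst ?PC" by (simp add: B_def)
    from inj_onD[OF chart_inj[OF PCA PC] p'(2) p(1) this] show ?thesis using p'(1) by simp
  qed
  have Rinv: "inv_into V ?L (?L w) = w" "?L w \<in> D" if "w \<in> V" for w
    using bij that by (auto simp: bij_betw_def)
  have "(m0, m0) \<in> snd ?PC ` B"
  proof (rule image_eqI)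
    have "snd ?PC (?L (z, \<lambda>_. 0)) = \<Psi> (snd TC (z, \<lambda>_. 0))" by (rule LW(2)) (use z0 m0W in simp_all)
    then show "(m0, m0) = snd ?PC (?L (z, \<lambda>_. 0))" using z0(2) diag[OF m0W(1)] by simp
    have "?L (z, \<lambda>_. 0) \<in> fst ?PC" by (rule LW(1)) (use z0 m0W in simp_all)
    then show "?L (z, \<lambda>_. 0) \<in> B" using Rinv[OF zV] zV z0 m0W N(2) by (simp add: B_def \<Omega>_def)
  qed
  from open_prod_elim[OF oB this] obtain W1 W1' where "open W1" "open W1'" "(m0, m0) \<in> W1 \<times> W1'"
    "W1 \<times> W1' \<subseteq> snd ?PC ` B" .
  then have W1: "open W1" "m0 \<in> W1" "open W1'" "m0 \<in> W1'" "W1 \<times> W1' \<subseteq> snd ?PC ` B" by auto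
  have W1M: "W1 \<subseteq> M" "W1' \<subseteq> M"
  proof -
    have "snd ?PC ` B \<subseteq> M \<times> M" by (auto simp: B_def M_def snd_prod_chart')
    then show "W1 \<subseteq> M" "W1' \<subseteq> M" using W1 by blast+
  qed
  have Fs: "smooth_on S F"
  proof -
    have S: "open S" by (rule smooth_on_open[OF G(1)])
    have "smooth_on S (\<lambda>y. ?X (G y))"
      by (rule smooth_on_compose[OF smooth_on_ham[OF \<eta>] G(1)]) (use KG N(3) in fastforce)
    then have "smooth_on S (\<lambda>y. (G y, fst y *\<^sub>R ?X (G y)))"
      by (intro smooth_on_Pair G(1) smooth_on_bilinear[OF bounded_bilinear_scaleR] smooth_on_fst smooth_on_ident S)
    from smooth_on_snd[OF smooth_on_compose[OF \<Psi>W this]]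
    have "smooth_on S (\<lambda>y. snd (\<Psi> (G y, fst y *\<^sub>R ?X (G y))))" using KG by auto
    then show ?thesis by (rule smooth_on_cong) (auto simp: F_def)
  qed
  \<comment> \<open>At h = 0 the constructed end point of \<open>m0\<close> is \<open>m0\<close>
    itself; continuity of \<open>F\<close> keeps the end point in \<open>W1'\<close> for all small h
    and all nearby starting points.\<close>
  have oF: "open (S \<inter> F -` W1')"
    by (rule continuous_open_preimage[OF smooth_on_continuous_on[OF Fs] smooth_on_open[OF G(1)] W1(3)])
  have "(0, m0) \<in> S \<inter> F -` W1'"
    using G(2,3) W1(4) diag[OF m0W(1)] by (simp add: F_def)
  from open_prod_elim[OF oF this] obtain I Wc' where "open I" "open Wc'" "(0, m0) \<in> I \<times> Wc'"
    "I \<times> Wc' \<subseteq> S \<inter> F -` W1'" .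
  then have I: "open I" "0 \<in> I" "open Wc'" "m0 \<in> Wc'" "I \<times> Wc' \<subseteq> S \<inter> F -` W1'" by auto
  obtain h0 where h0: "h0 > 0" "ball 0 h0 \<subseteq> I" using openE[OF I(1,2)] by blast
  have box: "(h, \<zeta>) \<in> S" "F (h, \<zeta>) \<in> W1'" if "0 < h" "h < h0" "\<zeta> \<in> Wc'" for h \<zeta>
  proof -
    have "h \<in> I" using h0(2) that by (simp add: subset_iff)
    then have "(h, \<zeta>) \<in> S \<inter> F -` W1'" using I(5) that(3) by blast
    then show "(h, \<zeta>) \<in> S" "F (h, \<zeta>) \<in> W1'" by simp_all
  qed
  \<comment> \<open>Starting points have to satisfy both conditions: \<open>Wc'\<close> provides the
    existence of the step, \<open>W1\<close> its uniqueness.\<close>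
  define Wc where "Wc = Wc' \<inter> W1"
  have Wc: "open Wc" "m0 \<in> Wc" "Wc \<subseteq> M" using I W1 W1M by (auto simp: Wc_def)
  define WW where "WW = {y \<in> fst C. snd C y \<in> Wc}"
  define WW' where "WW' = {y \<in> fst C. snd C y \<in> W1'}"
  have imWW: "snd C ` WW = Wc" "snd C ` WW' = W1'"
    unfolding WW_def WW'_def by (rule chart_preimage_image; use Wc(3) W1M in \<open>simp add: M_def\<close>)+
  have oWW: "openin (manifold_top ?CA) WW" "openin (manifold_top ?CA) WW'"
    using openin_chart[OF CA C, of WW] openin_chart[OF CA C, of WW'] imWW Wc(1) W1(3)
    by (auto simp: WW_def WW'_def)
  let ?E = "integrator_equation A (inv_into V ?L) D H"
  define \<phi> where "\<phi> = (\<lambda>h z0. chart_inv C (F (h, snd C z0)))"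
  have step: "\<phi> h z0 \<in> WW' \<and> ?E h z0 (\<phi> h z0)" "\<And>z1. z1 \<in> WW' \<and> ?E h z0 z1 \<Longrightarrow> z1 = \<phi> h z0"
    if h: "0 < h" "h < h0" and z0: "z0 \<in> WW" for h z0
  proof -
    define \<zeta> where "\<zeta> = snd C z0"
    have \<zeta>: "\<zeta> \<in> Wc" "z0 \<in> fst C" using z0 by (auto simp: WW_def \<zeta>_def)
    have hS: "(h, \<zeta>) \<in> S" "F (h, \<zeta>) \<in> W1'" using box[OF h] \<zeta>(1) by (simp_all add: Wc_def)
    define m where "m = G (h, \<zeta>)"
    have m: "\<bar>h\<bar> < a" "m \<in> N" "(m, h *\<^sub>R ?X m) \<in> W" "fst (\<Psi> (m, h *\<^sub>R ?X m)) = \<zeta>"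
      "snd (\<Psi> (m, h *\<^sub>R ?X m)) = F (h, \<zeta>)"
      using KG[OF hS(1)] by (auto simp: m_def F_def)
    have mM: "m \<in> M" using m N(3) by blast
    note w = w_of[OF mM, of h]
    have wV: "w_of h m \<in> V" by (rule inV[OF w(1)]) (use w(2) m(3) in simp)
    have "snd ?PC (?L (w_of h m)) = (\<zeta>, F (h, \<zeta>))"
      using LW(2)[OF w(1)] w(2) m by (simp add: prod_eq_iff)
    moreover have LwP: "?L (w_of h m) \<in> fst ?PC" using LW(1)[OF w(1)] w(2) m(3) by simp
    moreover obtain y0 y1 where y: "?L (w_of h m) = (y0, y1)" by (metis surj_pair)
    ultimately have y01: "y0 \<in> fst C" "y1 \<in> fst C" "snd C y0 = \<zeta>" "snd C y1 = F (h, \<zeta>)" by auto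
    have y0: "y0 = z0" using inj_onD[OF chart_inj[OF CA C], of y0 z0] y01 \<zeta> by (simp add: \<zeta>_def)
    have y1: "y1 = \<phi> h z0" using inv[OF y01(2)] y01(4) by (simp add: \<phi>_def \<zeta>_def)
    have inD: "(z0, \<phi> h z0) \<in> D" and Ri: "inv_into V ?L (z0, \<phi> h z0) = w_of h m"
      using Rinv[OF wV] y y0 y1 by auto
    have "chart_inv C m \<in> fst C" "snd C (chart_inv C m) = m" using inv'[OF mM] by auto
    then have "?E h z0 (\<phi> h z0)"
      using field[of "chart_inv C m" h] inD Ri by (simp add: integrator_equation_def Let_def w_of_def)
    moreover have "\<phi> h z0 \<in> WW'" using y01 hS(2) y1 by (simp add: WW'_def)
    ultimately show "\<phi> h z0 \<in> WW' \<and> ?E h z0 (\<phi> h z0)" by blast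
    fix z1 assume z1: "z1 \<in> WW' \<and> ?E h z0 z1"
    then have z1C: "z1 \<in> fst C" "snd C z1 \<in> W1'" by (auto simp: WW'_def)
    \<comment> \<open>Any solution is the lift of a vector \<open>v\<close> that equals the scaled
      Hamiltonian field at its own base point. Once \<open>v\<close> lies in
      \<open>\<Omega>\<close>, \<open>GK\<close> identifies this base point as the value of
      \<open>G\<close>, which determines \<open>z1\<close>.\<close>
    define v where "v = inv_into V ?L (z0, z1)"
    have zD: "(z0, z1) \<in> D" and v: "v = omega_sharp A (fst v, \<lambda>Y. h * differential ?CA H (fst v) Y)"
      using z1 by (auto simp: integrator_equation_def Let_def v_def)
    have "(z0, z1) \<in> B"
    proof (rule inB)
      show "(z0, z1) \<in> fst ?PC" using \<zeta>(2) z1C by simp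
      have "(\<zeta>, snd C z1) \<in> W1 \<times> W1'" using \<zeta>(1) z1C by (simp add: Wc_def)
      then show "snd ?PC (z0, z1) \<in> snd ?PC ` B" using W1(5) by (auto simp: \<zeta>_def)
    qed
    then have v\<Omega>: "v \<in> \<Omega>" by (simp add: B_def v_def)
    then have vTC: "v \<in> fst TC" "snd TC v \<in> W" "fst (snd TC v) \<in> N" by (auto simp: \<Omega>_def)
    have vC: "fst v \<in> fst C" using vTC(1) by (cases v) (auto simp: TCfst)
    define m' where "m' = snd C (fst v)"
    have vw: "v = w_of h m'" using v field[OF vC, of h] by (simp add: m'_def)
    have m'M: "m' \<in> M" using vC by (simp add: m'_def M_def)
    have sv: "snd TC v = (m', h *\<^sub>R ?X m')" using w_of(2)[OF m'M] vw by simp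
    have Lv: "?L v = (z0, z1)" unfolding v_def using bij zD by (simp add: bij_betw_def f_inv_into_f)
    have e: "\<Psi> (m', h *\<^sub>R ?X m') = (\<zeta>, snd C z1)"
      using LW(2)[OF vTC(1,2)] sv Lv by (simp add: \<zeta>_def)
    have "G (h, fst (\<Psi> (m', h *\<^sub>R ?X m'))) = m'"
      by (rule GK) (use m(1) vTC sv in auto)
    then have "G (h, \<zeta>) = m'" using e by simp
    then have "snd C z1 = F (h, \<zeta>)" using e by (simp add: F_def)
    then show "z1 = \<phi> h z0" using inv[OF z1C(1)] by (simp add: \<phi>_def \<zeta>_def)
  qed
  show ?thesis
    unfolding symplectic_integrator_at_def
  proof (intro exI conjI allI impI)
    show "openin (manifold_top ?CA) WW" "openin (manifold_top ?CA) WW'" using oWW by auto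
    show "z \<in> WW" "z \<in> WW'" using zC Wc(2) W1(4) by (auto simp: WW_def WW'_def m0_def)
    show "h0 > 0" by (rule h0)
    fix h assume "0 < h \<and> h < h0"
    then have h: "0 < h" "h < h0" by auto
    show "\<forall>z0\<in>WW. \<exists>!z1. z1 \<in> WW' \<and> ?E h z0 z1" using step[OF h] by blast
    \<comment> \<open>The one-step map in \<open>symplectic_integrator_at\<close> is given by
      \<open>THE\<close>; on \<open>WW\<close> it coincides with \<open>\<phi> h\<close>, whose
      coordinate expression is \<open>\<psi>\<close>.\<close>
    define \<theta> where "\<theta> = (\<lambda>z0. THE z1. z1 \<in> WW' \<and> ?E h z0 z1)"
    have \<theta>: "\<theta> z0 = \<phi> h z0" if "z0 \<in> WW" for z0
      unfolding \<theta>_def by (rule the_equality) (use step[OF h that] in blast)+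
    have \<theta>C: "\<theta> y \<in> fst C" if "y \<in> WW" for y
      using step(1)[OF h that] \<theta>[OF that] by (simp add: WW'_def)
    have hS: "(h, \<zeta>) \<in> S" "F (h, \<zeta>) \<in> W1'" if "\<zeta> \<in> Wc" for \<zeta>
      using box[OF h] that by (simp_all add: Wc_def)
    have Gh: "smooth_on Wc (\<lambda>\<zeta>. G (h, \<zeta>))"
      by (rule smooth_on_compose[OF G(1)]) (use hS Wc(1) in \<open>auto intro: smooth_on_intros\<close>)
    define \<psi> where "\<psi> = (\<lambda>\<zeta>. snd (\<Psi> (G (h, \<zeta>), h *\<^sub>R ?X (G (h, \<zeta>)))))"
    have GT: "G (h, \<zeta>) \<in> M \<and> (G (h, \<zeta>), h *\<^sub>R ?X (G (h, \<zeta>))) \<in> W \<and> fst (\<Psi> (G (h, \<zeta>), h *\<^sub>R ?X (G (h, \<zeta>)))) = \<zeta>"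
      if "\<zeta> \<in> Wc" for \<zeta>
      using KG[OF hS(1)[OF that]] N(3) by blast
    note sy = implicit_step_symplectic[OF \<Psi>W symp \<eta> Gh GT, folded \<psi>_def]
    have \<psi>s: "smooth_on Wc \<psi>" by (rule sy(1)) (use Wc(2) in auto)
    have rep: "\<psi> u = (snd C \<circ> \<theta> \<circ> chart_inv C) u" if u: "u \<in> Wc" for u
    proof -
      have "chart_inv C u \<in> WW" "snd C (chart_inv C u) = u" using inv'[of u] u Wc(3) by (auto simp: WW_def)
      then have "\<theta> (chart_inv C u) = chart_inv C (F (h, u))" using \<theta> by (simp add: \<phi>_def)
      moreover have "F (h, u) \<in> M" using hS(2)[OF u] W1M by blast
      ultimately show ?thesis using inv'(2)[of "F (h, u)"] by (simp add: \<psi>_def F_def)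
    qed
    have sm: "smooth_map ?CA ?CA WW \<theta>"
    proof (rule smooth_map_chartI[OF CA C C])
      show "WW \<subseteq> fst C" "\<theta> ` WW \<subseteq> fst C" using \<theta>C by (auto simp: WW_def)
      show "smooth_on (snd C ` WW) (snd C \<circ> \<theta> \<circ> chart_inv C)"
        unfolding imWW by (rule smooth_on_cong[OF \<psi>s rep])
    qed
    have om: "omega A (\<theta> z0) (tmap ?CA ?CA \<theta> z0 X) (tmap ?CA ?CA \<theta> z0 Y) = omega A z0 X Y"
      if z0: "z0 \<in> WW" and X: "X \<in> tspace ?CA z0" and Y: "Y \<in> tspace ?CA z0" for z0 X Y
    proof -
      have z0C: "z0 \<in> fst C" "snd C z0 \<in> Wc" using z0 by (auto simp: WW_def)
      have dif: "(snd C \<circ> \<theta> \<circ> chart_inv C) differentiable (at (snd C z0))"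
        by (rule smooth_map_differentiable[OF CA CA sm C C z0 z0C(1) \<theta>C[OF z0]])
      have FDr: "FD (snd C \<circ> \<theta> \<circ> chart_inv C) (snd C z0) = FD \<psi> (snd C z0)"
        by (rule FD_cong_open[OF Wc(1) z0C(2)]) (simp add: rep)
      have tm: "tmap ?CA ?CA \<theta> z0 Z C = FD \<psi> (snd C z0) (Z C)" if "Z \<in> tspace ?CA z0" for Z
        using tmap_in_chart[where F = \<theta>, OF CA C z0C(1) C \<theta>C[OF z0] that dif] FDr by simp
      have tin: "tmap ?CA ?CA \<theta> z0 Z \<in> tspace ?CA (\<theta> z0)" if "Z \<in> tspace ?CA z0" for Z
        by (rule tmap_in_tspace[OF CA CA sm z0 that])
      have cot: "fst y \<in> fst c" "snd y \<in> cotspace A (fst y)" if "y \<in> fst C" for y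
        using that by (auto simp: C_def)
      have "omega A (\<theta> z0) (tmap ?CA ?CA \<theta> z0 X) (tmap ?CA ?CA \<theta> z0 Y)
        = sform (FD \<psi> (snd C z0) (X C)) (FD \<psi> (snd C z0) (Y C))"
        using omega_in_chart[OF A c(1) cot[OF \<theta>C[OF z0]] tin[OF X] tin[OF Y], folded C_def] tm[OF X] tm[OF Y] by simp
      also have "\<dots> = sform (X C) (Y C)"
        by (rule sy(2)) (use z0C(2) in auto)
      also have "\<dots> = omega A z0 X Y"
        using omega_in_chart[OF A c(1) cot[OF z0C(1)] X Y, folded C_def] by simp
      finally show ?thesis .
    qed
    show "let \<phi> = (\<lambda>z0. THE z1. z1 \<in> WW' \<and> ?E h z0 z1)
      in smooth_map ?CA ?CA WW \<phi> \<and> (\<forall>z0\<in>WW. \<forall>X\<in>tspace ?CA z0. \<forall>Y\<in>tspace ?CA z0.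
           omega A (\<phi> z0) (tmap ?CA ?CA \<phi> z0 X) (tmap ?CA ?CA \<phi> z0 Y) = omega A z0 X Y)"
      unfolding Let_def \<theta>_def[symmetric] using sm om by blast
  qed
qed

text \<open>The first conjunct provides local inverses around every zero vector, so that the second,
  which treats all of them, is not vacuous.\<close>

theorem proposition5p1:
  fixes Q :: "('a, 'e::euclidean_space) atlas"
    and U :: "('a, 'e) tangent set"
    and R :: "('a, 'e) tangent \<Rightarrow> 'a \<times> 'a"
    and H :: "('a, 'e) cotangent \<Rightarrow> real"
  assumes "smooth_manifold Q"
    and "discretization_map Q U R"
    and "smooth_map (cotangent_atlas Q) euclidean_atlas (points (cotangent_atlas Q)) H"
  shows "(\<forall>z\<in>points (cotangent_atlas Q).
            \<exists>V D. (z, \<lambda>_. 0) \<in> V \<and> lift_invertible_on Q U R V D) \<and>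
         (\<forall>V D. lift_invertible_on Q U R V D \<longrightarrow>
            (\<forall>z\<in>points (cotangent_atlas Q). (z, \<lambda>_. 0) \<in> V \<longrightarrow>
               symplectic_integrator_at Q
                 (integrator_equation Q (inv_into V (cotangent_lift Q R)) D H) z))"
proof (intro conjI ballI allI impI)
  have A: "smooth_atlas Q" using assms(1) by (simp add: smooth_manifold_def)
  fix z assume z: "z \<in> points (cotangent_atlas Q)"
  then have "fst z \<in> points Q" by (auto simp: points_cotangent_atlas)
  then have c: "chart_at Q (fst z) \<in> Q" "fst z \<in> fst (chart_at Q (fst z))" by (rule chart_at)+
  let ?C = "cotangent_chart Q (chart_at Q (fst z))"
  have zC: "z \<in> fst ?C" using z c by (auto simp: points_cotangent_atlas)
  let ?TC = "tangent_chart (cotangent_atlas Q) ?C"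
  have "(z, \<lambda>_. 0) \<in> fst ?TC"
    using zC tspace_zero[OF smooth_cotangent_atlas[OF A]] by simp
  then have z0: "(z, \<lambda>_. 0) \<in> fst ?TC" "snd ?TC (z, \<lambda>_. 0) = (snd ?C z, 0)" by simp_all
  obtain W and \<Psi> :: "('e \<times> 'e) \<times> ('e \<times> 'e) \<Rightarrow> ('e \<times> 'e) \<times> ('e \<times> 'e)" and D
    where "(snd ?C z, 0) \<in> W" "lift_invertible_on Q U R {w \<in> fst ?TC. snd ?TC w \<in> W} D"
    by (rule cotangent_lift_local_form[OF A assms(2) c(1) zC]) (rule that)
  then show "\<exists>V D. (z, \<lambda>_. 0) \<in> V \<and> lift_invertible_on Q U R V D"
    using z0 by (intro exI[of _ "{w \<in> fst ?TC. snd ?TC w \<in> W}"] exI[of _ D]) auto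
next
  fix V D z assume "lift_invertible_on Q U R V D" "z \<in> points (cotangent_atlas Q)" "(z, \<lambda>_. 0) \<in> V"
  then show "symplectic_integrator_at Q (integrator_equation Q (inv_into V (cotangent_lift Q R)) D H) z"
    using symplectic_integrator_of_lift assms by (metis smooth_manifold_def)
qed

end
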